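(* Let $\mathbb{F}$ be the Fano plane. There exist constants $N_0$ and $c_{\mathbb{F}}>0$ such that for all integers $n\ge N_0$ and all integers $t\in[0,c_{\mathbb{F}}n]$ we have \[ \mathrm{EX}(n,(t+1)\mathbb{F})=\{K_t^3\bowtie B_3(n-t)\}. \]
   Context: The Fano plane $\mathbb{F}$ is the $3$-graph on $\{1,\dots,7\}$ with edges $\{123,345,561,174,275,376,246\}$. $B_3(n)$ is the $3$-graph on $[n]=V_1\cup V_2$ with $|V_1|=\lfloor n/2\rfloor$, $|V_2|=\lceil n/2\rceil$, whose edges are all triples meeting both $V_1$ and $V_2$. $K_t^3$ is the complete $3$-graph on $t$ vertices. For $r$-graphs $\mathcal{G},\mathcal{H}$ on disjoint vertex sets, $\mathcal{G}\bowtie\mathcal{H}$ consists of all edges of $\mathcal{G}$ and $\mathcal{H}$ plus all $r$-subsets of $V(\mathcal{G})\cup V(\mathcal{H})$ meeting both. $\mathrm{EX}(n,(t+1)F)$ is the set (up to isomorphism) of $n$-vertex $r$-graphs not containing $t+1$ pairwise vertex-disjoint copies of $F$ with the maximum number of edges among such. *)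

theory Defs
  imports Complex_Main "HOL-Library.Disjoint_Sets"
begin

type_synonym 'a hypergraph = "'a set \<times> 'a set set"

abbreviation hverts :: "'a hypergraph \<Rightarrow> 'a set" where
  "hverts G \<equiv> fst G"

abbreviation hedges :: "'a hypergraph \<Rightarrow> 'a set set" where
  "hedges G \<equiv> snd G"

definition rgraph :: "nat \<Rightarrow> 'a hypergraph \<Rightarrow> bool" where
  "rgraph r G \<longleftrightarrow> finite (hverts G) \<and> (\<forall>e\<in>hedges G. e \<subseteq> hverts G \<and> card e = r)"

definition hyper_iso :: "'a hypergraph \<Rightarrow> 'b hypergraph \<Rightarrow> bool" where
  "hyper_iso G H \<longleftrightarrow>
     (\<exists>f. bij_betw f (hverts G) (hverts H) \<and> (\<lambda>e. f ` e) ` hedges G = hedges H)"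

text \<open>Every finite hypergraph, over whatever vertex type, has isomorphic copies on natural numbers,
  so its isomorphism type can be represented by the set of those copies.\<close>

definition iso_class :: "'a hypergraph \<Rightarrow> nat hypergraph set" where
  "iso_class G = {H. hyper_iso G H}"

definition subhypergraph :: "'a hypergraph \<Rightarrow> 'a hypergraph \<Rightarrow> bool" where
  "subhypergraph C G \<longleftrightarrow> hverts C \<subseteq> hverts G \<and> hedges C \<subseteq> hedges G"

text \<open>Copies are subgraphs that need not be induced.\<close>

definition contains_disjoint_copies :: "nat \<Rightarrow> 'b hypergraph \<Rightarrow> 'a hypergraph \<Rightarrow> bool" where
  "contains_disjoint_copies k F G \<longleftrightarrow>
     (\<exists>C :: nat \<Rightarrow> 'a hypergraph.
        (\<forall>i<k. subhypergraph (C i) G \<and> hyper_iso F (C i)) \<and>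
        disjoint_family_on (\<lambda>i. hverts (C i)) {..<k})"

definition copies_free :: "nat \<Rightarrow> nat \<Rightarrow> nat \<Rightarrow> 'b hypergraph \<Rightarrow> nat hypergraph set" where
  "copies_free r n k F =
     {G. rgraph r G \<and> card (hverts G) = n \<and> \<not> contains_disjoint_copies k F G}"

text \<open>The extremal \<open>r\<close>-graphs on \<open>n\<close> vertices without \<open>k\<close> pairwise vertex-disjoint copies
  of \<open>F\<close>, as a set of isomorphism types.\<close>

definition Extremal :: "nat \<Rightarrow> nat \<Rightarrow> nat \<Rightarrow> 'b hypergraph \<Rightarrow> nat hypergraph set set" where
  "Extremal r n k F =
     iso_class ` {G \<in> copies_free r n k F.
       \<forall>H \<in> copies_free r n k F. card (hedges H) \<le> card (hedges G)}"

definition Fano :: "nat hypergraph" where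
  "Fano = ({1..7},
     {{1,2,3}, {3,4,5}, {5,6,1}, {1,7,4}, {2,7,5}, {3,7,6}, {2,4,6}})"

definition complete_rgraph :: "nat \<Rightarrow> nat \<Rightarrow> nat hypergraph" where
  "complete_rgraph r t = ({1..t}, {e. e \<subseteq> {1..t} \<and> card e = r})"

definition B3 :: "nat \<Rightarrow> nat hypergraph" where
  "B3 n = ({1..n},
     {e. e \<subseteq> {1..n} \<and> card e = 3 \<and>
         e \<inter> {1..n div 2} \<noteq> {} \<and> e \<inter> {n div 2 + 1..n} \<noteq> {}})"

text \<open>The sum type makes the two vertex sets disjoint.\<close>

definition hjoin :: "nat \<Rightarrow> 'a hypergraph \<Rightarrow> 'b hypergraph \<Rightarrow> ('a + 'b) hypergraph" where
  "hjoin r G H = (hverts G <+> hverts H,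
     (\<lambda>e. Inl ` e) ` hedges G \<union> (\<lambda>e. Inr ` e) ` hedges H \<union>
     {e. e \<subseteq> hverts G <+> hverts H \<and> card e = r \<and>
         e \<inter> Inl ` hverts G \<noteq> {} \<and> e \<inter> Inr ` hverts H \<noteq> {}})"

end

theory Submission
  imports Defs
begin

text \<open>In a Fano-free 3-graph of minimum degree close to \<open>3/8 n\<^sup>2\<close> one finds a tetrahedron \<open>S\<close> containing a
  pair of large codegree. Colour each pair of vertices by the elements of \<open>S\<close> that extend it to an edge.
  Three distinct colours occurring on both edges of the three perfect matchings of a 4-set would form
  a Fano plane, since removing a line from it leaves a 4-set whose perfect matchings correspond to the points of the line.
  This restriction forces almost every pair to be coloured as in a balanced bipartition \<open>X, Y\<close>, with
  all four colours across. If two vertices see almost all of \<open>X \<times> Y\<close>, every vertex in an edge with both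
  misses almost all pairs inside \<open>X\<close> or almost all inside \<open>Y\<close>, because a pair in each would complete a
  Fano plane. This property spreads to all vertices, and an edge of three vertices of the same type
  again gives a Fano plane. So the 3-graph is exactly two-colourable.

  Maximising \<open>e(W) - \<alpha> |W|\<^sup>3\<close> over vertex sets \<open>W\<close>, with \<open>\<alpha>\<close> slightly below \<open>1/8\<close>, supplies the minimum
  degree. It yields the Turan theorem for the Fano plane, and that no vertex of an almost extremal
  Fano-free 3-graph has degree much above \<open>3/8 n\<^sup>2\<close>.

  For \<open>t + 1\<close> disjoint copies use induction on \<open>t\<close>. A vertex of degree much above \<open>3/8 n\<^sup>2\<close> lies in
  a Fano plane avoiding any \<open>t\<close> given copies, so it can be removed together with one copy. If there
  is no such vertex, deleting a maximal packing of at most \<open>t\<close> copies costs too few edges to reach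
  the size of the join of a complete 3-graph on \<open>t\<close> vertices with a balanced bipartite one.\<close>

section \<open>Systems of distinct representatives and greedy weight bounds\<close>

text \<open>Four links of density 3/4 give the pairs an average weight of 3, and 3 is also the
  largest average, up to lower order terms, that the four-point restriction allows. The colouring is
  thus nearly extremal, and stability arguments apply. The obstacle is that they leave an error
  while the conclusion is exact. The constants are fixed backwards: an edge inside a class is
  excluded because 6/100 < 1/16; each passage through an edge counts quadruples and costs a square
  root of four times the error, which leads from 1/100 back to 2/10^5 and from there to 844/10^14;
  this last error is linear in e = 1/10^14, and e^2 has to absorb 4 \<epsilon>, whence \<epsilon> =
  1/10^29. In the packing argument a copy has seven vertices, each of degree at most (3/8 + 1/100)
  n^2, so a copy exceeds the loss of the bipartite bound by at most 7 (1/100 + 1/1000) n^2 = 77/1000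
  n^2. This has to stay below the gain of nearly n^2 / 8 per vertex of the complete part.\<close>

lemma not_subset_card_less:
  assumes "finite B" "card B < card A"
  shows "\<not> A \<subseteq> B"
  using card_mono[OF assms(1)] assms(2) by (meson leD)

lemma sdr_exists:
  assumes "card A \<ge> 1" "card B \<ge> 2" "card C \<ge> 3"
  shows "\<exists>i\<in>A. \<exists>j\<in>B. \<exists>k\<in>C. i \<noteq> j \<and> i \<noteq> k \<and> j \<noteq> k"
proof -
  obtain i where i: "i \<in> A" using assms(1) by (metis card.empty all_not_in_conv not_one_le_zero)
  have "\<not> B \<subseteq> {i}" using assms(2) by (intro not_subset_card_less) auto
  then obtain j where j: "j \<in> B" "j \<noteq> i" by auto
  have "\<not> C \<subseteq> {i, j}" using assms(3) j by (intro not_subset_card_less) auto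
  then obtain k where "k \<in> C" "k \<noteq> i" "k \<noteq> j" by auto
  with i j show ?thesis by metis
qed

text \<open>Hall's condition for three 2-sets fails only if all three coincide, so one inequality is
  enough.\<close>

lemma sdr_pairs:
  assumes "card A = 2" "card B = 2" "card C = 2" "A \<noteq> B"
  shows "\<exists>i\<in>A. \<exists>j\<in>B. \<exists>k\<in>C. i \<noteq> j \<and> i \<noteq> k \<and> j \<noteq> k"
proof -
  have fin: "finite A" "finite B" "finite C" using assms by (metis card.infinite zero_neq_numeral)+
  have "\<not> B \<subseteq> A" using card_subset_eq[OF fin(1), of B] assms by auto
  then obtain j where j: "j \<in> B" "j \<notin> A" by auto
  have ne: "\<not> D \<subseteq> {d}" if "card D = 2" for D and d :: 'a
    using that by (intro not_subset_card_less) auto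
  show ?thesis
  proof (cases "C = A")
    case True
    obtain i where i: "i \<in> A" using ne[OF assms(1)] by blast
    obtain k where "k \<in> A" "k \<noteq> i" using ne[OF assms(1)] by blast
    then show ?thesis using True i j by metis
  next
    case False
    then have "\<not> C \<subseteq> A" using card_subset_eq[OF fin(1), of C] assms by auto
    then obtain k where k: "k \<in> C" "k \<notin> A" by auto
    obtain j where j: "j \<in> B" "j \<noteq> k" using ne[OF assms(2)] by blast
    obtain i where i: "i \<in> A" "i \<noteq> j" using ne[OF assms(1)] by blast
    then show ?thesis using k j by metis
  qed
qed

text \<open>Repeatedly remove a block of at most four vertices to which every other vertex sends
  total weight at most \<open>\<kappa>\<close> per block vertex.\<close>

lemma greedy_weight_bound:
  fixes f :: "'a \<Rightarrow> 'a \<Rightarrow> real"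
  assumes fin: "finite X" and sym: "\<And>u v. f u v = f v u" and le4: "\<And>u v. f u v \<le> 4"
    and k0: "\<kappa> \<ge> 0"
    and block: "\<And>Y. Y \<subseteq> X \<Longrightarrow> Y \<noteq> {} \<Longrightarrow>
        \<exists>B\<subseteq>Y. B \<noteq> {} \<and> card B \<le> 4 \<and> (\<forall>v\<in>Y-B. (\<Sum>b\<in>B. f b v) \<le> \<kappa> * real (card B))"
  shows "(\<Sum>u\<in>X. \<Sum>v\<in>X. f u v) \<le> \<kappa> * (real (card X))^2 + 16 * real (card X)"
proof -
  have "Y \<subseteq> X \<longrightarrow> (\<Sum>u\<in>Y. \<Sum>v\<in>Y. f u v) \<le> \<kappa> * (real (card Y))^2 + 16 * real (card Y)" if "finite Y" for Y
    using that
  proof (induction rule: finite_psubset_induct)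
    case (psubset Y)
    show ?case
    proof (cases "Y = {}")
      case False
      show ?thesis
      proof
        assume YX: "Y \<subseteq> X"
        obtain B where B: "B \<subseteq> Y" "B \<noteq> {}" "card B \<le> 4"
            "\<And>v. v \<in> Y - B \<Longrightarrow> (\<Sum>b\<in>B. f b v) \<le> \<kappa> * real (card B)"
          using block[OF YX False] by blast
        define R where "R = Y - B"
        have finB: "finite B" and finR: "finite R"
          using psubset(1) B(1) finite_subset unfolding R_def by auto
        have Y: "Y = B \<union> R" "B \<inter> R = {}" using B(1) unfolding R_def by auto
        have cY: "card Y = card B + card R" using Y finB finR card_Un_disjoint by blast
        have "R \<subset> Y" using B(1,2) unfolding R_def by auto
        then have RR: "(\<Sum>u\<in>R. \<Sum>v\<in>R. f u v) \<le> \<kappa> * (real (card R))^2 + 16 * real (card R)"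
          using psubset(2) YX by auto
        have RB: "(\<Sum>u\<in>R. \<Sum>v\<in>B. f u v) \<le> real (card R) * (\<kappa> * real (card B))"
        proof -
          have "(\<Sum>v\<in>B. f u v) \<le> \<kappa> * real (card B)" if "u \<in> R" for u
            using B(4)[of u] that sym[of u] unfolding R_def by simp
          then show ?thesis using sum_bounded_above[of R "\<lambda>u. \<Sum>v\<in>B. f u v"] by simp
        qed
        have BR: "(\<Sum>u\<in>B. \<Sum>v\<in>R. f u v) = (\<Sum>u\<in>R. \<Sum>v\<in>B. f u v)"
          by (subst sum.swap) (simp add: sym)
        have "(\<Sum>v\<in>B. f u v) \<le> 16" for u
        proof -
          have "(\<Sum>v\<in>B. f u v) \<le> real (card B) * 4" by (rule sum_bounded_above) (rule le4)
          then show ?thesis using B(3) by linarith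
        qed
        then have BB: "(\<Sum>u\<in>B. \<Sum>v\<in>B. f u v) \<le> real (card B) * 16"
          using sum_bounded_above[of B "\<lambda>u. \<Sum>v\<in>B. f u v" 16] by simp
        have "(\<Sum>u\<in>Y. \<Sum>v\<in>Y. f u v) = (\<Sum>u\<in>B. \<Sum>v\<in>B. f u v) + (\<Sum>u\<in>B. \<Sum>v\<in>R. f u v)
            + (\<Sum>u\<in>R. \<Sum>v\<in>B. f u v) + (\<Sum>u\<in>R. \<Sum>v\<in>R. f u v)"
          unfolding Y(1) using finB finR Y(2)
          by (simp add: sum.union_disjoint sum.distrib)
        also have "\<dots> \<le> real (card B) * 16 + 2 * (real (card R) * (\<kappa> * real (card B))) + (\<kappa> * (real (card R))^2 + 16 * real (card R))"
          using BB RB RR BR by linarith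
        \<comment> \<open>The two mixed terms complete the square of \<open>card B + card R\<close>;
          the weight inside the block goes into the linear term.\<close>
        also have "\<dots> \<le> \<kappa> * (real (card Y))^2 + 16 * real (card Y)"
          unfolding cY using k0 by (simp add: power2_eq_square algebra_simps)
        finally show "(\<Sum>u\<in>Y. \<Sum>v\<in>Y. f u v) \<le> \<kappa> * (real (card Y))^2 + 16 * real (card Y)" .
      qed
    qed simp
  qed
  then show ?thesis using fin by blast
qed

section \<open>Coloured links of a tetrahedron\<close>

text \<open>A colouring of pairs by the vertices \<open>S\<close> of a tetrahedron that extend them to an edge. Absence of
  the transversals below is what Fano-freeness says about it.\<close>

locale link_colouring =
  fixes U :: "'a set" and S :: "'b set" and c :: "'a \<Rightarrow> 'a \<Rightarrow> 'b set"
  assumes finU: "finite U"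
    and cardS: "card S = 4"
    and c_sub: "c u v \<subseteq> S"
    and c_sym: "c u v = c v u"
    and c_irrefl: "c u u = {}"
    and no_transversal: "\<lbrakk>p \<in> U; q \<in> U; r \<in> U; s \<in> U; distinct [p, q, r, s];
      i \<in> c p q; i \<in> c r s; j \<in> c p r; j \<in> c q s; k \<in> c p s; k \<in> c q r; distinct [i, j, k]\<rbrakk> \<Longrightarrow> False"
begin

section \<open>Weights of pairs and the four-point restriction\<close>

definition w :: "'a \<Rightarrow> 'a \<Rightarrow> nat" where "w u v = card (c u v)"

lemma finS: "finite S" using cardS card.infinite by fastforce

lemma w_sym: "w u v = w v u" unfolding w_def using c_sym by simp

lemma w_irrefl [simp]: "w u u = 0" unfolding w_def using c_irrefl by simp

lemma w_le4: "w u v \<le> 4" unfolding w_def using card_mono[OF finS c_sub] cardS by simp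

text \<open>Inclusion-exclusion inside the 4-set \<open>S\<close>. It converts weights of opposite
  pairs into lower bounds on the intersections that \<open>four_points\<close> restricts.\<close>

lemma card_inter_ge: "w p q + w r s \<le> card (c p q \<inter> c r s) + 4"
proof -
  have fin: "finite (c p q)" "finite (c r s)" using c_sub finS finite_subset by blast+
  have "card (c p q \<union> c r s) \<le> 4"
    using card_mono[OF finS Un_least[OF c_sub c_sub]] cardS by metis
  then show ?thesis using card_Un_Int[OF fin] unfolding w_def by linarith
qed

text \<open>The sizes of the three intersections, in increasing order, cannot dominate 1, 2, 3,
  since then distinct representatives would be a forbidden transversal. Only sizes enter, so that
  \<open>linarith\<close> can use the result; the finer case of sizes 2, 2, 2 is treated in
  \<open>miss_pairs\<close>.\<close>

lemma four_points:
  assumes "p \<in> U" "q \<in> U" "r \<in> U" "s \<in> U" "distinct [p, q, r, s]"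
  defines "a \<equiv> card (c p q \<inter> c r s)" and "b \<equiv> card (c p r \<inter> c q s)" and "d \<equiv> card (c p s \<inter> c q r)"
  shows "a = 0 \<or> b = 0 \<or> d = 0 \<or> a \<le> 1 \<and> b \<le> 1 \<or> a \<le> 1 \<and> d \<le> 1 \<or> b \<le> 1 \<and> d \<le> 1
    \<or> a \<le> 2 \<and> b \<le> 2 \<and> d \<le> 2"
proof (rule ccontr)
  note nt = no_transversal[OF assms(1-5)]
  assume "\<not> ?thesis"
  then have ne: "1 \<le> a" "1 \<le> b" "1 \<le> d" "2 \<le> a \<or> 2 \<le> b" "2 \<le> a \<or> 2 \<le> d" "2 \<le> b \<or> 2 \<le> d"
    "3 \<le> a \<or> 3 \<le> b \<or> 3 \<le> d" by auto
  have "3 \<le> n \<Longrightarrow> 2 \<le> n" for n :: nat by simp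
  with ne consider "a \<ge> 1" "b \<ge> 2" "d \<ge> 3" | "a \<ge> 1" "d \<ge> 2" "b \<ge> 3" | "b \<ge> 1" "a \<ge> 2" "d \<ge> 3"
    | "b \<ge> 1" "d \<ge> 2" "a \<ge> 3" | "d \<ge> 1" "a \<ge> 2" "b \<ge> 3" | "d \<ge> 1" "b \<ge> 2" "a \<ge> 3" by metis
  then show False
    unfolding a_def b_def d_def
  proof cases
    case 1
    from sdr_exists[OF this] obtain i j k where "i \<in> c p q \<inter> c r s" "j \<in> c p r \<inter> c q s"
      "k \<in> c p s \<inter> c q r" "i \<noteq> j" "i \<noteq> k" "j \<noteq> k" by blast
    then show False using nt[of i j k] by auto
  next
    case 2
    from sdr_exists[OF this] obtain i j k where "i \<in> c p q \<inter> c r s" "j \<in> c p s \<inter> c q r"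
      "k \<in> c p r \<inter> c q s" "i \<noteq> j" "i \<noteq> k" "j \<noteq> k" by blast
    then show False using nt[of i k j] by auto
  next
    case 3
    from sdr_exists[OF this] obtain i j k where "i \<in> c p r \<inter> c q s" "j \<in> c p q \<inter> c r s"
      "k \<in> c p s \<inter> c q r" "i \<noteq> j" "i \<noteq> k" "j \<noteq> k" by blast
    then show False using nt[of j i k] by auto
  next
    case 4
    from sdr_exists[OF this] obtain i j k where "i \<in> c p r \<inter> c q s" "j \<in> c p s \<inter> c q r"
      "k \<in> c p q \<inter> c r s" "i \<noteq> j" "i \<noteq> k" "j \<noteq> k" by blast
    then show False using nt[of k i j] by auto
  next
    case 5
    from sdr_exists[OF this] obtain i j k where "i \<in> c p s \<inter> c q r" "j \<in> c p q \<inter> c r s"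
      "k \<in> c p r \<inter> c q s" "i \<noteq> j" "i \<noteq> k" "j \<noteq> k" by blast
    then show False using nt[of j k i] by auto
  next
    case 6
    from sdr_exists[OF this] obtain i j k where "i \<in> c p s \<inter> c q r" "j \<in> c p r \<inter> c q s"
      "k \<in> c p q \<inter> c r s" "i \<noteq> j" "i \<noteq> k" "j \<noteq> k" by blast
    then show False using nt[of k j i] by auto
  qed
qed

text \<open>The intersections have sizes at least \<open>w z v\<close>, \<open>w y v\<close> and
  \<open>w x v - 1\<close>. The exceptional total 9 arises only when the last of these bounds
  vanishes, with weight 1 at \<open>x\<close> and 4 at \<open>y\<close> and \<open>z\<close>. It is
  kept because vertices with \<open>w y v = 4\<close> can be counted separately.\<close>

lemma four_four_three:
  assumes "x \<in> U" "y \<in> U" "z \<in> U" "v \<in> U" "distinct [x, y, z, v]"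
    and "w x y = 4" "w x z = 4" "w y z \<ge> 3"
  shows "w x v + w y v + w z v \<le> 8 \<or> w x v + w y v + w z v = 9 \<and> w y v = 4"
  using four_points[OF assms(1-5)] card_inter_ge[of x y z v] card_inter_ge[of x z y v]
    card_inter_ge[of x v y z] w_le4[of x v] w_le4[of y v] w_le4[of z v] assms(6-8)
  by linarith

lemma four_four_four:
  assumes "x \<in> U" "y \<in> U" "z \<in> U" "v \<in> U" "distinct [x, y, z, v]"
    and "w x y = 4" "w x z = 4" "w y z = 4"
  shows "w x v + w y v + w z v \<le> 8"
  using four_points[OF assms(1-5)] card_inter_ge[of x y z v] card_inter_ge[of x z y v]
    card_inter_ge[of x v y z] w_le4[of x v] w_le4[of y v] w_le4[of z v] assms(6-8)
  by linarith

text \<open>The matching formed by the two weight-4 pairs shares all four colours and each of the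
  other two matchings at least two, so distinct representatives exist.\<close>

lemma two_four_edges:
  assumes "x \<in> U" "y \<in> U" "z \<in> U" "v \<in> U" "distinct [x, y, z, v]"
    and "w x y = 4" "w z v = 4" "w x z \<ge> 3" "w x v \<ge> 3" "w y z \<ge> 3" "w y v \<ge> 3"
  shows False
  using four_points[OF assms(1-5)] card_inter_ge[of x y z v] card_inter_ge[of x z y v]
    card_inter_ge[of x v y z] assms(6-11)
  by linarith

text \<open>Meant for pairs of weight at least 3. If the weight is 4 no colour is absent, and an
  arbitrary colour of \<open>S\<close> is chosen.\<close>

definition miss :: "'a \<Rightarrow> 'a \<Rightarrow> 'b" where "miss u v = (SOME m. m \<in> S \<and> S - {m} \<subseteq> c u v)"

lemma miss_sym: "miss u v = miss v u" unfolding miss_def using c_sym by simp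

lemma miss:
  assumes "w u v \<ge> 3"
  shows "miss u v \<in> S" "S - {miss u v} \<subseteq> c u v"
proof -
  have "card (S - c u v) \<le> 1"
    using assms card_Diff_subset[OF finite_subset[OF c_sub finS] c_sub] cardS unfolding w_def by simp
  then have "\<exists>m. m \<in> S \<and> S - {m} \<subseteq> c u v"
  proof (cases "S - c u v = {}")
    case True
    moreover obtain m where "m \<in> S" using cardS by fastforce
    ultimately show ?thesis by blast
  next
    case False
    with \<open>card (S - c u v) \<le> 1\<close> finS have "card (S - c u v) = 1"
      by (simp add: le_Suc_eq)
    then obtain m where "S - c u v = {m}" by (rule card_1_singletonE)
    then show ?thesis by blast
  qed
  from someI_ex[OF this] show "miss u v \<in> S" "S - {miss u v} \<subseteq> c u v" unfolding miss_def by auto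
qed

text \<open>Two opposite pairs lacking the same colour would share three colours, while the other
  two matchings share at least two each.\<close>

lemma miss_opposite:
  assumes "p \<in> U" "q \<in> U" "r \<in> U" "s \<in> U" "distinct [p, q, r, s]"
    and "w p q \<ge> 3" "w p r \<ge> 3" "w p s \<ge> 3" "w q r \<ge> 3" "w q s \<ge> 3" "w r s \<ge> 3"
  shows "miss p q \<noteq> miss r s"
proof
  assume "miss p q = miss r s"
  then have "S - {miss p q} \<subseteq> c p q \<inter> c r s" using miss(2) assms by fastforce
  then have "card (S - {miss p q}) \<le> card (c p q \<inter> c r s)"
    using card_mono finite_subset[OF c_sub finS] by (metis finite_Int)
  then have "card (c p q \<inter> c r s) \<ge> 3" using miss(1) assms(6) cardS by simp
  then show False
    using four_points[OF assms(1-5)] card_inter_ge[of p r q s] card_inter_ge[of p s q r] assms(6-11)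
    by linarith
qed

text \<open>Removing the two missing colours leaves each matching a set of two usable colours. If
  two of these sets differed, \<open>sdr_pairs\<close> would give a transversal.\<close>

lemma miss_pairs:
  assumes "p \<in> U" "q \<in> U" "r \<in> U" "s \<in> U" "distinct [p, q, r, s]"
    and "w p q \<ge> 3" "w p r \<ge> 3" "w p s \<ge> 3" "w q r \<ge> 3" "w q s \<ge> 3" "w r s \<ge> 3"
  shows "{miss p q, miss r s} = {miss p r, miss q s}"
proof (rule ccontr)
  assume ne: "\<not> ?thesis"
  have wsym: "w r q \<ge> 3" "w s q \<ge> 3" "w s r \<ge> 3" using assms w_sym by auto
  have opp: "miss p q \<noteq> miss r s" "miss p r \<noteq> miss q s" "miss p s \<noteq> miss q r"
    using miss_opposite[of p q r s] miss_opposite[of p r q s] miss_opposite[of p s q r] assms wsym by auto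
  let ?A = "S - {miss p q, miss r s}" and ?B = "S - {miss p r, miss q s}" and ?C = "S - {miss p s, miss q r}"
  have card2: "card (S - {a, b}) = 2" if "a \<in> S" "b \<in> S" "a \<noteq> b" for a b
    using that cardS finS by simp
  have mS: "miss p q \<in> S" "miss r s \<in> S" "miss p r \<in> S" "miss q s \<in> S" "miss p s \<in> S" "miss q r \<in> S"
    using miss(1) assms by auto
  have "?A \<noteq> ?B" using ne mS by blast
  then obtain i j k where "i \<in> ?A" "j \<in> ?B" "k \<in> ?C" "i \<noteq> j" "i \<noteq> k" "j \<noteq> k"
    using sdr_pairs[OF card2[OF mS(1,2) opp(1)] card2[OF mS(3,4) opp(2)] card2[OF mS(5,6) opp(3)]] by blast
  then show False using no_transversal[OF assms(1-5), of i j k] miss(2) assms(6-11) by auto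
qed

text \<open>Label pairs by their missing colour. In every 4-set all three perfect matchings carry
  the same two labels, one on each side. Each label thus takes one pair from every matching, so one
  label class is a triangle and the other a star. Two further points cannot be attached to such a
  triangle.\<close>

lemma no_heavy_five:
  assumes "{p, q, r, s, t} \<subseteq> U" "distinct [p, q, r, s, t]"
    and heavy: "\<And>u v. u \<in> {p, q, r, s, t} \<Longrightarrow> v \<in> {p, q, r, s, t} \<Longrightarrow> u \<noteq> v \<Longrightarrow> w u v \<ge> 3"
  shows False
proof -
  have P: "{miss a b, miss d e} = {miss a d, miss b e}" "miss a b \<noteq> miss d e"
    if "{a, b, d, e} \<subseteq> {p, q, r, s, t}" "distinct [a, b, d, e]" for a b d e
  proof -
    have "a \<in> U" "b \<in> U" "d \<in> U" "e \<in> U" using that(1) assms(1) by blast+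
    moreover have "w a b \<ge> 3" "w a d \<ge> 3" "w a e \<ge> 3" "w b d \<ge> 3" "w b e \<ge> 3" "w d e \<ge> 3"
      by (rule heavy; use that in simp)+
    ultimately show "{miss a b, miss d e} = {miss a d, miss b e}" "miss a b \<noteq> miss d e"
      using miss_pairs[OF _ _ _ _ that(2)] miss_opposite[OF _ _ _ _ that(2)] by metis+
  qed
  \<comment> \<open>A point outside a triangle labelled \<open>i\<close> sends a common label other
    than \<open>i\<close> to its corners. For two outside points \<open>e\<close>, \<open>f\<close>
    the matching \<open>a b\<close>, \<open>e f\<close> then carries the label \<open>i\<close>,
    whereas \<open>a e\<close>, \<open>b f\<close> does not.\<close>
  have triangle: False
    if d: "{a, b, d, e, f} \<subseteq> {p, q, r, s, t}" "distinct [a, b, d, e, f]"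
      and tri: "miss a b = i" "miss a d = i" "miss b d = i" for a b d e f i
  proof -
    have star: "\<exists>j. j \<noteq> i \<and> miss a v = j \<and> miss b v = j" if "v \<in> {e, f}" for v
    proof -
      have "distinct [b, d, a, v]" "distinct [a, d, v, b]"
        "{b, d, a, v} \<subseteq> {p, q, r, s, t}" "{a, d, v, b} \<subseteq> {p, q, r, s, t}" using that d by auto
      then have "miss b d \<noteq> miss a v" "{miss a d, miss v b} = {miss a v, miss d b}"
        using P by metis+
      then show ?thesis unfolding miss_sym[of v b] miss_sym[of d b] tri doubleton_eq_iff by metis
    qed
    obtain j k where "j \<noteq> i" "k \<noteq> i" "miss a e = j" "miss b f = k"
      using star[of e] star[of f] by auto
    moreover have "{miss a b, miss e f} = {miss a e, miss b f}"
      by (rule P(1)) (use d in auto)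
    ultimately show False unfolding tri doubleton_eq_iff by metis
  qed
  have "miss p q = miss p r \<and> miss p q = miss q r \<or> miss p q = miss p s \<and> miss p q = miss q s
    \<or> miss p r = miss p s \<and> miss p r = miss r s \<or> miss q r = miss q s \<and> miss q r = miss r s"
  proof -
    have 1: "{miss p q, miss r s} = {miss p r, miss q s}" "{miss p q, miss r s} = {miss p s, miss q r}"
      "miss p q \<noteq> miss r s"
      using P[of p q r s] P(1)[of p q s r] assms(2) miss_sym[of s r] miss_sym[of q r]
      by (simp_all add: insert_commute eq_commute[of s r])
    then show ?thesis unfolding doubleton_eq_iff by metis
  qed
  moreover have "{p, q, s, r, t} = {p, q, r, s, t}" "{p, r, s, q, t} = {p, q, r, s, t}"
    "{q, r, s, p, t} = {p, q, r, s, t}" by auto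
  moreover have "distinct [p, q, s, r, t]" "distinct [p, r, s, q, t]" "distinct [q, r, s, p, t]"
    using assms(2) by auto
  ultimately show False using triangle assms(2) by (metis order_refl)
qed

lemma heavy_clique_card:
  assumes "K \<subseteq> U" and "\<And>u v. u \<in> K \<Longrightarrow> v \<in> K \<Longrightarrow> u \<noteq> v \<Longrightarrow> w u v \<ge> 3"
  shows "card K \<le> 4"
proof (rule ccontr)
  assume "\<not> ?thesis"
  then obtain T where T: "T \<subseteq> K" "card T = 5" using obtain_subset_with_card_n[of 5 K] by auto
  then obtain xs where xs: "set xs = T" "distinct xs" "length xs = 5"
    by (metis card.infinite distinct_card finite_distinct_list zero_neq_numeral)
  then obtain p q r s t where "xs = [p, q, r, s, t]"
    by (auto simp: numeral_eq_Suc length_Suc_conv)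
  with xs have "T = {p, q, r, s, t}" "distinct [p, q, r, s, t]" by auto
  then show False using no_heavy_five[of p q r s t] assms T(1) by blast
qed

end

lemma finite_maximizer:
  fixes f :: "'a \<Rightarrow> real"
  assumes "finite A" "A \<noteq> {}"
  obtains x where "x \<in> A" "\<And>y. y \<in> A \<Longrightarrow> f y \<le> f x"
proof -
  have "Max (f ` A) \<in> f ` A" using assms by (intro Max_in) auto
  then obtain x where x: "x \<in> A" "f x = Max (f ` A)" by auto
  then have "f y \<le> f x" if "y \<in> A" for y using that assms(1) by simp
  with x show ?thesis using that by blast
qed

section \<open>Weight sums over vertex sets and the near-bipartite structure\<close>

context link_colouring
begin

definition sw :: "'a set \<Rightarrow> 'a set \<Rightarrow> real" where
  "sw A B = (\<Sum>u\<in>A. \<Sum>v\<in>B. real (w u v))"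

lemma sw_commute: "sw A B = sw B A"
  unfolding sw_def by (subst sum.swap) (simp add: w_sym)

lemma sw_Un_left: "finite A \<Longrightarrow> finite A' \<Longrightarrow> A \<inter> A' = {} \<Longrightarrow> sw (A \<union> A') B = sw A B + sw A' B"
  unfolding sw_def by (rule sum.union_disjoint)

lemma sw_Un_right: "finite A \<Longrightarrow> finite A' \<Longrightarrow> A \<inter> A' = {} \<Longrightarrow> sw B (A \<union> A') = sw B A + sw B A'"
  using sw_Un_left sw_commute by metis

lemma sw_bound:
  assumes "\<And>u v. u \<in> A \<Longrightarrow> v \<in> B \<Longrightarrow> real (w u v) \<le> k"
  shows "sw A B \<le> k * real (card A) * real (card B)"
proof -
  have "(\<Sum>v\<in>B. real (w u v)) \<le> real (card B) * k" if "u \<in> A" for u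
    by (rule sum_bounded_above) (rule assms[OF that])
  then have "sw A B \<le> real (card A) * (real (card B) * k)" unfolding sw_def by (rule sum_bounded_above)
  then show ?thesis by (simp add: algebra_simps)
qed

lemma sw_bound4: "sw A B \<le> 4 * real (card A) * real (card B)"
  by (rule sw_bound) (use w_le4 in simp)

text \<open>The blocks are weight-4 pairs, which receive at most 4, and otherwise maximal cliques of
  pairs of weight 3. Such a clique has k \<le> 4 vertices, and by maximality an outside vertex sends
  weight at most 2 to one of them, hence at most 3 k - 1 \<le> 11/4 k in all. The point is that 11/4
  lies strictly below the density 3 at hand.\<close>

lemma sw_square_bound:
  assumes "X \<subseteq> U" and no4: "\<And>u v v'. u \<in> X \<Longrightarrow> v \<in> X \<Longrightarrow> v' \<in> X \<Longrightarrow> distinct [u, v, v'] \<Longrightarrow> w u v = 4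
      \<Longrightarrow> w u v' + w v v' \<le> 4"
  shows "sw X X \<le> 11/4 * (real (card X))^2 + 16 * real (card X)"
  unfolding sw_def
proof (rule greedy_weight_bound)
  show "finite X" using assms(1) finU finite_subset by blast
  show "real (w u v) = real (w v u)" "real (w u v) \<le> 4" for u v
    using w_sym[of u v] w_le4[of u v] by auto
next
  fix Y assume Y: "Y \<subseteq> X" "Y \<noteq> {}"
  have finY: "finite Y" using Y(1) assms(1) finU finite_subset by metis
  show "\<exists>B\<subseteq>Y. B \<noteq> {} \<and> card B \<le> 4 \<and> (\<forall>v\<in>Y-B. (\<Sum>b\<in>B. real (w b v)) \<le> 11/4 * real (card B))"
  proof (cases "\<exists>u\<in>Y. \<exists>v\<in>Y. w u v = 4")
    case True
    then obtain u v where uv: "u \<in> Y" "v \<in> Y" "w u v = 4" by blast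
    then have "u \<noteq> v" by auto
    moreover have "w u x + w v x \<le> 4" if "x \<in> Y - {u, v}" for x
      using no4[of u v x] uv \<open>u \<noteq> v\<close> that Y(1) by auto
    then have "real (w u x) + real (w v x) \<le> 4" if "x \<in> Y - {u, v}" for x
      using that by (metis of_nat_add of_nat_le_iff of_nat_numeral)
    ultimately show ?thesis using uv by (intro exI[of _ "{u, v}"]) fastforce
  next
    case False
    have le3: "w u v \<le> 3" if "u \<in> Y" "v \<in> Y" for u v
      using False that w_le4[of u v] by (metis Suc_leI eval_nat_numeral(2) le_antisym not_less_eq_eq numeral_3_eq_3 numeral_eq_Suc pred_numeral_simps(2) semiring_norm(26) semiring_norm(27) semiring_norm(28))
    define clq where "clq K \<longleftrightarrow> (\<forall>u\<in>K. \<forall>v\<in>K. u \<noteq> v \<longrightarrow> w u v \<ge> 3)" for K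
    obtain a where "a \<in> Y" using Y(2) by blast
    then have "{a} \<in> {K. K \<subseteq> Y \<and> clq K}" unfolding clq_def by simp
    then obtain K where K: "K \<subseteq> Y" "clq K" "{a} \<subseteq> K"
      and max: "\<And>L. L \<subseteq> Y \<Longrightarrow> clq L \<Longrightarrow> K \<subseteq> L \<Longrightarrow> K = L"
      using finite_has_maximal2[of "{K. K \<subseteq> Y \<and> clq K}" "{a}"] finY by auto
    have c4: "card K \<le> 4"
      using heavy_clique_card[of K] K(1,2) Y(1) assms(1) unfolding clq_def by blast
    have finK: "finite K" using K(1) finY finite_subset by blast
    have "(\<Sum>b\<in>K. real (w b v)) \<le> 11/4 * card K" if v: "v \<in> Y - K" for v
    proof -
      have "\<not> clq (insert v K)" using max[of "insert v K"] K(1) v by blast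
      then obtain b where b: "b \<in> K" "w b v \<le> 2"
        using K(2) unfolding clq_def by (metis insertE not_less_eq_eq numeral_2_eq_2 numeral_3_eq_3 w_sym)
      have "(\<Sum>b\<in>K. real (w b v)) = real (w b v) + (\<Sum>b\<in>K-{b}. real (w b v))"
        using finK b(1) by (rule sum.remove)
      also have "(\<Sum>b\<in>K-{b}. real (w b v)) \<le> real (card (K - {b})) * 3"
      proof (rule sum_bounded_above)
        fix x assume "x \<in> K - {b}"
        then show "real (w x v) \<le> 3" using le3[of x v] K(1) v by auto
      qed
      also have "real (card (K - {b})) = real (card K) - 1"
        using b(1) finK by (metis One_nat_def card_Diff_singleton card_gt_0_iff empty_iff of_nat_1 of_nat_diff Suc_leI)
      finally have "(\<Sum>b\<in>K. real (w b v)) \<le> real (w b v) + (real (card K) - 1) * 3" by simp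
      moreover have "real (w b v) \<le> 2" "real (card K) \<le> 4" using b(2) c4 by auto
      moreover have "s \<le> 11/4 * k" if "s \<le> d + (k - 1) * 3" "d \<le> 2" "k \<le> 4" for s d k :: real
        using that by (simp add: algebra_simps)
      ultimately show ?thesis by blast
    qed
    then show ?thesis using K c4 by blast
  qed
qed simp

text \<open>In order of preference the blocks are triangles of weights 4, 4 and at least 3, which
  receive at most 9 by \<open>four_four_three\<close>; weight-4 pairs, which receive at most 6 once
  there are no such triangles; and single vertices.\<close>

lemma sw_square_bound3:
  assumes "X \<subseteq> U"
  shows "sw X X \<le> 3 * (real (card X))^2 + 16 * real (card X)"
  unfolding sw_def
proof (rule greedy_weight_bound)
  show "finite X" using assms(1) finU finite_subset by blast
  show "real (w u v) = real (w v u)" "real (w u v) \<le> 4" for u v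
    using w_sym[of u v] w_le4[of u v] by auto
next
  fix Y assume Y: "Y \<subseteq> X" "Y \<noteq> {}"
  show "\<exists>B\<subseteq>Y. B \<noteq> {} \<and> card B \<le> 4 \<and> (\<forall>v\<in>Y-B. (\<Sum>b\<in>B. real (w b v)) \<le> 3 * real (card B))"
  proof (cases "\<exists>x\<in>Y. \<exists>y\<in>Y. \<exists>z\<in>Y. w x y = 4 \<and> w x z = 4 \<and> w y z \<ge> 3")
    case True
    then obtain x y z where t: "x \<in> Y" "y \<in> Y" "z \<in> Y" "w x y = 4" "w x z = 4" "w y z \<ge> 3" by blast
    then have d: "x \<noteq> y" "x \<noteq> z" "y \<noteq> z" by auto
    have "real (w x v) + real (w y v) + real (w z v) \<le> 9" if "v \<in> Y - {x, y, z}" for v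
    proof -
      have "x \<in> U" "y \<in> U" "z \<in> U" "v \<in> U" using t that Y(1) assms by blast+
      moreover have "distinct [x, y, z, v]" using d that by auto
      ultimately have "w x v + w y v + w z v \<le> 9" using four_four_three[of x y z v] t by linarith
      then show ?thesis by linarith
    qed
    then show ?thesis using t d by (intro exI[of _ "{x, y, z}"]) (simp add: add.assoc)
  next
    case False
    show ?thesis
    proof (cases "\<exists>x\<in>Y. \<exists>y\<in>Y. w x y = 4")
      case True
      then obtain x y where t: "x \<in> Y" "y \<in> Y" "w x y = 4" by blast
      then have d: "x \<noteq> y" by auto
      have "real (w x v) + real (w y v) \<le> 6" if "v \<in> Y - {x, y}" for v
      proof -
        have "v \<in> Y" "w y x = 4" using that t w_sym[of y x] by auto
        then have "\<not> (w x v = 4 \<and> w y v \<ge> 3)" "\<not> (w y v = 4 \<and> w x v \<ge> 3)"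
          using False t \<open>w y x = 4\<close> by blast+
        then have "w x v + w y v \<le> 6" using w_le4[of x v] w_le4[of y v] by linarith
        then show ?thesis by linarith
      qed
      then show ?thesis using t d by (intro exI[of _ "{x, y}"]) simp
    next
      case no4: False
      obtain a where a: "a \<in> Y" using Y(2) by blast
      have "w a v \<le> 3" if "v \<in> Y" for v
      proof -
        have "w a v \<noteq> 4" using no4 that a by blast
        then show ?thesis using w_le4[of a v] by linarith
      qed
      then show ?thesis using a by (intro exI[of _ "{a}"]) auto
    qed
  qed
qed simp

text \<open>An edge \<open>x y\<close> of weight 4 determines the parts: the weight-4 neighbours of \<open>y\<close> and those of \<open>x\<close>.
  Of the remaining vertices, those sending 3 to both \<open>x\<close> and \<open>y\<close> are few, as they send at most 3 to either
  part and less than 3 on average to each other.\<close>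

lemma bipartite_structure:
  fixes e :: real
  assumes W: "W \<subseteq> U" and N: "N = real (card W)"
    and deg: "\<And>u. u \<in> W \<Longrightarrow> (3 - 2*e) * N \<le> sw {u} W"
    and e: "0 < e" "e \<le> 1/2000" and eN: "e * N \<ge> 100"
  obtains X Y where "X \<subseteq> W" "Y \<subseteq> W" "X \<inter> Y = {}"
    "real (card X) \<ge> (1/2 - 211*e) * N" "real (card Y) \<ge> (1/2 - 211*e) * N"
    "\<And>u. u \<in> X \<Longrightarrow> card {v\<in>Y. w u v \<noteq> 4} \<le> 844 * e * N"
proof -
  have finW: "finite W" using W finU finite_subset by blast
  have N0: "N \<ge> 200000"
  proof -
    have "e * N \<le> 1/2000 * N" using e(2) N by (intro mult_right_mono) auto
    then show ?thesis using eN by linarith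
  qed
  have N2: "N^2 = N * N" by (rule power2_eq_square)
  have Nge: "N * N \<ge> 200000 * N" using N0 by (intro mult_right_mono) auto
  have eNN: "e * N * N \<le> 1/2000 * (N * N)" using e(2) N0 by (simp add: mult_right_mono)
  have sw1: "sw {u} A = (\<Sum>v\<in>A. real (w u v))" for u A unfolding sw_def by simp
  have swW: "sw W W \<ge> (3 - 2*e) * N * N"
  proof -
    have "sw W W = (\<Sum>u\<in>W. sw {u} W)" unfolding sw_def by simp
    also have "\<dots> \<ge> real (card W) * ((3 - 2*e) * N)" using deg by (intro sum_bounded_below) auto
    finally show ?thesis using N by (simp add: algebra_simps)
  qed
  have swW': "sw W W \<ge> 2999/1000 * (N * N)" using swW eNN by (simp add: algebra_simps)

  \<comment> \<open>Any weight-4 pair in the weight-4 neighbourhood \<open>Q\<close> of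
    \<open>y\<close> spans a weight-4 triangle with \<open>y\<close>, so
    \<open>four_four_four\<close> makes \<open>Q\<close> satisfy \<open>sw_square_bound\<close>. If
    \<open>Q\<close> were almost all of \<open>W\<close>, the density would be at most 11/4 + 2/25
    up to lower order terms.\<close>
  have claim1: "card {v\<in>W. w y v = 4} \<le> 99/100 * N" if y: "y \<in> W" for y
  proof (rule ccontr)
    assume c: "\<not> ?thesis"
    define Q where "Q = {v\<in>W. w y v = 4}"
    have QW: "Q \<subseteq> W" "finite Q" "finite (W - Q)" unfolding Q_def using finW by auto
    have cQ: "real (card Q) > 99/100 * N" using c unfolding Q_def by linarith
    have cQN: "real (card Q) \<le> N" using card_mono[OF finW QW(1)] N by simp
    have cWQ: "real (card (W - Q)) = N - real (card Q)" using card_Diff_subset[OF QW(2,1)] N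
      by (simp add: of_nat_diff card_mono finW QW(1))
    have "sw Q Q \<le> 11/4 * (real (card Q))^2 + 16 * real (card Q)"
    proof (rule sw_square_bound)
      show "Q \<subseteq> U" using QW W by blast
    next
      fix u v v' assume uv: "u \<in> Q" "v \<in> Q" "v' \<in> Q" "distinct [u, v, v']" "w u v = 4"
      then have "y \<noteq> u" "y \<noteq> v" "y \<noteq> v'" unfolding Q_def by auto
      then show "w u v' + w v v' \<le> 4"
        using four_four_four[of y u v v'] uv y W unfolding Q_def by auto
    qed
    moreover have "(real (card Q))^2 \<le> N^2" using cQN by (intro power_mono) auto
    ultimately have QQ: "sw Q Q \<le> 11/4 * (N * N) + 16 * N" using cQN unfolding N2 by linarith
    have "sw W W = sw Q W + sw (W - Q) W"
      using sw_Un_left[OF QW(2,3), of W] QW(1) by (simp add: Un_absorb1)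
    also have "sw Q W = sw Q Q + sw Q (W - Q)"
      using sw_Un_right[OF QW(2,3), of Q] QW(1) by (simp add: Un_absorb1)
    also have "sw Q (W - Q) \<le> 4 * real (card Q) * real (card (W - Q))" by (rule sw_bound4)
    also have "\<dots> \<le> 4 * N * (1/100 * N)" using cQN cWQ cQ N0 by (intro mult_mono) auto
    also have "sw (W - Q) W \<le> 4 * real (card (W - Q)) * real (card W)" by (rule sw_bound4)
    also have "\<dots> \<le> 4 * (1/100 * N) * N" using cQN cWQ cQ N0 N by (intro mult_mono) auto
    finally have "sw W W \<le> 11/4 * (N*N) + 16 * N + 2/25 * (N * N)" using QQ by simp
    then show False using swW' Nge N0 by linarith
  qed

  \<comment> \<open>The degrees of \<open>x\<close>, \<open>y\<close>, \<open>z\<close> add up to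
    nearly 9 N, but by \<open>four_four_three\<close> a vertex outside the triangle sends more than
    8 only if it is a weight-4 neighbour of \<open>y\<close>, and \<open>claim1\<close> leaves N/100
    vertices that are not. The term with \<open>T\<close> pays for the three corners.\<close>
  have claim2: "w y z \<le> 2" if t: "x \<in> W" "y \<in> W" "z \<in> W" "w x y = 4" "w x z = 4" for x y z
  proof (rule ccontr)
    assume "\<not> ?thesis"
    then have yz: "w y z \<ge> 3" by simp
    have d: "x \<noteq> y" "x \<noteq> z" "y \<noteq> z" using t yz by auto
    define T where "T = {x, y, z}"
    have pt: "real (w x v) + real (w y v) + real (w z v)
        \<le> 8 + of_bool (w y v = 4) + 4 * of_bool (v \<in> T)" if "v \<in> W" for v
    proof (cases "v \<in> {x, y, z}")
      case True
      then show ?thesis using w_le4[of x v] w_le4[of y v] w_le4[of z v] unfolding T_def by simp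
    next
      case False
      have "x \<in> U" "y \<in> U" "z \<in> U" "v \<in> U" using t that W by blast+
      moreover have "distinct [x, y, z, v]" using d False by auto
      ultimately have "w x v + w y v + w z v \<le> 8 \<or> w x v + w y v + w z v = 9 \<and> w y v = 4"
        using four_four_three[of x y z v] t yz by blast
      then show ?thesis using False unfolding T_def by auto
    qed
    have "sw {x} W + sw {y} W + sw {z} W = (\<Sum>v\<in>W. real (w x v) + real (w y v) + real (w z v))"
      unfolding sw1 by (simp add: sum.distrib)
    also have "\<dots> \<le> (\<Sum>v\<in>W. 8 + of_bool (w y v = 4) + 4 * of_bool (v \<in> T))"
      by (rule sum_mono) (rule pt)
    also have "\<dots> = 8 * N + card {v\<in>W. w y v = 4} + 4 * card {v\<in>W. v \<in> T}"
      using finW N by (simp add: sum.distrib sum_distrib_left[symmetric] sum_of_bool_eq Int_def)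
    also have "{v\<in>W. v \<in> T} = {x, y, z}" using t unfolding T_def by auto
    finally have "sw {x} W + sw {y} W + sw {z} W \<le> 8 * N + 99/100 * N + 12"
      using claim1[OF t(2)] d by simp
    moreover have "(3 - 2*e) * N \<ge> 2999/1000 * N" using e(2) N0 by (intro mult_right_mono) auto
    ultimately show False using deg[OF t(1)] deg[OF t(2)] deg[OF t(3)] N0 by linarith
  qed

  obtain x y where xy: "x \<in> W" "y \<in> W" "w x y = 4"
  proof -
    have "\<exists>x\<in>W. \<exists>y\<in>W. w x y = 4"
    proof (rule ccontr)
      assume "\<not> ?thesis"
      then have "sw W W \<le> 11/4 * (real (card W))^2 + 16 * real (card W)"
        using W by (intro sw_square_bound) auto
      then have "sw W W \<le> 11/4 * (N * N) + 16 * N" using N by (simp add: power2_eq_square)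
      then show False using swW' Nge N0 by linarith
    qed
    then show ?thesis using that by blast
  qed
  then have yx: "w y x = 4" "x \<noteq> y" using w_sym[of x y] by auto

  define X where "X = {v\<in>W. w y v = 4}"
  define Y where "Y = {v\<in>W. w x v = 4}"
  define Z where "Z = {v\<in>W. w x v = 3 \<and> w y v = 3}"
  define R where "R = W - X - Y - Z"
  have sub: "X \<subseteq> W" "Y \<subseteq> W" "Z \<subseteq> W" "R \<subseteq> W" unfolding X_def Y_def Z_def R_def by auto
  have fin: "finite X" "finite Y" "finite Z" "finite R" using sub finW finite_subset by blast+
  have XY: "X \<inter> Y = {}" using claim2[of x y] claim2[of y x] xy yx unfolding X_def Y_def by fastforce
  have XZ: "X \<inter> Z = {}" "Y \<inter> Z = {}" unfolding X_def Y_def Z_def by auto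
  have Wun: "W = X \<union> Y \<union> Z \<union> R" unfolding R_def using sub by auto
  have cW: "N = real (card X) + real (card Y) + real (card Z) + real (card R)"
  proof -
    have "card W = card X + card Y + card Z + card R"
      unfolding Wun using fin XY XZ unfolding R_def
      by (subst card_Un_disjoint; auto)+
    then show ?thesis using N by simp
  qed

  \<comment> \<open>By \<open>claim2\<close> every vertex sends at most 6 to \<open>x\<close> and
    \<open>y\<close> together, and a vertex of \<open>R\<close> at most 5, while the two degrees
    require (6 - 4 e) N.\<close>
  have cR: "real (card R) \<le> 5 * e * N"
  proof -
    define T where "T = {x, y}"
    have pt: "real (w x v) + real (w y v) \<le> 6 - of_bool (v \<in> R) + 2 * of_bool (v \<in> T)" if v: "v \<in> W" for v
    proof (cases "v \<in> {x, y}")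
      case True
      then have "v \<in> X \<union> Y" unfolding X_def Y_def using xy yx by auto
      then have "v \<notin> R" unfolding R_def by auto
      then show ?thesis using True w_le4[of x v] w_le4[of y v] unfolding T_def by auto
    next
      case False
      have "\<not> (w x v = 4 \<and> w y v \<ge> 3)" "\<not> (w y v = 4 \<and> w x v \<ge> 3)"
        using claim2[of x y v] claim2[of y x v] xy yx v by auto
      moreover have "v \<in> R \<Longrightarrow> w x v \<noteq> 4 \<and> w y v \<noteq> 4 \<and> \<not> (w x v = 3 \<and> w y v = 3)"
        unfolding R_def X_def Y_def Z_def by auto
      ultimately have "w x v + w y v \<le> 6 \<and> (v \<in> R \<longrightarrow> w x v + w y v \<le> 5)"
        using w_le4[of x v] w_le4[of y v] by linarith
      then show ?thesis using False unfolding T_def by auto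
    qed
    have "sw {x} W + sw {y} W = (\<Sum>v\<in>W. real (w x v) + real (w y v))"
      unfolding sw1 by (simp add: sum.distrib)
    also have "\<dots> \<le> (\<Sum>v\<in>W. 6 - of_bool (v \<in> R) + 2 * of_bool (v \<in> T))"
      by (rule sum_mono) (rule pt)
    also have "\<dots> = 6 * N - card {v\<in>W. v \<in> R} + 2 * card {v\<in>W. v \<in> T}"
      using finW N by (simp add: sum.distrib sum_subtractf sum_distrib_left[symmetric] sum_of_bool_eq Int_def)
    also have "{v\<in>W. v \<in> R} = R" using sub by auto
    also have "{v\<in>W. v \<in> T} = {x, y}" using xy unfolding T_def by auto
    finally have "sw {x} W + sw {y} W \<le> 6 * N - real (card R) + 4" using yx by simp
    then show ?thesis using deg[OF xy(1)] deg[OF xy(2)] eN by (simp add: algebra_simps)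
  qed

  have cZ: "real (card Z) \<le> 100 * e * N"
  proof (cases "Z = {}")
    case True
    then show ?thesis using e N0 by simp
  next
    case False
    \<comment> \<open>A weight-4 pair inside \<open>Z\<close> together with \<open>x y\<close> would
      be the configuration of \<open>two_four_edges\<close>.\<close>
    have Z4: "w z z' \<noteq> 4" if "z \<in> Z" "z' \<in> Z" for z z'
    proof
      assume z4: "w z z' = 4"
      then have "distinct [x, y, z, z']" using that yx unfolding Z_def by auto
      then show False using two_four_edges[of x y z z'] that xy z4 W unfolding Z_def by auto
    qed
    have ZX: "w z u \<le> 3" if "z \<in> Z" "u \<in> X" for z u
    proof -
      have "w z u \<noteq> 4" using claim2[of u y z] that xy w_sym[of u] unfolding Z_def X_def by auto
      then show ?thesis using w_le4[of z u] by linarith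
    qed
    have ZY: "w z u \<le> 3" if "z \<in> Z" "u \<in> Y" for z u
    proof -
      have "w z u \<noteq> 4" using claim2[of u x z] that xy w_sym[of u] unfolding Z_def Y_def by auto
      then show ?thesis using w_le4[of z u] by linarith
    qed
    have ZZ: "sw Z Z \<le> 11/4 * (real (card Z))^2 + 16 * real (card Z)"
      using Z4 sub W by (intro sw_square_bound) auto
    have "real (card Z) * ((3 - 2*e) * N) \<le> sw Z W"
    proof -
      have "sw Z W = (\<Sum>u\<in>Z. sw {u} W)" unfolding sw_def by simp
      also have "\<dots> \<ge> real (card Z) * ((3 - 2*e) * N)" using deg sub by (intro sum_bounded_below) auto
      finally show ?thesis .
    qed
    also have "sw Z W = sw Z X + sw Z Y + sw Z Z + sw Z R"
    proof -
      have "sw Z (X \<union> Y \<union> Z \<union> R) = sw Z (X \<union> Y \<union> Z) + sw Z R"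
        by (rule sw_Un_right) (use fin in \<open>auto simp: R_def\<close>)
      also have "sw Z (X \<union> Y \<union> Z) = sw Z (X \<union> Y) + sw Z Z"
        by (rule sw_Un_right) (use fin XZ in auto)
      also have "sw Z (X \<union> Y) = sw Z X + sw Z Y"
        by (rule sw_Un_right) (use fin XY in auto)
      finally show ?thesis using Wun by simp
    qed
    also have "sw Z X \<le> 3 * real (card Z) * real (card X)" by (rule sw_bound) (use ZX in \<open>simp\<close>)
    also have "sw Z Y \<le> 3 * real (card Z) * real (card Y)" by (rule sw_bound) (use ZY in \<open>simp\<close>)
    also have "sw Z R \<le> 4 * real (card Z) * real (card R)" by (rule sw_bound4)
    also note ZZ
    finally have "real (card Z) * ((3 - 2*e) * N)
      \<le> real (card Z) * (3 * real (card X) + 3 * real (card Y) + 11/4 * real (card Z) + 16 + 4 * real (card R))"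
      by (simp add: algebra_simps power2_eq_square)
    then have "(3 - 2*e) * N \<le> 3 * real (card X) + 3 * real (card Y) + 11/4 * real (card Z) + 16 + 4 * real (card R)"
      using False fin by (simp add: card_gt_0_iff)
    then have "1/4 * real (card Z) \<le> 2 * e * N + 16 + real (card R)" using cW by (simp add: algebra_simps)
    then show ?thesis using cR eN by linarith
  qed

  \<comment> \<open>Vertices of \<open>A\<close> have a common weight-4 neighbour, so
    \<open>claim2\<close> limits weights inside \<open>A\<close> to 2; then degree 3 N is possible
    only if \<open>B\<close> has about N/2 vertices and is joined almost completely with weight 4.
    The error 420 e is 4 (100 e + 5 e) from \<open>Z\<close> and \<open>R\<close>; with 2 e from the
    degree this gives 211 e for the sizes and 844 e for the defects.\<close>
  have main: "real (card B) \<ge> (1/2 - 211*e) * N \<and> (3 - 2*e) * N \<le> 2 * real (card A) + 4 * real (card B) - card {v\<in>B. w u v \<noteq> 4} + 420 * e * N"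
    if AB: "A = X \<and> B = Y \<or> A = Y \<and> B = X" and u: "u \<in> A" for A B u
  proof -
    have sAB: "W = A \<union> B \<union> (Z \<union> R)" "finite A" "finite B" "A \<inter> B = {}" "(A \<union> B) \<inter> (Z \<union> R) = {}" "u \<in> W"
      "N = real (card A) + real (card B) + real (card Z) + real (card R)"
      using AB fin sub XY XZ u cW Wun unfolding R_def by auto
    have "(3 - 2*e) * N \<le> sw {u} W" using deg sAB by blast
    also have "\<dots> = sw {u} A + sw {u} B + sw {u} (Z \<union> R)"
    proof -
      have "sw {u} W = sw {u} (A \<union> B) + sw {u} (Z \<union> R)"
        unfolding sAB(1) by (rule sw_Un_right) (use fin sAB in auto)
      also have "sw {u} (A \<union> B) = sw {u} A + sw {u} B"
        by (rule sw_Un_right) (use sAB in auto)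
      finally show ?thesis .
    qed
    also have "sw {u} A \<le> 2 * real (card {u}) * real (card A)"
    proof (rule sw_bound)
      fix u' v assume "u' \<in> {u}" "v \<in> A"
      then have "w u v \<le> 2" "u' = u" using AB u claim2[of x u v] claim2[of y u v] xy unfolding X_def Y_def by auto
      then show "real (w u' v) \<le> 2" by simp
    qed
    also have "sw {u} B \<le> 4 * real (card B) - card {v\<in>B. w u v \<noteq> 4}"
    proof -
      have "sw {u} B \<le> (\<Sum>v\<in>B. 4 - of_bool (w u v \<noteq> 4))"
        unfolding sw1
      proof (rule sum_mono)
        fix v
        have "w u v \<le> 4 \<and> (w u v \<noteq> 4 \<longrightarrow> w u v \<le> 3)" using w_le4[of u v] by linarith
        then show "real (w u v) \<le> 4 - of_bool (w u v \<noteq> 4)" by auto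
      qed
      also have "\<dots> = 4 * real (card B) - card {v\<in>B. w u v \<noteq> 4}"
        using sAB(3) by (simp add: sum_subtractf sum_of_bool_eq Int_def)
      finally show ?thesis .
    qed
    also have "sw {u} (Z \<union> R) \<le> 4 * real (card {u}) * real (card (Z \<union> R))" by (rule sw_bound4)
    also have "real (card (Z \<union> R)) \<le> 105 * e * N" using card_Un_le[of Z R] cZ cR by linarith
    finally have *: "(3 - 2*e) * N \<le> 2 * real (card A) + 4 * real (card B) - card {v\<in>B. w u v \<noteq> 4} + 420 * e * N"
      by simp
    moreover have "real (card A) \<le> N - real (card B)" using sAB(7) by linarith
    ultimately have "real (card B) \<ge> (1/2 - 211*e) * N" by (simp add: algebra_simps)
    then show ?thesis using * by blast
  qed
  have "x \<in> X" "y \<in> Y" unfolding X_def Y_def using xy yx by auto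
  then have cY: "real (card Y) \<ge> (1/2 - 211*e) * N" and cX: "real (card X) \<ge> (1/2 - 211*e) * N"
    using main[of X Y x] main[of Y X y] by blast+
  have "card {v\<in>Y. w u v \<noteq> 4} \<le> 844 * e * N" if "u \<in> X" for u
  proof -
    have "(3 - 2*e) * N \<le> 2 * real (card X) + 4 * real (card Y) - card {v\<in>Y. w u v \<noteq> 4} + 420 * e * N"
      using main[of X Y u] that by blast
    moreover have "real (card X) \<le> N - real (card Y)" "real (card Y) \<le> N - real (card X)" using cW by linarith+
    ultimately show ?thesis using cX by (simp add: algebra_simps)
  qed
  then show ?thesis using that[OF sub(1,2) XY cX cY] by blast
qed

text \<open>A maximiser \<open>W\<close> of \<open>sw W W - (3 - e) |W|\<^sup>2\<close> has the minimum degree needed above.\<close>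

lemma bipartite_structure_dense:
  fixes e :: real
  assumes n: "n = real (card U)"
    and tot: "sw U U \<ge> (3 - e^2) * n^2"
    and e: "0 < e" "e \<le> 1/2000" and en: "e^2 * n \<ge> 1000"
  obtains X Y where "X \<subseteq> U" "Y \<subseteq> U" "X \<inter> Y = {}"
    "real (card X) \<ge> (1/2 - 212*e) * n" "real (card Y) \<ge> (1/2 - 212*e) * n"
    "card {p\<in>X\<times>Y. w (fst p) (snd p) \<noteq> 4} \<le> 844 * e * n^2"
proof -
  define \<kappa> where "\<kappa> = 3 - e"
  define \<phi> where "\<phi> W = sw W W - \<kappa> * (real (card W))^2" for W
  obtain W where W: "W \<subseteq> U" and max: "\<And>W'. W' \<subseteq> U \<Longrightarrow> \<phi> W' \<le> \<phi> W"
    using finite_maximizer[of "Pow U" \<phi>] finU by auto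
  have finW: "finite W" using W finU finite_subset by blast
  define N where "N = real (card W)"
  have Nn: "N \<le> n" unfolding N_def n using card_mono[OF finU W] by simp
  have n0: "n \<ge> 0" "N \<ge> 0" unfolding n N_def by auto
  have en1: "e * n \<ge> 1000"
  proof -
    have "e^2 * n \<le> e * n" using e n0 by (intro mult_right_mono) (auto simp: power2_eq_square mult_le_cancel_right1)
    then show ?thesis using en by linarith
  qed
  \<comment> \<open>The value of \<open>\<phi>\<close> is at least (e - e^2) n^2 at
    \<open>U\<close>, but by \<open>sw_square_bound3\<close> at most e N^2 + 16 N at the maximiser,
    so the latter cannot be much smaller than \<open>U\<close>.\<close>
  have N1: "N \<ge> (1 - 2*e) * n"
  proof -
    have "\<phi> U \<le> \<phi> W" using max by simp
    then have "(3 - e^2) * n^2 - \<kappa> * n^2 \<le> 3 * N^2 + 16 * N - \<kappa> * N^2"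
      using tot sw_square_bound3[OF W] unfolding \<phi>_def N_def n by linarith
    then have "(e - e^2) * n^2 \<le> e * N^2 + 16 * n" using Nn unfolding \<kappa>_def by (simp add: algebra_simps)
    moreover have "16 * n \<le> e^2 * n * n" using mult_right_mono[OF en n0(1)] n0(1) by linarith
    ultimately have "e * ((1 - 2 * e) * n^2) \<le> e * N^2"
      by (simp add: algebra_simps power2_eq_square)
    then have "(1 - 2*e) * n^2 \<le> N^2" using e by simp
    moreover have "((1 - 2*e) * n)^2 \<le> (1 - 2*e) * n^2"
    proof -
      have "(1 - 2*e)^2 \<le> 1 - 2*e" using e by (simp add: power2_eq_square mult_le_cancel_left1)
      then show ?thesis unfolding power_mult_distrib by (intro mult_right_mono) auto
    qed
    ultimately have "((1 - 2*e) * n)^2 \<le> N^2" by linarith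
    then show ?thesis using n0(2) by (rule power2_le_imp_le)
  qed
  have "e * N \<ge> 100"
  proof -
    have "e * ((1 - 2*e) * n) \<le> e * N" using N1 e by simp
    moreover have "(1 - 2*e) * (e * n) \<ge> 9/10 * (e * n)" using e n0 by (intro mult_right_mono) auto
    ultimately show ?thesis using en1 by (simp add: algebra_simps)
  qed
  have deg: "(3 - 2*e) * N \<le> sw {u} W" if u: "u \<in> W" for u
  proof -
    let ?V = "W - {u}"
    have Wu: "W = {u} \<union> ?V" using u by auto
    have "sw {u} {u} = 0" unfolding sw_def by simp
    moreover have "sw W W = sw {u} W + sw ?V W"
      using sw_Un_left[of "{u}" ?V W] finW Wu by simp
    moreover have "sw ?V W = sw ?V {u} + sw ?V ?V"
      using sw_Un_right[of "{u}" ?V ?V] finW Wu by simp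
    moreover have "sw {u} W = sw {u} {u} + sw {u} ?V"
      using sw_Un_right[of "{u}" ?V "{u}"] finW Wu by simp
    ultimately have "sw W W = sw ?V ?V + 2 * sw {u} W" using sw_commute[of ?V "{u}"] by simp
    moreover have "\<phi> ?V \<le> \<phi> W" using max W by blast
    moreover have "real (card ?V) = N - 1"
    proof -
      have "card W > 0" using u finW card_gt_0_iff by blast
      then show ?thesis unfolding N_def using u by (simp add: of_nat_diff)
    qed
    ultimately have "\<kappa> * N^2 - \<kappa> * (N - 1)^2 \<le> 2 * sw {u} W" unfolding \<phi>_def N_def by simp
    then have "\<kappa> * (2 * N - 1) \<le> 2 * sw {u} W" by (simp add: algebra_simps power2_eq_square)
    then show ?thesis using \<open>e * N \<ge> 100\<close> e unfolding \<kappa>_def by (simp add: algebra_simps)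
  qed
  obtain X Y where XY: "X \<subseteq> W" "Y \<subseteq> W" "X \<inter> Y = {}"
    "real (card X) \<ge> (1/2 - 211*e) * N" "real (card Y) \<ge> (1/2 - 211*e) * N"
    "\<And>u. u \<in> X \<Longrightarrow> card {v\<in>Y. w u v \<noteq> 4} \<le> 844 * e * N"
    using bipartite_structure[OF W N_def deg e \<open>e * N \<ge> 100\<close>, of thesis] by blast
  have fin: "finite X" "finite Y" using XY finW finite_subset by blast+
  \<comment> \<open>Passing from \<open>N\<close> to \<open>n\<close> costs a factor 1 - 2 e, that
    is, about e on top of 211 e.\<close>
  have big: "(1/2 - 212*e) * n \<le> (1/2 - 211*e) * N"
  proof -
    have "(1/2 - 211*e) * ((1 - 2*e) * n) \<le> (1/2 - 211*e) * N" using N1 e by (intro mult_left_mono) auto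
    moreover have "(1/2 - 212*e) * n \<le> ((1/2 - 211*e) * (1 - 2*e)) * n"
      using e n0 by (intro mult_right_mono) (auto simp: algebra_simps)
    ultimately show ?thesis by (simp add: mult.assoc)
  qed
  have "real (card {p\<in>X\<times>Y. w (fst p) (snd p) \<noteq> 4}) \<le> 844 * e * n^2"
  proof -
    have "{p\<in>X\<times>Y. w (fst p) (snd p) \<noteq> 4} = (SIGMA u:X. {v\<in>Y. w u v \<noteq> 4})" by auto
    then have "real (card {p\<in>X\<times>Y. w (fst p) (snd p) \<noteq> 4}) = (\<Sum>u\<in>X. real (card {v\<in>Y. w u v \<noteq> 4}))"
      using fin by simp
    also have "\<dots> \<le> real (card X) * (844 * e * N)" using XY(6) by (rule sum_bounded_above)
    also have "\<dots> \<le> n * (844 * e * n)"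
    proof (rule mult_mono)
      show "real (card X) \<le> n" using card_mono[OF finU, of X] XY(1) W n by (simp add: subset_trans)
    qed (use Nn n0 e in auto)
    finally show ?thesis by (simp add: power2_eq_square algebra_simps)
  qed
  then show ?thesis
    by (rule that[OF subset_trans[OF XY(1) W] subset_trans[OF XY(2) W] XY(3)
      order_trans[OF big XY(4)] order_trans[OF big XY(5)]])
qed

end

section \<open>Dense Fano-free 3-graphs are two-colourable\<close>

lemma ex_in_Inter3:
  fixes b1 b2 b3 :: real
  assumes "finite \<Omega>" "card (\<Omega> - A1) \<le> b1" "card (\<Omega> - A2) \<le> b2" "card (\<Omega> - A3) \<le> b3"
    and "b1 + b2 + b3 < card \<Omega>"
  shows "\<exists>x\<in>\<Omega>. x \<in> A1 \<and> x \<in> A2 \<and> x \<in> A3"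
proof (rule ccontr)
  assume "\<not> ?thesis"
  then have "\<Omega> \<subseteq> (\<Omega> - A1) \<union> (\<Omega> - A2) \<union> (\<Omega> - A3)" by blast
  then have "card \<Omega> \<le> card ((\<Omega> - A1) \<union> (\<Omega> - A2) \<union> (\<Omega> - A3))"
    using assms(1) by (intro card_mono) auto
  also have "\<dots> \<le> card (\<Omega> - A1) + card (\<Omega> - A2) + card (\<Omega> - A3)"
    by (metis add_le_mono1 card_Un_le order_trans)
  finally show False using assms(2-5) by linarith
qed

text \<open>The seven points are automatically distinct in a 3-graph, since any two lie on a common line.\<close>

definition fano_free :: "'a set set \<Rightarrow> bool" where
  "fano_free E \<longleftrightarrow> \<not> (\<exists>a b c p q r s. {a, b, c} \<in> E \<and> {a, p, q} \<in> E \<and> {a, r, s} \<in> E \<and>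
     {b, p, r} \<in> E \<and> {b, q, s} \<in> E \<and> {c, p, s} \<in> E \<and> {c, q, r} \<in> E)"

text \<open>Ordered pairs, so that a vertex of degree \<open>d\<close> has \<open>2 * d\<close> pairs in its link.\<close>

definition link :: "'a set set \<Rightarrow> 'a \<Rightarrow> ('a \<times> 'a) set" where
  "link E v = {(y, z). {v, y, z} \<in> E}"

lemma link_iff [simp]: "(y, z) \<in> link E v \<longleftrightarrow> {v, y, z} \<in> E"
  unfolding link_def by simp

locale three_graph =
  fixes V :: "'a set" and E :: "'a set set"
  assumes finV: "finite V" and edge_sub: "e \<in> E \<Longrightarrow> e \<subseteq> V" and edge_card: "e \<in> E \<Longrightarrow> card e = 3"
begin

lemma edgeD:
  assumes "{a, b, c} \<in> E"
  shows "a \<in> V" "b \<in> V" "c \<in> V" "a \<noteq> b" "a \<noteq> c" "b \<noteq> c"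
proof -
  show "a \<in> V" "b \<in> V" "c \<in> V" using edge_sub[OF assms] by auto
  show "a \<noteq> b" "a \<noteq> c" "b \<noteq> c"
    using edge_card[OF assms] by (auto simp: card_insert_if split: if_splits)
qed

lemma link_sub: "link E v \<subseteq> V \<times> V"
  using edgeD by auto

lemma fin_link: "finite (link E v)"
  using link_sub finV finite_subset by blast

lemma finE: "finite E"
  using edge_sub finV by (meson Pow_iff finite_Pow_iff finite_subset subsetI)

lemma fano_freeD:
  assumes "fano_free E" "(q1, q2) \<in> link E a" "(q3, q4) \<in> link E a" "(q1, q3) \<in> link E b"
    "(q2, q4) \<in> link E b" "(q1, q4) \<in> link E c" "(q2, q3) \<in> link E c" "{a, b, c} \<in> E"
  shows False
  using assms unfolding fano_free_def link_iff by blast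

end

text \<open>The numerical thresholds here and below are only meant to be safe, not close to optimal.\<close>

locale dense_fano_free = three_graph +
  fixes \<epsilon> n :: real
  assumes ff: "fano_free E"
    and n: "n = real (card V)"
    and deg: "v \<in> V \<Longrightarrow> real (card (link E v)) \<ge> (3/4 - \<epsilon>) * n^2"
    and eps: "0 < \<epsilon>" "\<epsilon> \<le> 1 / 10^29"
    and n_large: "n \<ge> 10^32"
begin

lemma n0: "n > 0" "n^2 > 0" using n_large by auto

lemma eps': "\<epsilon> \<le> 1/1000" using eps by (rule_tac order_trans) auto

lemma cardVV: "real (card (V \<times> V)) = n^2"
  unfolding n by (simp add: card_cartesian_product power2_eq_square)

lemma card_VV_diff:
  assumes "A \<subseteq> V \<times> V" shows "real (card (V \<times> V - A)) = n^2 - card A"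
proof -
  have fin: "finite (V \<times> V)" using finV by simp
  have "card A \<le> card (V \<times> V)" using card_mono[OF fin assms] .
  then show ?thesis
    using card_Diff_subset[OF finite_subset[OF assms fin] assms] cardVV by (simp add: of_nat_diff)
qed

lemma link_missing: "v \<in> V \<Longrightarrow> real (card (V \<times> V - link E v)) \<le> (1/4 + \<epsilon>) * n^2"
  using card_VV_diff[OF link_sub, of v] deg[of v] by (simp add: algebra_simps)

lemma square_missing:
  assumes "N \<subseteq> V" "real (card N) \<ge> (3/4 - \<epsilon>) * n"
  shows "real (card (V \<times> V - N \<times> N)) \<le> (7/16 + 3/2 * \<epsilon>) * n^2"
proof -
  have "((3/4 - \<epsilon>) * n)^2 \<le> (real (card N))^2"
    using assms(2) n0 eps' by (intro power_mono) auto
  moreover have "(9/16 - 3/2 * \<epsilon>) * n^2 \<le> ((3/4 - \<epsilon>) * n)^2"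
    unfolding power_mult_distrib using eps by (intro mult_right_mono) (simp_all add: power2_eq_square algebra_simps)
  moreover have "real (card (V \<times> V - N \<times> N)) = n^2 - (real (card N))^2"
    using card_VV_diff[of "N \<times> N"] assms(1) by (auto simp: power2_eq_square card_cartesian_product)
  ultimately show ?thesis by (simp add: algebra_simps)
qed

section \<open>A tetrahedron over a pair of large codegree, and the spread of its cross
  pairs\<close>

definition nb :: "'a \<Rightarrow> 'a \<Rightarrow> 'a set" where "nb x y = {z. {x, y, z} \<in> E}"

lemma nb_sub: "nb x y \<subseteq> V" unfolding nb_def using edgeD(3) by auto

lemma heavy_pair:
  obtains x y where "x \<in> V" "y \<in> V" "real (card (nb x y)) \<ge> (3/4 - \<epsilon>) * n"
proof -
  have "V \<noteq> {}" using n0 n by auto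
  then obtain x where x: "x \<in> V" by blast
  have "link E x = (SIGMA y:V. nb x y)" unfolding nb_def using edgeD by auto
  then have eq: "real (card (link E x)) = (\<Sum>y\<in>V. real (card (nb x y)))"
    using finV finite_subset[OF nb_sub finV] by simp
  have "\<exists>y\<in>V. real (card (nb x y)) \<ge> (3/4 - \<epsilon>) * n"
  proof (rule ccontr)
    assume "\<not> ?thesis"
    then have "(\<Sum>y\<in>V. real (card (nb x y))) < (\<Sum>y\<in>V. (3/4 - \<epsilon>) * n)"
      using finV \<open>V \<noteq> {}\<close> by (intro sum_strict_mono) auto
    then show False using deg[OF x] eq n by (simp add: power2_eq_square algebra_simps)
  qed
  then show ?thesis using that x by blast
qed

text \<open>A pair inside the common neighbourhood of \<open>x y\<close> that also lies in the links
  of \<open>x\<close> and of \<open>y\<close> completes the tetrahedron. The three requirements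
  exclude about 7/16, 1/4 and 1/4 of all ordered pairs, in total 15/16 < 1.\<close>

lemma ex_tetrahedron:
  obtains x y z w where "{x, y, z} \<in> E" "{x, y, w} \<in> E" "{x, z, w} \<in> E" "{y, z, w} \<in> E"
    "real (card (nb x y)) \<ge> (3/4 - \<epsilon>) * n"
proof -
  obtain x y where xy: "x \<in> V" "y \<in> V" "real (card (nb x y)) \<ge> (3/4 - \<epsilon>) * n"
    by (rule heavy_pair)
  have "(7/16 + 3/2 * \<epsilon>) * n^2 + (1/4 + \<epsilon>) * n^2 + (1/4 + \<epsilon>) * n^2 = (15/16 + 7/2 * \<epsilon>) * n^2"
    by (simp add: algebra_simps)
  also have "\<dots> < 1 * n^2" using eps' n0 by (intro mult_strict_right_mono) auto
  finally have "\<exists>p\<in>V \<times> V. p \<in> nb x y \<times> nb x y \<and> p \<in> link E x \<and> p \<in> link E y"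
    using ex_in_Inter3[OF _ square_missing[OF nb_sub xy(3)] link_missing[OF xy(1)] link_missing[OF xy(2)]]
      finV cardVV by simp
  then show ?thesis using that xy(3) unfolding nb_def by auto
qed

text \<open>In the limit structure the link of a vertex in the part \<open>X\<close> consists of all pairs not inside \<open>X\<close>.\<close>

definition cross_missing :: "'a set \<Rightarrow> 'a set \<Rightarrow> real \<Rightarrow> 'a \<Rightarrow> bool" where
  "cross_missing X Y \<eta> s \<longleftrightarrow> real (card (X \<times> Y - link E s)) \<le> \<eta> * n^2"

definition outside_missing :: "'a set \<Rightarrow> real \<Rightarrow> 'a \<Rightarrow> bool" where
  "outside_missing X \<eta> s \<longleftrightarrow> real (card (V \<times> V - X \<times> X - link E s)) \<le> \<eta> * n^2"

lemma outside_missing_cross: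
  assumes "outside_missing X \<eta> s" "A \<subseteq> V" "B \<subseteq> V" "A \<inter> X = {} \<or> B \<inter> X = {}"
  shows "cross_missing A B \<eta> s"
proof -
  have "A \<times> B - link E s \<subseteq> V \<times> V - X \<times> X - link E s" using assms(2-4) by auto
  then have "card (A \<times> B - link E s) \<le> card (V \<times> V - X \<times> X - link E s)"
    using finV by (intro card_mono) auto
  then show ?thesis using assms(1) unfolding outside_missing_def cross_missing_def by linarith
qed

text \<open>Counts the quadruples spoiled by a missing pair: the pair ranges over \<open>Z\<close>,
  the other two points are free, and \<open>f\<close> only puts the four points into their
  places.\<close>

lemma card_image_product:
  assumes "real (card Z) \<le> \<eta> * n^2" "finite Z"
  shows "real (card (f ` (Z \<times> (V \<times> V)))) \<le> \<eta> * n^4"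
proof -
  have "card (f ` (Z \<times> (V \<times> V))) \<le> card (Z \<times> (V \<times> V))"
    using assms finV by (intro card_image_le) auto
  also have "\<dots> = card Z * card (V \<times> V)" by (rule card_cartesian_product)
  finally have "real (card (f ` (Z \<times> (V \<times> V)))) \<le> real (card Z) * n^2"
    using cardVV by (metis of_nat_le_iff of_nat_mult)
  also have "\<dots> \<le> (\<eta> * n^2) * n^2" using assms by (intro mult_right_mono) auto
  also have "\<dots> = \<eta> * n^4" by (simp add: power2_eq_square power4_eq_xxxx)
  finally show ?thesis .
qed

text \<open>A pair in \<open>X\<close> and a pair in \<open>Y\<close>, both in the link of
  \<open>p\<close>, form a Fano plane with the line \<open>{p, s, s'}\<close> unless one of the four
  cross pairs is missing from the link of \<open>s\<close> or \<open>s'\<close>. This happens for at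
  most 4 \<eta> n^4 quadruples, so with \<rho>^2 > 4 \<eta> one of the two sets of pairs is smaller
  than \<rho> n^2.\<close>

lemma one_sided_link:
  assumes XY: "X \<subseteq> V" "Y \<subseteq> V"
    and size: "(real (card X))^2 \<ge> (1/4 - \<sigma>) * n^2" "(real (card Y))^2 \<ge> (1/4 - \<sigma>) * n^2"
    and edge: "{p, s, s'} \<in> E"
    and cm: "cross_missing X Y \<eta> s" "cross_missing X Y \<eta> s'"
    and \<eta>: "4 * \<eta> < \<rho>^2" "\<rho> > 0" "\<epsilon> + \<sigma> + \<rho> \<le> \<rho>'"
  shows "outside_missing X \<rho>' p \<or> outside_missing Y \<rho>' p"
proof -
  have pV: "p \<in> V" using edgeD(1)[OF edge] .
  have fin: "finite X" "finite Y" using XY finV finite_subset by blast+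
  \<comment> \<open>The link misses at most (1/4 + \<epsilon>) n^2 pairs in all, and the square of
    \<open>Z\<close> already uses up (1/4 - \<sigma> - \<rho>) n^2 of them.\<close>
  have half: "outside_missing Z \<rho>' p"
    if Z: "Z \<subseteq> V" "(real (card Z))^2 \<ge> (1/4 - \<sigma>) * n^2" and c: "real (card (link E p \<inter> Z \<times> Z)) < \<rho> * n^2" for Z
  proof -
    have finZ: "finite Z" using Z finV finite_subset by blast
    have "card (V \<times> V - link E p) = card (V \<times> V - Z \<times> Z - link E p) + card (Z \<times> Z - link E p)"
      using Z(1) finV finZ by (subst card_Un_disjoint[symmetric]) (auto intro: arg_cong[where f = card])
    moreover have "card (Z \<times> Z) = card (Z \<times> Z - link E p) + card (link E p \<inter> Z \<times> Z)"
      using card_Int_Diff[of "Z \<times> Z" "link E p"] finZ by (simp only: finite_cartesian_product Int_commute add.commute)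
    moreover have "real (card (Z \<times> Z)) = (real (card Z))^2"
      by (simp add: power2_eq_square card_cartesian_product)
    ultimately have "real (card (V \<times> V - Z \<times> Z - link E p)) \<le> (1/4 + \<epsilon>) * n^2 - (1/4 - \<sigma>) * n^2 + \<rho> * n^2"
      using link_missing[OF pV] Z(2) c by linarith
    also have "\<dots> = (\<epsilon> + \<sigma> + \<rho>) * n^2" by (simp add: algebra_simps)
    also have "\<dots> \<le> \<rho>' * n^2" using \<eta>(3) n0 by (intro mult_right_mono) auto
    finally show ?thesis unfolding outside_missing_def .
  qed
  define P where "P = link E p \<inter> X \<times> X"
  define Q where "Q = link E p \<inter> Y \<times> Y"
  define M where "M = X \<times> Y - link E s"
  define M' where "M' = X \<times> Y - link E s'"
  have finM: "finite M" "finite M'" unfolding M_def M'_def using fin by auto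
  \<comment> \<open>One map for each of the four positions of the missing cross pair within the
    quadruple.\<close>
  define f1 f2 f3 f4 :: "('a \<times> 'a) \<times> ('a \<times> 'a) \<Rightarrow> ('a \<times> 'a) \<times> ('a \<times> 'a)"
    where f: "f1 = (\<lambda>((a, c), (b, d)). ((a, b), (c, d)))" "f2 = (\<lambda>((b, d), (a, c)). ((a, b), (c, d)))"
      "f3 = (\<lambda>((a, d), (b, c)). ((a, b), (c, d)))" "f4 = (\<lambda>((b, c), (a, d)). ((a, b), (c, d)))"
  define B where "B = f1 ` (M \<times> (V \<times> V)) \<union> f2 ` (M \<times> (V \<times> V))
     \<union> f3 ` (M' \<times> (V \<times> V)) \<union> f4 ` (M' \<times> (V \<times> V))"
  have finB: "finite B" unfolding B_def using finM finV by simp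
  have "P \<times> Q \<subseteq> B"
  proof
    fix t assume "t \<in> P \<times> Q"
    then obtain a b c d where t: "t = ((a, b), (c, d))" and ab: "(a, b) \<in> link E p" "a \<in> X" "b \<in> X"
      and cd: "(c, d) \<in> link E p" "c \<in> Y" "d \<in> Y" unfolding P_def Q_def by auto
    have inV: "a \<in> V" "b \<in> V" "c \<in> V" "d \<in> V" using ab cd XY by auto
    have "\<not> ((a, c) \<in> link E s \<and> (b, d) \<in> link E s \<and> (a, d) \<in> link E s' \<and> (b, c) \<in> link E s')"
      using fano_freeD[OF ff ab(1) cd(1) _ _ _ _ edge] by blast
    then consider "(a, c) \<in> M" | "(b, d) \<in> M" | "(a, d) \<in> M'" | "(b, c) \<in> M'"
      unfolding M_def M'_def using ab cd by blast
    then have "t \<in> f1 ` (M \<times> (V \<times> V)) \<or> t \<in> f2 ` (M \<times> (V \<times> V))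
     \<or> t \<in> f3 ` (M' \<times> (V \<times> V)) \<or> t \<in> f4 ` (M' \<times> (V \<times> V))"
    proof cases
      case 1
      then have "t = f1 ((a, c), (b, d))" "((a, c), (b, d)) \<in> M \<times> (V \<times> V)" using inV t f by auto
      then show ?thesis by blast
    next
      case 2
      then have "t = f2 ((b, d), (a, c))" "((b, d), (a, c)) \<in> M \<times> (V \<times> V)" using inV t f by auto
      then show ?thesis by blast
    next
      case 3
      then have "t = f3 ((a, d), (b, c))" "((a, d), (b, c)) \<in> M' \<times> (V \<times> V)" using inV t f by auto
      then show ?thesis by blast
    next
      case 4
      then have "t = f4 ((b, c), (a, d))" "((b, c), (a, d)) \<in> M' \<times> (V \<times> V)" using inV t f by auto
      then show ?thesis by blast
    qed
    then show "t \<in> B" unfolding B_def by blast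
  qed
  then have "card (P \<times> Q) \<le> card B" using finB card_mono by blast
  moreover have "real (card B) \<le> 4 * \<eta> * n^4"
  proof -
    have M: "real (card M) \<le> \<eta> * n^2" "real (card M') \<le> \<eta> * n^2"
      using cm unfolding cross_missing_def M_def M'_def by auto
    have "card B \<le> card (f1 ` (M \<times> (V \<times> V))) + card (f2 ` (M \<times> (V \<times> V)))
     + card (f3 ` (M' \<times> (V \<times> V))) + card (f4 ` (M' \<times> (V \<times> V)))"
      unfolding B_def by (intro order_trans[OF card_Un_le] add_mono order_refl)
    then show ?thesis
      using card_image_product[OF M(1) finM(1), of f1] card_image_product[OF M(1) finM(1), of f2]
       card_image_product[OF M(2) finM(2), of f3] card_image_product[OF M(2) finM(2), of f4]
      by linarith
  qed
  ultimately have PQ: "real (card P) * real (card Q) \<le> 4 * \<eta> * n^4"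
    by (simp add: card_cartesian_product flip: of_nat_mult)
  have "real (card P) < \<rho> * n^2 \<or> real (card Q) < \<rho> * n^2"
  proof (rule ccontr)
    assume "\<not> ?thesis"
    then have "(\<rho> * n^2) * (\<rho> * n^2) \<le> real (card P) * real (card Q)"
      using \<eta> n0 by (intro mult_mono) auto
    then have "\<rho>^2 * n^4 \<le> 4 * \<eta> * n^4"
      using PQ by (simp add: power2_eq_square power4_eq_xxxx algebra_simps)
    then show False using \<eta>(1) n0 by simp
  qed
  then show ?thesis using half[OF XY(1) size(1)] half[OF XY(2) size(2)] unfolding P_def Q_def by blast
qed

text \<open>Assigning the three perfect matchings of a quadruple in \<open>Y\<close> to
  \<open>a\<close>, \<open>b\<close>, \<open>c\<close> gives a Fano plane unless one of its six
  pairs is missing. Each position is responsible for at most \<rho> n^4 ordered quadruples, so some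
  quadruple is good. In the application \<open>Y\<close> is the class opposite to the edge.\<close>

lemma no_monochromatic_edge:
  assumes Y: "Y \<subseteq> V" "(real (card Y))^4 > 6 * \<rho> * n^4"
    and edge: "{a, b, c} \<in> E"
    and cm: "cross_missing Y Y \<rho> a" "cross_missing Y Y \<rho> b" "cross_missing Y Y \<rho> c"
  shows False
proof -
  have finY: "finite Y" using Y finV finite_subset by blast
  define M where "M v = Y \<times> Y - link E v" for v
  have M: "real (card (M a)) \<le> \<rho> * n^2" "real (card (M b)) \<le> \<rho> * n^2" "real (card (M c)) \<le> \<rho> * n^2"
    using cm unfolding cross_missing_def M_def by auto
  have finM: "finite (M v)" for v unfolding M_def using finY by simp
  define f1 f2 f3 f4 f5 f6 :: "('a \<times> 'a) \<times> ('a \<times> 'a) \<Rightarrow> ('a \<times> 'a) \<times> ('a \<times> 'a)"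
    where f: "f1 = (\<lambda>((x, y), (z, w)). ((x, y), (z, w)))" "f2 = (\<lambda>((z, w), (x, y)). ((x, y), (z, w)))"
     "f3 = (\<lambda>((x, z), (y, w)). ((x, y), (z, w)))" "f4 = (\<lambda>((y, w), (x, z)). ((x, y), (z, w)))"
     "f5 = (\<lambda>((x, w), (y, z)). ((x, y), (z, w)))" "f6 = (\<lambda>((y, z), (x, w)). ((x, y), (z, w)))"
  define B where "B = f1 ` (M a \<times> (V \<times> V)) \<union> f2 ` (M a \<times> (V \<times> V)) \<union> f3 ` (M b \<times> (V \<times> V))
     \<union> f4 ` (M b \<times> (V \<times> V)) \<union> f5 ` (M c \<times> (V \<times> V)) \<union> f6 ` (M c \<times> (V \<times> V))"
  have finB: "finite B" unfolding B_def using finM finV by simp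
  have "(Y \<times> Y) \<times> (Y \<times> Y) \<subseteq> B"
  proof
    fix t assume "t \<in> (Y \<times> Y) \<times> (Y \<times> Y)"
    then obtain x y z w where t: "t = ((x, y), (z, w))" and xy: "x \<in> Y" "y \<in> Y" "z \<in> Y" "w \<in> Y" by auto
    have inV: "x \<in> V" "y \<in> V" "z \<in> V" "w \<in> V" using xy Y by auto
    have "\<not> ((x, y) \<in> link E a \<and> (z, w) \<in> link E a \<and> (x, z) \<in> link E b \<and> (y, w) \<in> link E b
       \<and> (x, w) \<in> link E c \<and> (y, z) \<in> link E c)"
      using fano_freeD[OF ff _ _ _ _ _ _ edge] by blast
    then consider "(x, y) \<in> M a" | "(z, w) \<in> M a" | "(x, z) \<in> M b" | "(y, w) \<in> M b" | "(x, w) \<in> M c" | "(y, z) \<in> M c"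
      unfolding M_def using xy by blast
    then have "t \<in> f1 ` (M a \<times> (V \<times> V)) \<or> t \<in> f2 ` (M a \<times> (V \<times> V)) \<or> t \<in> f3 ` (M b \<times> (V \<times> V))
     \<or> t \<in> f4 ` (M b \<times> (V \<times> V)) \<or> t \<in> f5 ` (M c \<times> (V \<times> V)) \<or> t \<in> f6 ` (M c \<times> (V \<times> V))"
    proof cases
      case 1
      then have "t = f1 ((x, y), (z, w))" "((x, y), (z, w)) \<in> M a \<times> (V \<times> V)" using inV t f by auto
      then show ?thesis by blast
    next
      case 2
      then have "t = f2 ((z, w), (x, y))" "((z, w), (x, y)) \<in> M a \<times> (V \<times> V)" using inV t f by auto
      then show ?thesis by blast
    next
      case 3
      then have "t = f3 ((x, z), (y, w))" "((x, z), (y, w)) \<in> M b \<times> (V \<times> V)" using inV t f by auto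
      then show ?thesis by blast
    next
      case 4
      then have "t = f4 ((y, w), (x, z))" "((y, w), (x, z)) \<in> M b \<times> (V \<times> V)" using inV t f by auto
      then show ?thesis by blast
    next
      case 5
      then have "t = f5 ((x, w), (y, z))" "((x, w), (y, z)) \<in> M c \<times> (V \<times> V)" using inV t f by auto
      then show ?thesis by blast
    next
      case 6
      then have "t = f6 ((y, z), (x, w))" "((y, z), (x, w)) \<in> M c \<times> (V \<times> V)" using inV t f by auto
      then show ?thesis by blast
    qed
    then show "t \<in> B" unfolding B_def by blast
  qed
  then have "card ((Y \<times> Y) \<times> (Y \<times> Y)) \<le> card B" using finB card_mono by blast
  then have "(real (card Y))^4 \<le> real (card B)"
    by (simp add: card_cartesian_product power4_eq_xxxx mult.assoc flip: of_nat_mult)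
  also have "card B \<le> card (f1 ` (M a \<times> (V \<times> V))) + card (f2 ` (M a \<times> (V \<times> V))) + card (f3 ` (M b \<times> (V \<times> V)))
     + card (f4 ` (M b \<times> (V \<times> V))) + card (f5 ` (M c \<times> (V \<times> V))) + card (f6 ` (M c \<times> (V \<times> V)))"
    unfolding B_def by (intro order_trans[OF card_Un_le] add_mono order_refl)
  then have "real (card B) \<le> 6 * \<rho> * n^4"
    using card_image_product[OF M(1) finM, of f1] card_image_product[OF M(1) finM, of f2]
      card_image_product[OF M(2) finM, of f3] card_image_product[OF M(2) finM, of f4]
      card_image_product[OF M(3) finM, of f5] card_image_product[OF M(3) finM, of f6]
    by linarith
  finally show False using Y(2) by linarith
qed

text \<open>A pair of weight 4 is one that lies in the links of all four vertices of the
  tetrahedron, so the near-bipartite colouring gives the cross property for each of them. The heavy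
  pair of the tetrahedron is returned as \<open>s\<close>, \<open>s'\<close>.\<close>

lemma cross_pair:
  obtains X Y s s' where "X \<subseteq> V" "Y \<subseteq> V" "X \<inter> Y = {}"
    "(real (card X))^2 \<ge> (1/4 - 213 / 10^14) * n^2" "(real (card Y))^2 \<ge> (1/4 - 213 / 10^14) * n^2"
    "cross_missing X Y (844 / 10^14) s" "cross_missing X Y (844 / 10^14) s'"
    "real (card (nb s s')) \<ge> (3/4 - \<epsilon>) * n"
proof -
  obtain x y z v where t: "{x, y, z} \<in> E" "{x, y, v} \<in> E" "{x, z, v} \<in> E" "{y, z, v} \<in> E"
    and big: "real (card (nb x y)) \<ge> (3/4 - \<epsilon>) * n" by (rule ex_tetrahedron)
  define S where "S = {x, y, z, v}"
  have dist: "x \<noteq> y" "x \<noteq> z" "x \<noteq> v" "y \<noteq> z" "y \<noteq> v" "z \<noteq> v"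
    using edgeD[OF t(1)] edgeD[OF t(2)] edgeD[OF t(3)] by auto
  have SV: "S \<subseteq> V" unfolding S_def using edgeD[OF t(1)] edgeD[OF t(2)] by auto
  have cardS: "card S = 4" unfolding S_def using dist by simp
  have finS: "finite S" unfolding S_def by simp
  have SE: "{i, j, k} \<in> E" if "i \<in> S" "j \<in> S" "k \<in> S" "i \<noteq> j" "i \<noteq> k" "j \<noteq> k" for i j k
    using that t unfolding S_def by (auto simp: insert_commute)
  define U where "U = V - S"
  define c where "c u v = {s\<in>S. {s, u, v} \<in> E}" for u v
  have finU: "finite U" unfolding U_def using finV by simp
  interpret link_colouring U S c
  proof
    show "finite U" by (rule finU)
    show "card S = 4" by (rule cardS)
    show "c u v \<subseteq> S" "c u v = c v u" for u v unfolding c_def by (auto simp: insert_commute)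
    show "c u u = {}" for u unfolding c_def using edgeD(6) by blast
  next
    fix p q r s i j k
    assume "i \<in> c p q" "i \<in> c r s" "j \<in> c p r" "j \<in> c q s" "k \<in> c p s" "k \<in> c q r" "distinct [i, j, k]"
    then show False
      using fano_freeD[OF ff, of p q i r s j k] SE[of i j k] unfolding c_def by auto
  qed
  define m where "m = real (card U)"
  have "card V = card U + 4"
  proof -
    have "card U = card V - 4" unfolding U_def using card_Diff_subset[OF finS SV] cardS by simp
    moreover have "card V \<ge> 4" using card_mono[OF finV SV] cardS by simp
    ultimately show ?thesis by simp
  qed
  then have mn: "m = n - 4" unfolding m_def n by simp
  have tot: "sw U U \<ge> (3 - 4 * \<epsilon>) * n^2 - 32 * n"
  proof -
    have "sw U U = (\<Sum>u\<in>U. \<Sum>v\<in>U. \<Sum>s\<in>S. of_bool ({s, u, v} \<in> E))"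
      unfolding sw_def link_colouring.w_def[OF link_colouring_axioms] c_def using finS
      by (simp add: sum_of_bool_eq Int_def)
    also have "\<dots> = (\<Sum>s\<in>S. \<Sum>u\<in>U. \<Sum>v\<in>U. of_bool ({s, u, v} \<in> E))"
      by (simp only: sum.swap[of _ S U])
    also have "\<dots> = (\<Sum>s\<in>S. real (card (link E s \<inter> U \<times> U)))"
    proof (rule sum.cong)
      fix s assume "s \<in> S"
      have "(\<Sum>u\<in>U. \<Sum>v\<in>U. of_bool ({s, u, v} \<in> E)) = (\<Sum>p\<in>U\<times>U. of_bool (p \<in> link E s) :: real)"
        by (simp add: sum.cartesian_product case_prod_beta link_def)
      also have "\<dots> = real (card (link E s \<inter> U \<times> U))"
        using finU by (simp add: sum_of_bool_eq Int_commute)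
      finally show "(\<Sum>u\<in>U. \<Sum>v\<in>U. of_bool ({s, u, v} \<in> E)) = real (card (link E s \<inter> U \<times> U))" .
    qed simp
    \<comment> \<open>Passing from \<open>V\<close> to \<open>U\<close> removes at most 8 n ordered
      pairs with an entry in \<open>S\<close> from each link.\<close>
    also have "\<dots> \<ge> real (card S) * ((3/4 - \<epsilon>) * n^2 - 8 * n)"
    proof (rule sum_bounded_below)
      fix s assume s: "s \<in> S"
      have "link E s \<subseteq> (link E s \<inter> U \<times> U) \<union> (S \<times> V \<union> V \<times> S)"
        using link_sub unfolding U_def by auto
      then have "card (link E s) \<le> card ((link E s \<inter> U \<times> U) \<union> (S \<times> V \<union> V \<times> S))"
        using fin_link finS finV by (intro card_mono) auto
      also have "\<dots> \<le> card (link E s \<inter> U \<times> U) + (card (S \<times> V) + card (V \<times> S))"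
        by (intro order_trans[OF card_Un_le] add_mono order_refl card_Un_le)
      finally have "real (card (link E s)) \<le> real (card (link E s \<inter> U \<times> U)) + 8 * n"
        unfolding n using cardS by (simp add: card_cartesian_product)
      then show "(3/4 - \<epsilon>) * n^2 - 8 * n \<le> real (card (link E s \<inter> U \<times> U))"
        using deg[of s] s SV by auto
    qed
    finally show ?thesis using cardS by (simp add: algebra_simps)
  qed
  \<comment> \<open>With k = n^2 / 10^29 the deficit 4 \<epsilon> n^2 + 32 n is at most 5 k, and e^2
    n^2 is 10 k.\<close>
  define e :: real where "e = 1 / 10^14"
  have tot_e: "sw U U \<ge> (3 - e^2) * m^2"
  proof -
    have "m^2 \<le> n^2" unfolding mn using n_large by (intro power_mono) auto
    then have "(3 - e^2) * m^2 \<le> (3 - e^2) * n^2"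
      unfolding e_def by (intro mult_left_mono) (auto simp: power2_eq_square)
    moreover define k where "k = 1/10^29 * n^2"
    moreover have "32 * n \<le> k"
    proof -
      have "32 * n \<le> (1/10^29 * n) * n" using n_large n0 by (intro mult_right_mono) auto
      then show ?thesis unfolding k_def by (simp add: power2_eq_square)
    qed
    moreover have "\<epsilon> * n^2 \<le> k" unfolding k_def using eps(2) n0 by (intro mult_right_mono) auto
    moreover have "(3 - e^2) * n^2 = 3 * n^2 - 10 * k" unfolding e_def k_def by (simp add: power2_eq_square algebra_simps)
    moreover have "(3 - 4 * \<epsilon>) * n^2 = 3 * n^2 - 4 * (\<epsilon> * n^2)" by (simp add: algebra_simps)
    moreover have "k > 0" unfolding k_def using n0 by simp
    ultimately show ?thesis using tot by linarith
  qed
  have e: "0 < e" "e \<le> 1/2000" "e^2 * m \<ge> 1000" unfolding e_def mn using n_large by (auto simp: power2_eq_square)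
  obtain X Y where XY: "X \<subseteq> U" "Y \<subseteq> U" "X \<inter> Y = {}"
    "real (card X) \<ge> (1/2 - 212*e) * m" "real (card Y) \<ge> (1/2 - 212*e) * m"
    "real (card {p\<in>X\<times>Y. w (fst p) (snd p) \<noteq> 4}) \<le> 844 * e * m^2"
    using bipartite_structure_dense[OF m_def tot_e e, of thesis] by blast
  \<comment> \<open>The step from 212 to 213 absorbs the four vertices of \<open>S\<close> missing
    from \<open>U\<close>.\<close>
  have size: "(real k)^2 \<ge> (1/4 - 213 / 10^14) * n^2" if "real k \<ge> (1/2 - 212*e) * m" for k
  proof -
    have "(1/2 - 213/10^14) * n \<le> (1/2 - 212*e) * m" unfolding mn e_def using n_large by simp
    then have "((1/2 - 213/10^14) * n)^2 \<le> (real k)^2" using that n0 by (intro power_mono) auto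
    moreover have "(1/4 - 213 / 10^14) * n^2 \<le> ((1/2 - 213/10^14) * n)^2"
      unfolding power_mult_distrib using n0 by (intro mult_right_mono) (auto simp: power2_eq_square)
    ultimately show ?thesis by linarith
  qed
  have cm: "cross_missing X Y (844 / 10^14) s" if s: "s \<in> S" for s
  proof -
    have finXY: "finite (X \<times> Y)" using XY finU finite_subset by blast
    have "p \<in> link E s" if "w (fst p) (snd p) = 4" for p
    proof -
      have "c (fst p) (snd p) = S"
        using that card_subset_eq[OF finS c_sub, of "fst p" "snd p"] cardS
        unfolding link_colouring.w_def[OF link_colouring_axioms] by simp
      then show ?thesis using s unfolding c_def link_def by auto
    qed
    then have "card (X \<times> Y - link E s) \<le> card {p\<in>X\<times>Y. w (fst p) (snd p) \<noteq> 4}"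
      using finXY by (intro card_mono) auto
    moreover have "844 * e * m^2 \<le> 844 * e * n^2"
      unfolding mn e_def using n_large by (intro mult_left_mono power_mono) auto
    ultimately show ?thesis using XY(6) unfolding cross_missing_def e_def by simp
  qed
  have "X \<subseteq> V" "Y \<subseteq> V" using XY(1,2) unfolding U_def by auto
  then show ?thesis
    by (rule that[OF _ _ XY(3) size[OF XY(4)] size[OF XY(5)] cm cm big]) (auto simp: S_def)
qed

theorem two_colourable: "\<exists>A\<subseteq>V. \<forall>e\<in>E. \<not> e \<subseteq> A \<and> \<not> e \<subseteq> V - A"
proof -
  define \<sigma> :: real where "\<sigma> = 213 / 10^14"
  obtain X Y s s' where XY: "X \<subseteq> V" "Y \<subseteq> V" "X \<inter> Y = {}"
    and size: "(real (card X))^2 \<ge> (1/4 - \<sigma>) * n^2" "(real (card Y))^2 \<ge> (1/4 - \<sigma>) * n^2"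
    and cm: "cross_missing X Y (844 / 10^14) s" "cross_missing X Y (844 / 10^14) s'"
    and big: "real (card (nb s s')) \<ge> (3/4 - \<epsilon>) * n"
    unfolding \<sigma>_def by (rule cross_pair)
  have eps5: "\<epsilon> \<le> 1/10^6" by (rule order_trans[OF eps(2)]) simp
  have YX: "Y \<inter> X = {}" using XY(3) by auto
  \<comment> \<open>Both alternatives of \<open>one_sided_link\<close> contain the cross pairs,
    because \<open>X \<times> Y\<close> lies outside the square of either part. Hence all of
    \<open>nb s s'\<close> inherits the cross property.\<close>
  have T: "cross_missing X Y (2 / 10^5) p" if "p \<in> nb s s'" for p
  proof -
    have "{p, s, s'} \<in> E" using that unfolding nb_def by (simp add: insert_commute)
    then have "outside_missing X (2 / 10^5) p \<or> outside_missing Y (2 / 10^5) p"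
      by (rule one_sided_link[OF XY(1,2) size _ cm, of _ "1/10^5"])
        (use eps5 in \<open>auto simp: \<sigma>_def power2_eq_square\<close>)
    then show ?thesis using outside_missing_cross XY YX by blast
  qed
  \<comment> \<open>Any two vertices of \<open>nb s s'\<close> can now replace \<open>s\<close>,
    \<open>s'\<close>. Their pairs fill about 9/16 of the square and the link of \<open>p\<close>
    about 3/4, so every \<open>p\<close> lies in an edge with two of them.\<close>
  have all: "outside_missing X (1/100) p \<or> outside_missing Y (1/100) p" if p: "p \<in> V" for p
  proof -
    have "(7/16 + 3/2 * \<epsilon>) * n^2 + (1/4 + \<epsilon>) * n^2 + (1/4 + \<epsilon>) * n^2 = (15/16 + 7/2 * \<epsilon>) * n^2"
      by (simp add: algebra_simps)
    also have "\<dots> < 1 * n^2" using eps' n0 by (intro mult_strict_right_mono) auto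
    finally have "\<exists>q\<in>V \<times> V. q \<in> nb s s' \<times> nb s s' \<and> q \<in> link E p \<and> q \<in> link E p"
      using ex_in_Inter3[OF _ square_missing[OF nb_sub big] link_missing[OF p] link_missing[OF p]]
        finV cardVV by simp
    then obtain q q' where q: "{p, q, q'} \<in> E" "q \<in> nb s s'" "q' \<in> nb s s'" by auto
    show ?thesis
      by (rule one_sided_link[OF XY(1,2) size q(1) T[OF q(2)] T[OF q(3)], where \<rho> = "9/1000"])
        (use eps5 in \<open>auto simp: \<sigma>_def power2_eq_square\<close>)
  qed
  \<comment> \<open>Each part has about n/2 vertices, hence about n^4 / 16 quadruples, more than the
    6/100 n^4 that can be spoiled.\<close>
  have pow4: "(real k)^4 > 6 * (1/100) * n^4" if "(real k)^2 \<ge> (1/4 - \<sigma>) * n^2" for k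
  proof -
    have "((1/4 - \<sigma>) * n^2)^2 \<le> ((real k)^2)^2" using that n0 unfolding \<sigma>_def by (intro power_mono) auto
    moreover have "((1/4 - \<sigma>) * n^2)^2 = (1/4 - \<sigma>)^2 * n^4" by (simp add: power_mult_distrib flip: power_mult)
    moreover have "(1/4 - \<sigma>)^2 * n^4 > 6 * (1/100) * n^4"
      unfolding \<sigma>_def using n0 by (intro mult_strict_right_mono) (auto simp: power2_eq_square)
    ultimately show ?thesis by (simp flip: power_mult)
  qed
  define A where "A = {v\<in>V. outside_missing X (1/100) v}"
  \<comment> \<open>Vertices whose link avoids the square of \<open>Z\<close> see almost every pair
    inside the opposite part \<open>Z'\<close>, where \<open>no_monochromatic_edge\<close> is
    applied.\<close>
  have mono: False if e: "e \<in> E" and Z: "Z \<subseteq> V" "Z' \<subseteq> V" "Z \<inter> Z' = {}" "(real (card Z'))^2 \<ge> (1/4 - \<sigma>) * n^2"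
    and om: "\<And>v. v \<in> e \<Longrightarrow> outside_missing Z (1/100) v" for e Z Z'
  proof -
    obtain a b c where abc: "e = {a, b, c}" using edge_card[OF e] by (auto simp: card_3_iff)
    have "cross_missing Z' Z' (1/100) v" if "v \<in> e" for v
      using outside_missing_cross[OF om[OF that] Z(2) Z(2)] Z(3) by auto
    then show False using no_monochromatic_edge[OF Z(2) pow4[OF Z(4)], of a b c] e abc by auto
  qed
  have "A \<subseteq> V" unfolding A_def by auto
  moreover have "\<not> e \<subseteq> A" if "e \<in> E" for e
    using mono[OF that XY(1,2,3) size(2)] unfolding A_def by auto
  moreover have "\<not> e \<subseteq> V - A" if "e \<in> E" for e
    using mono[OF that XY(2,1) YX size(1)] all unfolding A_def by auto
  ultimately show ?thesis by blast
qed

end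

section \<open>The Turan theorem for the Fano plane\<close>

lemma real_choose_2: "real (n choose 2) = real n * (real n - 1) / 2"
  by (induction n) (auto simp: numeral_eq_Suc field_simps)

lemma choose_3_Suc: "Suc k choose 3 = (k choose 2) + (k choose 3)"
  by (simp add: numeral_eq_Suc)

lemma real_choose_3: "real (n choose 3) = real n * (real n - 1) * (real n - 2) / 6"
proof (induction n)
  case (Suc n)
  have "real (Suc n choose 3) = real (n choose 2) + real (n choose 3)"
    using choose_3_Suc[of n] by simp
  then show ?case using Suc by (simp add: real_choose_2 field_simps)
qed simp

text \<open>The number of triples inside one of the two parts of a balanced bipartition of \<open>m\<close> points.\<close>

definition bip_missing :: "nat \<Rightarrow> nat" where
  "bip_missing m = (m div 2 choose 3) + (m - m div 2 choose 3)"

text \<open>A new point joins the smaller part, of size \<open>m div 2\<close>, and forms a triple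
  inside it with each pair of that part.\<close>

lemma bip_missing_Suc: "bip_missing (Suc m) = bip_missing m + (m div 2 choose 2)"
proof (cases "even m")
  case True
  then obtain k where k: "m = 2 * k" by blast
  have "Suc (2 * k) div 2 = k" "Suc (2 * k) - k = Suc k" "2 * k div 2 = k" "2 * k - k = k" by simp_all
  then show ?thesis unfolding bip_missing_def k by (simp add: choose_3_Suc)
next
  case False
  then obtain k where k: "m = 2 * k + 1" using oddE by blast
  have "Suc (2 * k + 1) div 2 = Suc k" "Suc (2 * k + 1) - Suc k = Suc k" "(2 * k + 1) div 2 = k" "2 * k + 1 - k = Suc k"
    by simp_all
  then show ?thesis unfolding bip_missing_def k by (simp add: choose_3_Suc)
qed

lemma balanced_product:
  fixes a b m :: nat
  assumes "a + b = m"
  shows "a * b \<le> (m div 2) * (m - m div 2)"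
    and "a * b = (m div 2) * (m - m div 2) \<Longrightarrow> a = m div 2 \<or> b = m div 2"
proof -
  define k where "k = m div 2"
  define d where "d = int a - int k"
  have a: "int a = int k + d" unfolding d_def by simp
  \<comment> \<open>For odd m the optimal sizes k and k + 1 occur in either order, corresponding to
    deviations 0 and 1.\<close>
  have sq: "d \<le> d * d" "d = d * d \<longleftrightarrow> d = 0 \<or> d = 1"
    by (auto, cases "d \<le> 0", simp_all add: mult_le_cancel_left1 order_trans)
  have "a * b \<le> k * (m - k) \<and> (a * b = k * (m - k) \<longrightarrow> a = k \<or> b = k)"
  proof (cases "even m")
    case True
    then have m: "m = 2 * k" unfolding k_def by simp
    then have b: "int b = int k - d" using assms a by linarith
    have "int (a * b) = int (k * (m - k)) - d * d"
      unfolding of_nat_mult a b using m by (simp add: algebra_simps)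
    moreover have "d * d \<ge> 0" by simp
    moreover have "d * d = 0 \<Longrightarrow> a = k" using a by simp
    ultimately show ?thesis by linarith
  next
    case False
    then have m: "m = 2 * k + 1" unfolding k_def by presburger
    then have b: "int b = int k + 1 - d" using assms a by linarith
    have "int (a * b) = int (k * (m - k)) + d - d * d"
      unfolding of_nat_mult a b using m by (simp add: algebra_simps)
    moreover have "d = d * d \<Longrightarrow> a = k \<or> b = k" using a b sq(2) by auto
    ultimately show ?thesis using sq(1) by linarith
  qed
  then show "a * b \<le> (m div 2) * (m - m div 2)"
    "a * b = (m div 2) * (m - m div 2) \<Longrightarrow> a = m div 2 \<or> b = m div 2" unfolding k_def by auto
qed

text \<open>A triple meeting both parts contains exactly two of the \<open>a * b\<close> cross
  pairs, and each cross pair extends to \<open>m - 2\<close> triples.\<close>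

lemma choose_3_add:
  assumes "a + b = m"
  shows "real (a choose 3) + real (b choose 3) = real (m choose 3) - real (a * b) * (real m - 2) / 2"
proof -
  have "real m = real a + real b" using assms by (simp flip: of_nat_add)
  then show ?thesis by (simp add: real_choose_3 field_simps)
qed

lemma real_bip_missing:
  "real (bip_missing m) = real (m choose 3) - real ((m div 2) * (m - m div 2)) * (real m - 2) / 2"
  unfolding bip_missing_def using choose_3_add[of "m div 2" "m - m div 2" m] by simp

lemma bip_missing_le:
  assumes "a + b = m" "m \<ge> 3"
  shows "bip_missing m \<le> (a choose 3) + (b choose 3)"
    and "bip_missing m = (a choose 3) + (b choose 3) \<Longrightarrow> a = m div 2 \<or> b = m div 2"
proof -
  note eq = choose_3_add[OF assms(1)] real_bip_missing[of m]
  have "real (a * b) \<le> real ((m div 2) * (m - m div 2))"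
    using balanced_product(1)[OF assms(1)] of_nat_le_iff by blast
  then have "real (a * b) * (real m - 2) \<le> real ((m div 2) * (m - m div 2)) * (real m - 2)"
    using assms(2) by (intro mult_right_mono) auto
  then have "real (bip_missing m) \<le> real (a choose 3) + real (b choose 3)" using eq by linarith
  then show "bip_missing m \<le> (a choose 3) + (b choose 3)" by (simp flip: of_nat_add)
  assume "bip_missing m = (a choose 3) + (b choose 3)"
  then have "real (bip_missing m) = real (a choose 3) + real (b choose 3)" by simp
  then have "real (a * b) * (real m - 2) = real ((m div 2) * (m - m div 2)) * (real m - 2)"
    using eq by linarith
  then have "real (a * b) = real ((m div 2) * (m - m div 2))" using assms(2) by simp
  then have "a * b = (m div 2) * (m - m div 2)" using of_nat_eq_iff by blast
  then show "a = m div 2 \<or> b = m div 2" by (rule balanced_product(2)[OF assms(1)])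
qed

lemma half_product_bounds:
  "real ((m div 2) * (m - m div 2)) \<le> (real m)^2 / 4"
  "real ((m div 2) * (m - m div 2)) \<ge> ((real m)^2 - 1) / 4"
proof -
  have "real ((m div 2) * (m - m div 2)) = (real m)^2 / 4 \<or> real ((m div 2) * (m - m div 2)) = ((real m)^2 - 1) / 4"
  proof (cases "even m")
    case True
    then obtain k where "m = 2 * k" by blast
    then show ?thesis by (simp add: power2_eq_square)
  next
    case False
    then obtain k where k: "m = 2 * k + 1" using oddE by blast
    have "(2 * k + 1) div 2 = k" "2 * k + 1 - k = k + 1" by simp_all
    then show ?thesis unfolding k by (simp add: power2_eq_square field_simps)
  qed
  then show "real ((m div 2) * (m - m div 2)) \<le> (real m)^2 / 4"
    "real ((m div 2) * (m - m div 2)) \<ge> ((real m)^2 - 1) / 4" by auto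
qed

text \<open>The number of edges of the balanced bipartite 3-graph, taken as a real number for the
  estimates below.\<close>

definition bip_size :: "nat \<Rightarrow> real" where
  "bip_size n = real (n choose 3) - real (bip_missing n)"

lemma bip_size_eq: "2 * bip_size n = real ((n div 2) * (n - n div 2)) * (real n - 2)"
  unfolding bip_size_def real_bip_missing by simp

lemma bip_size_upper:
  assumes "n \<ge> 2" shows "bip_size n \<le> (real n)^3 / 8"
proof -
  have "2 * bip_size n \<le> (real n)^2 / 4 * real n"
    unfolding bip_size_eq using assms by (intro mult_mono half_product_bounds) auto
  then show ?thesis by (simp add: power2_eq_square power3_eq_cube)
qed

lemma bip_size_lower:
  assumes "n \<ge> 2" shows "bip_size n \<ge> (real n)^3 / 8 - (real n)^2 / 4 - real n / 8"
proof -
  have "2 * bip_size n \<ge> ((real n)^2 - 1) / 4 * (real n - 2)"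
    unfolding bip_size_eq using assms by (intro mult_right_mono half_product_bounds) auto
  then show ?thesis by (simp add: power2_eq_square power3_eq_cube field_simps)
qed

lemma bip_size_Suc: "bip_size (Suc k) \<ge> bip_size k + 3/8 * (real k)^2 - real k / 2"
proof -
  have "bip_size (Suc k) - bip_size k = real (k choose 2) - real (k div 2 choose 2)"
    unfolding bip_size_def bip_missing_Suc choose_3_Suc by simp
  moreover have "real (k div 2 choose 2) \<le> (real k)^2 / 8"
  proof -
    have h: "real (k div 2) \<le> real k / 2" by linarith
    have "real (k div 2 choose 2) \<le> (real (k div 2))^2 / 2"
      by (simp add: real_choose_2 power2_eq_square algebra_simps)
    also have "\<dots> \<le> (real k / 2)^2 / 2" using h by (intro divide_right_mono power_mono) auto
    finally show ?thesis by (simp add: power2_eq_square)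
  qed
  ultimately show ?thesis by (simp add: real_choose_2 power2_eq_square field_simps)
qed

definition bip_edges :: "'a set \<Rightarrow> 'a set \<Rightarrow> 'a set \<Rightarrow> 'a set set" where
  "bip_edges V A B = {e. e \<subseteq> V \<and> card e = 3 \<and> \<not> e \<subseteq> A \<and> \<not> e \<subseteq> B}"

lemma finite_bip_edges: "finite V \<Longrightarrow> finite (bip_edges V A B)"
  unfolding bip_edges_def by simp

lemma card_bip_edges:
  assumes "finite V" "A \<subseteq> V" "B \<subseteq> V" "A \<inter> B = {}"
  shows "card (bip_edges V A B) + (card A choose 3) + (card B choose 3) = card V choose 3"
proof -
  let ?T = "\<lambda>X. {e. e \<subseteq> X \<and> card e = 3}"
  have finAB: "finite A" "finite B" using finite_subset[OF _ assms(1)] assms(2,3) by blast+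
  then have fin: "finite (?T A)" "finite (?T B)" "finite (bip_edges V A B)"
    using finite_bip_edges[OF assms(1)] by simp_all
  have disj: "?T A \<inter> ?T B = {}"
  proof -
    have "e = {}" if "e \<subseteq> A" "e \<subseteq> B" for e using that assms(4) by blast
    then have "card e \<noteq> 3" if "e \<subseteq> A" "e \<subseteq> B" for e using that by (metis card.empty zero_neq_numeral)
    then show ?thesis by blast
  qed
  have T: "card (?T X) = card X choose 3" if "finite X" for X :: "'a set"
    using n_subsets[OF that, of 3] .
  have "?T V = bip_edges V A B \<union> (?T A \<union> ?T B)"
    using assms(2,3) unfolding bip_edges_def by auto
  then have "card (?T V) = card (bip_edges V A B) + card (?T A \<union> ?T B)"
    using fin by (subst card_Un_disjoint[symmetric]) (auto simp: bip_edges_def)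
  also have "card (?T A \<union> ?T B) = card (?T A) + card (?T B)"
    using fin disj by (intro card_Un_disjoint) auto
  finally show ?thesis using T finAB assms(1) by simp
qed

text \<open>The join of a complete 3-graph on \<open>V - (A \<union> B)\<close> with the bipartite 3-graph on \<open>A, B\<close> consists of all
  triples contained in neither \<open>A\<close> nor \<open>B\<close>.\<close>

definition extremal_structure :: "'a set \<Rightarrow> 'a set set \<Rightarrow> nat \<Rightarrow> bool" where
  "extremal_structure V E t \<longleftrightarrow> (\<exists>A B. A \<subseteq> V \<and> B \<subseteq> V \<and> A \<inter> B = {} \<and> card A = (card V - t) div 2 \<and>
     card B = (card V - t) - (card V - t) div 2 \<and> E = bip_edges V A B)"

definition induced :: "'a set set \<Rightarrow> 'a set \<Rightarrow> 'a set set" where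
  "induced E W = {e\<in>E. e \<subseteq> W}"

lemma fano_free_mono: "fano_free E \<Longrightarrow> E' \<subseteq> E \<Longrightarrow> fano_free E'"
  unfolding fano_free_def by blast

lemma induced_sub: "induced E W \<subseteq> E" unfolding induced_def by auto

section \<open>Degrees, dense subsets and the exact Turan bound\<close>

context three_graph
begin

lemma three_graph_induced: "W \<subseteq> V \<Longrightarrow> three_graph W (induced E W)"
  unfolding induced_def using finV edge_card by unfold_locales (auto intro: finite_subset)

lemma card_link: "card (link E v) = 2 * card {e\<in>E. v \<in> e}"
proof -
  let ?F = "\<lambda>e. {p. {v, fst p, snd p} = e}"
  have fib: "card (?F e) = 2" if "e \<in> {e\<in>E. v \<in> e}" for e
  proof -
    have "card (e - {v}) = 2" using that edge_card[of e] by simp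
    then obtain y z where yz: "e - {v} = {y, z}" "y \<noteq> z" by (auto simp: card_2_iff)
    then have "e = {v, y, z}" "y \<noteq> v" "z \<noteq> v" using that by auto
    then have "?F e = {(y, z), (z, y)}" using yz(2) by (auto simp: set_eq_iff)
    then show ?thesis using yz(2) by simp
  qed
  have "link E v = (\<Union>e\<in>{e\<in>E. v \<in> e}. ?F e)" unfolding link_def by auto
  also have "card \<dots> = (\<Sum>e\<in>{e\<in>E. v \<in> e}. card (?F e))"
  proof (rule card_UN_disjoint)
    show "\<forall>e\<in>{e\<in>E. v \<in> e}. finite (?F e)"
    proof
      fix e assume "e \<in> {e\<in>E. v \<in> e}"
      then show "finite (?F e)" using fib by (intro card_ge_0_finite) simp
    qed
  qed (use finE in auto)
  also have "\<dots> = 2 * card {e\<in>E. v \<in> e}" using fib by simp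
  finally show ?thesis .
qed

lemma card_remove_vertex:
  "card E = card (induced E (V - {v})) + card {e\<in>E. v \<in> e}"
proof -
  have "E = induced E (V - {v}) \<union> {e\<in>E. v \<in> e}" unfolding induced_def using edge_sub by auto
  moreover have "induced E (V - {v}) \<inter> {e\<in>E. v \<in> e} = {}" unfolding induced_def by auto
  moreover have "finite (induced E (V - {v}))" "finite {e\<in>E. v \<in> e}"
    using finE finite_subset[OF induced_sub] by auto
  ultimately show ?thesis using card_Un_disjoint by metis
qed

lemma card_edges_le: "card E \<le> card V choose 3"
proof -
  have "E \<subseteq> {e. e \<subseteq> V \<and> card e = 3}" using edge_sub edge_card by auto
  then have "card E \<le> card {e. e \<subseteq> V \<and> card e = 3}" using finV by (intro card_mono) auto
  then show ?thesis using n_subsets[OF finV, of 3] by simp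
qed

lemma card_edges_le_cube: "real (card E) \<le> (real (card V))^3"
proof -
  have "card V choose 3 \<le> card V ^ 3"
    using binomial_le_pow[of 3 "card V"] binomial_eq_0[of "card V" 3] by linarith
  then have "card E \<le> card V ^ 3" using card_edges_le by (rule order_trans[rotated])
  then show ?thesis by (metis of_nat_le_iff of_nat_power)
qed

text \<open>Deleting \<open>u\<close> from a maximiser cannot increase \<open>\<phi>\<close>, so
  \<open>u\<close> lies in at least about 3 (1/8 - \<epsilon>/12) w^2 edges, that is, its link has
  about (3/4 - \<epsilon>/2) w^2 ordered pairs. The other half of \<epsilon> absorbs the linear term
  once w \<ge> 3 / (2 \<epsilon>). The set \<open>F\<close> is protected from deletion: it is empty
  for the Turan theorem and holds the special vertex in \<open>no_large_link\<close>.\<close>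

lemma max_dense_subset:
  fixes \<epsilon> :: real
  assumes "F \<subseteq> V" and eps: "0 < \<epsilon>" "\<epsilon> \<le> 1"
  defines "\<phi> W \<equiv> real (card (induced E W)) - (1/8 - \<epsilon>/12) * (real (card W))^3"
  obtains W where "F \<subseteq> W" "W \<subseteq> V" "\<phi> V \<le> \<phi> W"
    "\<And>u. u \<in> W - F \<Longrightarrow> real (card W) \<ge> 3 / (2 * \<epsilon>) \<Longrightarrow>
       real (card (link (induced E W) u)) \<ge> (3/4 - \<epsilon>) * (real (card W))^2"
proof -
  define S where "S = {W. F \<subseteq> W \<and> W \<subseteq> V}"
  have "finite S" "S \<noteq> {}" unfolding S_def using finV assms(1) by auto
  then have "\<exists>W\<in>S. \<forall>W'\<in>S. \<phi> W' \<le> \<phi> W" by (rule finite_maximizer[of S \<phi>]) blast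
  then obtain W where W: "F \<subseteq> W" "W \<subseteq> V"
    and max: "\<And>W'. F \<subseteq> W' \<Longrightarrow> W' \<subseteq> V \<Longrightarrow> \<phi> W' \<le> \<phi> W"
    unfolding S_def by blast
  interpret W: three_graph W "induced E W" using three_graph_induced[OF W(2)] .
  have "real (card (link (induced E W) u)) \<ge> (3/4 - \<epsilon>) * (real (card W))^2"
    if u: "u \<in> W - F" and big: "real (card W) \<ge> 3 / (2 * \<epsilon>)" for u
  proof -
    define w where "w = real (card W)"
    have "induced (induced E W) (W - {u}) = induced E (W - {u})" unfolding induced_def by auto
    then have "card (induced E W) = card (induced E (W - {u})) + card {e\<in>induced E W. u \<in> e}"
      using W.card_remove_vertex[of u] by simp
    moreover have "\<phi> (W - {u}) \<le> \<phi> W" using max[of "W - {u}"] u W by blast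
    moreover have "real (card (W - {u})) = w - 1"
    proof -
      have "card W > 0" using u W.finV card_gt_0_iff by blast
      then show ?thesis unfolding w_def using u by (simp add: of_nat_diff)
    qed
    ultimately have "(1/8 - \<epsilon>/12) * w^3 - (1/8 - \<epsilon>/12) * (w - 1)^3 \<le> real (card {e\<in>induced E W. u \<in> e})"
      unfolding \<phi>_def w_def by simp
    moreover have "(1/8 - \<epsilon>/12) * w^3 - (1/8 - \<epsilon>/12) * (w - 1)^3 = (1/8 - \<epsilon>/12) * (3 * w^2 - 3 * w + 1)"
      by (simp add: power2_eq_square power3_eq_cube algebra_simps)
    moreover have "(1/8 - \<epsilon>/12) * (3 * w^2 - 3 * w) \<le> (1/8 - \<epsilon>/12) * (3 * w^2 - 3 * w + 1)"
      using eps by (intro mult_left_mono) auto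
    moreover have "6 * (1/8 - \<epsilon>/12) * (w^2 - w) = 2 * ((1/8 - \<epsilon>/12) * (3 * w^2 - 3 * w))"
      by (simp add: field_simps)
    ultimately have "6 * (1/8 - \<epsilon>/12) * (w^2 - w) \<le> 2 * real (card {e\<in>induced E W. u \<in> e})" by linarith
    moreover have "(3/4 - \<epsilon>) * w^2 \<le> 6 * (1/8 - \<epsilon>/12) * (w^2 - w)"
    proof -
      have "3 \<le> 2 * \<epsilon> * w" using big eps unfolding w_def by (simp add: field_simps)
      then have "3 * w \<le> 2 * \<epsilon> * w * w" unfolding w_def by (intro mult_right_mono) auto
      moreover have "0 \<le> \<epsilon> * w" using eps unfolding w_def by simp
      ultimately show ?thesis by (simp add: power2_eq_square field_simps)
    qed
    ultimately show ?thesis using W.card_link[of u] unfolding w_def by simp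
  qed
  then show ?thesis using that[OF W max[OF assms(1)]] by blast
qed

lemma bip_size_bound:
  assumes "A \<subseteq> V" "\<And>e. e \<in> E \<Longrightarrow> \<not> e \<subseteq> A \<and> \<not> e \<subseteq> V - A" "card V \<ge> 3"
  shows "real (card E) \<le> bip_size (card V)"
    and "real (card E) \<ge> bip_size (card V) \<Longrightarrow> extremal_structure V E 0"
proof -
  have disj: "A \<inter> (V - A) = {}" and sub: "V - A \<subseteq> V" by auto
  have sz: "card A + card (V - A) = card V"
    using assms(1) finV by (metis card_Diff_subset card_mono finite_subset le_add_diff_inverse)
  have EB: "E \<subseteq> bip_edges V A (V - A)" unfolding bip_edges_def using assms(2) edge_sub edge_card by auto
  then have le: "card E \<le> card (bip_edges V A (V - A))" using finite_bip_edges[OF finV] card_mono by blast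
  note cb = card_bip_edges[OF finV assms(1) sub disj]
  have "card E + bip_missing (card V) \<le> card V choose 3"
    using bip_missing_le(1)[OF sz assms(3)] cb le by linarith
  then show "real (card E) \<le> bip_size (card V)" unfolding bip_size_def by linarith
  assume "real (card E) \<ge> bip_size (card V)"
  then have "card E + bip_missing (card V) \<ge> card V choose 3" unfolding bip_size_def by linarith
  then have eq: "card E = card (bip_edges V A (V - A))" "bip_missing (card V) = (card A choose 3) + (card (V - A) choose 3)"
    using bip_missing_le(1)[OF sz assms(3)] cb le by linarith+
  have E: "E = bip_edges V A (V - A)" using card_subset_eq[OF finite_bip_edges[OF finV] EB eq(1)] .
  then have E': "E = bip_edges V (V - A) A" unfolding bip_edges_def by auto
  from bip_missing_le(2)[OF sz assms(3) eq(2)] show "extremal_structure V E 0"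
  proof
    assume "card A = card V div 2"
    then show ?thesis unfolding extremal_structure_def using E assms(1) sz
      by (intro exI[of _ A] exI[of _ "V - A"]) auto
  next
    assume "card (V - A) = card V div 2"
    then show ?thesis unfolding extremal_structure_def using E' assms(1) sz
      by (intro exI[of _ "V - A"] exI[of _ A]) auto
  qed
qed

text \<open>The maximiser \<open>W\<close> is two-colourable, so it has at most
  \<open>bip_size (card W)\<close> edges. The function \<open>g\<close>, which is
  \<open>\<phi>\<close> with the edge number replaced by \<open>bip_size\<close>, strictly increases
  from \<open>card W\<close> on. A proper subset could therefore not reach the value at
  \<open>V\<close>, so \<open>V\<close> itself is two-colourable.\<close>

theorem turan_fano:
  assumes ff: "fano_free E" and n: "real (card V) \<ge> 10^60" and E: "real (card E) \<ge> bip_size (card V)"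
  shows "extremal_structure V E 0"
proof -
  define \<epsilon> :: real where "\<epsilon> = 1 / 10^29"
  define g where "g k = bip_size k - (1/8 - \<epsilon>/12) * (real k)^3" for k
  define n where "n = real (card V)"
  obtain W where W: "{} \<subseteq> W" "W \<subseteq> V"
    and \<phi>: "real (card (induced E V)) - (1/8 - \<epsilon>/12) * (real (card V))^3
      \<le> real (card (induced E W)) - (1/8 - \<epsilon>/12) * (real (card W))^3"
    and deg: "\<And>u. u \<in> W - {} \<Longrightarrow> real (card W) \<ge> 3 / (2 * \<epsilon>) \<Longrightarrow>
       real (card (link (induced E W) u)) \<ge> (3/4 - \<epsilon>) * (real (card W))^2"
    by (rule max_dense_subset[of "{}" \<epsilon>]) (auto simp: \<epsilon>_def)
  interpret W: three_graph W "induced E W" using three_graph_induced[OF W(2)] .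
  have "induced E V = E" unfolding induced_def using edge_sub by auto
  then have \<phi>V: "g (card V) \<le> real (card (induced E W)) - (1/8 - \<epsilon>/12) * (real (card W))^3"
    using \<phi> E unfolding g_def by simp
  \<comment> \<open>A small \<open>W\<close> has \<open>\<phi>\<close> at most 10^96 by the trivial
    edge bound, while the value at \<open>V\<close> is about \<epsilon>/12 n^3.\<close>
  have large: "real (card W) \<ge> 10^32"
  proof (rule ccontr)
    assume "\<not> ?thesis"
    then have "(real (card W))^3 \<le> (10^32)^3" by (intro power_mono) auto
    moreover have "(1/8 - \<epsilon>/12) * (real (card W))^3 \<ge> 0" unfolding \<epsilon>_def by simp
    moreover have "(10^32)^3 = (10^96 :: real)" by simp
    ultimately have "g (card V) \<le> 10^96" using \<phi>V W.card_edges_le_cube by linarith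
    moreover have "card V \<ge> 2" using n by simp
    then have "n^3 / 8 - n^2 / 4 - n / 8 - (1/8 - \<epsilon>/12) * n^3 \<le> g (card V)"
      unfolding g_def n_def using bip_size_lower[of "card V"] by simp
    moreover have "\<epsilon>/12 * n^3 \<ge> 3 * n^2"
    proof -
      have "3 \<le> \<epsilon>/12 * n" using n unfolding n_def \<epsilon>_def by simp
      then have "3 * n^2 \<le> \<epsilon>/12 * n * n^2" by (intro mult_right_mono) auto
      then show ?thesis by (simp add: power3_eq_cube power2_eq_square)
    qed
    moreover have "n^2 \<ge> 10^60 * n" using n unfolding power2_eq_square n_def by (intro mult_right_mono) auto
    moreover have "n^2 \<ge> (10^60)^2" using n unfolding n_def by (intro power_mono) auto
    ultimately show False using n unfolding n_def by (simp add: algebra_simps)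
  qed
  interpret D: dense_fano_free W "induced E W" \<epsilon> "real (card W)"
  proof
    show "fano_free (induced E W)" using fano_free_mono[OF ff induced_sub] .
    show "0 < \<epsilon>" "\<epsilon> \<le> 1 / 10^29" unfolding \<epsilon>_def by auto
    fix v assume "v \<in> W"
    moreover have "3 / (2 * \<epsilon>) \<le> real (card W)"
      unfolding \<epsilon>_def by (rule order_trans[OF _ large]) simp
    ultimately show "(3/4 - \<epsilon>) * (real (card W))^2 \<le> real (card (link (induced E W) v))"
      using deg by simp
  qed (use large in auto)
  obtain A where A: "A \<subseteq> W" "\<And>e. e \<in> induced E W \<Longrightarrow> \<not> e \<subseteq> A \<and> \<not> e \<subseteq> W - A"
    using D.two_colourable by auto
  have cW: "card W \<ge> 3" using large by simp
  have gW: "g (card V) \<le> g (card W)"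
    using \<phi>V W.bip_size_bound(1)[OF A cW] unfolding g_def by linarith
  \<comment> \<open>One more vertex adds about 3/8 k^2 edges but only (3/8 - \<epsilon>/4) k^2 to
    the subtracted term.\<close>
  have inc: "g k < g (Suc k)" if "k \<ge> card W" for k
  proof -
    have k: "real k \<ge> 10^32" using large that by linarith
    have "g (Suc k) - g k \<ge> 3/8 * (real k)^2 - real k / 2 - (1/8 - \<epsilon>/12) * (3 * (real k)^2 + 3 * real k + 1)"
      using bip_size_Suc[of k] unfolding g_def
      by (simp add: power2_eq_square power3_eq_cube algebra_simps)
    moreover have "(1/8 - \<epsilon>/12) * (3 * (real k)^2 + 3 * real k + 1)
        \<le> 3/8 * (real k)^2 - \<epsilon>/4 * (real k)^2 + 3 * real k + 1"
      unfolding \<epsilon>_def by (simp add: algebra_simps)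
    moreover have "\<epsilon>/4 * (real k)^2 \<ge> 10 * real k"
    proof -
      have "10 \<le> \<epsilon>/4 * real k" using k unfolding \<epsilon>_def by simp
      then have "10 * real k \<le> \<epsilon>/4 * real k * real k" by (intro mult_right_mono) auto
      then show ?thesis by (simp add: power2_eq_square)
    qed
    moreover have "real k \<ge> 1" using k by simp
    ultimately show ?thesis by linarith
  qed
  have "card W = card V"
  proof (rule ccontr)
    assume "card W \<noteq> card V"
    then have "card W < card V" using card_mono[OF finV W(2)] by simp
    then have "Suc (card W) \<le> card V" by simp
    then have "g (card W) < g (card V)"
    proof (induction rule: dec_induct)
      case base
      then show ?case using inc[of "card W"] by simp
    next
      case (step k)
      then show ?case using inc[of k] by simp
    qed
    then show False using gW by simp
  qed
  then have WV: "W = V" using card_subset_eq[OF finV W(2)] by simp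
  show ?thesis
    using bip_size_bound(2)[of A] A cW E \<open>induced E V = E\<close> unfolding WV by simp
qed

text \<open>The link of \<open>u\<close> avoids the whole of \<open>A \<times> A\<close>, so a
  vertex of large degree has a small colour class.\<close>

lemma part_size:
  assumes "A \<subseteq> V" "u \<in> A" "\<And>e. e \<in> E \<Longrightarrow> \<not> e \<subseteq> A"
    and "real (card (link E u)) \<ge> \<kappa> * (real (card V))^2"
  shows "(real (card A))^2 \<le> (1 - \<kappa>) * (real (card V))^2"
proof -
  have "link E u \<subseteq> V \<times> V - A \<times> A" using link_sub assms(2,3) by fastforce
  then have "card (link E u) \<le> card (V \<times> V - A \<times> A)" using finV by (intro card_mono) auto
  moreover have "V \<times> V \<inter> A \<times> A = A \<times> A" using assms(1) by auto
  then have "card (V \<times> V) = card (A \<times> A) + card (V \<times> V - A \<times> A)"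
    using card_Int_Diff[of "V \<times> V" "A \<times> A"] finV by simp
  then have "real (card V)^2 = real (card (V \<times> V - A \<times> A)) + real (card A)^2"
    unfolding card_cartesian_product by (metis add.commute of_nat_add of_nat_mult power2_eq_square)
  ultimately have "real (card (link E u)) + real (card A)^2 \<le> real (card V)^2" by linarith
  then show ?thesis using assms(4) by (simp add: algebra_simps)
qed

text \<open>A dense subset \<open>W\<close> that keeps \<open>v\<close> is two-colourable. The class
  of \<open>v\<close> has size at most the square root of 1/4 - 1/200, below 499/1000 of w, because
  of the large link; the other class stays below 501/1000 of w by the minimum degree. Together they
  would not cover \<open>W\<close>.\<close>

lemma no_large_link:
  assumes ff: "fano_free E" and v: "v \<in> V" and m: "real (card V) \<ge> 10^100"
    and link: "real (card (link E v)) \<ge> (3/4 + 1/100) * (real (card V))^2"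
    and E: "real (card E) \<ge> (1/8 - 1/10^60) * (real (card V))^3"
  shows False
proof -
  define \<epsilon> :: real where "\<epsilon> = 1 / 10^29"
  define m where "m = real (card V)"
  have m0: "m \<ge> 10^100" using m unfolding m_def .
  obtain W where W: "{v} \<subseteq> W" "W \<subseteq> V"
    and \<phi>: "real (card (induced E V)) - (1/8 - \<epsilon>/12) * (real (card V))^3
      \<le> real (card (induced E W)) - (1/8 - \<epsilon>/12) * (real (card W))^3"
    and deg: "\<And>u. u \<in> W - {v} \<Longrightarrow> real (card W) \<ge> 3 / (2 * \<epsilon>) \<Longrightarrow>
       real (card (link (induced E W) u)) \<ge> (3/4 - \<epsilon>) * (real (card W))^2"
    by (rule max_dense_subset[of "{v}" \<epsilon>]) (use v in \<open>auto simp: \<epsilon>_def\<close>)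
  interpret W: three_graph W "induced E W" using three_graph_induced[OF W(2)] .
  have ffW: "fano_free (induced E W)" using fano_free_mono[OF ff induced_sub] .
  define w where "w = real (card W)"
  have wm: "w \<le> m" unfolding w_def m_def using card_mono[OF finV W(2)] by simp
  have "induced E V = E" unfolding induced_def using edge_sub by auto
  then have \<phi>V: "(\<epsilon>/12 - 1/10^60) * m^3 \<le> real (card (induced E W)) - (1/8 - \<epsilon>/12) * w^3"
    using \<phi> E unfolding m_def w_def by (simp add: algebra_simps)
  have large: "w \<ge> 10^60"
  proof (rule ccontr)
    assume "\<not> ?thesis"
    then have "w \<le> 1/10^20 * m" using m0 by simp
    then have "w^3 \<le> (1/10^20 * m)^3" unfolding w_def by (intro power_mono) auto
    also have "\<dots> = 1/10^60 * m^3" by (simp add: power3_eq_cube)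
    finally have "w^3 \<le> 1/10^60 * m^3" .
    moreover have "(1/8 - \<epsilon>/12) * w^3 \<ge> 0" unfolding \<epsilon>_def w_def by simp
    moreover have "real (card (induced E W)) \<le> w^3" using W.card_edges_le_cube unfolding w_def .
    ultimately have "(\<epsilon>/12 - 1/10^60) * m^3 \<le> 1/10^60 * m^3" using \<phi>V by linarith
    moreover have "m^3 > 0" using m0 by simp
    ultimately have "\<epsilon>/12 - 1/10^60 \<le> 1/10^60" using mult_right_le_imp_le by blast
    then show False unfolding \<epsilon>_def by simp
  qed
  \<comment> \<open>This cap gives \<open>W\<close> a value of at most \<epsilon>/12 w^3, against at
    least (\<epsilon>/12 - 1/10^60) m^3 for \<open>V\<close>, and so forces w to be close to
    m.\<close>
  have "real (card (induced E W)) \<le> bip_size (card W)"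
  proof (rule ccontr)
    assume c: "\<not> ?thesis"
    then have "extremal_structure W (induced E W) 0"
      using W.turan_fano[OF ffW] large unfolding w_def by simp
    then obtain A B where AB: "A \<subseteq> W" "B \<subseteq> W" "A \<inter> B = {}" "card A = card W div 2" "card B = card W - card W div 2"
      "induced E W = bip_edges W A B" unfolding extremal_structure_def by auto
    have "card (induced E W) + bip_missing (card W) = card W choose 3"
      using card_bip_edges[OF W.finV AB(1-3)] AB(4-6) unfolding bip_missing_def by simp
    then have "real (card (induced E W)) = bip_size (card W)" unfolding bip_size_def by linarith
    then show False using c by simp
  qed
  moreover have cW: "card W \<ge> 2" using large unfolding w_def by simp
  ultimately have "real (card (induced E W)) \<le> w^3 / 8" using bip_size_upper[of "card W"] unfolding w_def by linarith
  then have "(\<epsilon>/12 - 1/10^60) * m^3 \<le> \<epsilon>/12 * w^3" using \<phi>V by (simp add: algebra_simps)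
  then have w3: "(1 - 1/10^29) * m^3 \<le> w^3" 
  proof -
    have "\<epsilon>/12 * ((1 - 1/10^29) * m^3) \<le> (\<epsilon>/12 - 1/10^60) * m^3"
      using m0 unfolding \<epsilon>_def mult.assoc[symmetric] by (intro mult_right_mono) auto
    then have "\<epsilon>/12 * ((1 - 1/10^29) * m^3) \<le> \<epsilon>/12 * w^3"
      using \<open>(\<epsilon>/12 - 1/10^60) * m^3 \<le> \<epsilon>/12 * w^3\<close> by linarith
    then show ?thesis unfolding \<epsilon>_def by simp
  qed
  have wge: "w \<ge> (1 - 1/1000) * m"
  proof (rule ccontr)
    assume "\<not> ?thesis"
    then have "w^3 \<le> ((1 - 1/1000) * m)^3" unfolding w_def by (intro power_mono) auto
    also have "\<dots> = (1 - 1/1000)^3 * m^3" by (rule power_mult_distrib)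
    also have "\<dots> < (1 - 1/10^29) * m^3" using m0 by (intro mult_strict_right_mono) (auto simp: power3_eq_cube)
    finally show False using w3 by simp
  qed
  \<comment> \<open>At most 2 (m - w) m \<le> m^2 / 500 ordered pairs meet \<open>V - W\<close>,
    which still leaves an excess of 1/200.\<close>
  have linkv: "real (card (link (induced E W) v)) \<ge> (3/4 + 1/200) * w^2"
  proof -
    have finW: "finite W" using W.finV .
    have "link E v \<subseteq> link (induced E W) v \<union> ((V - W) \<times> V \<union> V \<times> (V - W))"
      using link_sub W(1) unfolding induced_def by auto
    then have "card (link E v) \<le> card (link (induced E W) v \<union> ((V - W) \<times> V \<union> V \<times> (V - W)))"
      using W.fin_link finV by (intro card_mono) auto
    also have "\<dots> \<le> card (link (induced E W) v) + (card ((V - W) \<times> V) + card (V \<times> (V - W)))"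
      by (intro order_trans[OF card_Un_le] add_mono order_refl card_Un_le)
    also have "\<dots> = card (link (induced E W) v) + 2 * (card (V - W) * card V)" by (simp add: card_cartesian_product)
    finally have "real (card (link E v)) \<le> real (card (link (induced E W) v) + 2 * (card (V - W) * card V))"
      by (rule of_nat_mono)
    also have "\<dots> = real (card (link (induced E W) v)) + 2 * (m - w) * m"
      using card_Diff_subset[OF finW W(2)] card_mono[OF finV W(2)] unfolding m_def w_def by (simp add: of_nat_diff)
    also have "2 * (m - w) * m \<le> 2 * (1/1000 * m) * m" using wge m0 by (intro mult_right_mono) auto
    finally have "real (card (link (induced E W) v)) \<ge> (3/4 + 1/100) * m^2 - 1/500 * m^2"
      using link unfolding m_def by (simp add: power2_eq_square)
    moreover have "w^2 \<le> m^2" using wm unfolding w_def by (intro power_mono) auto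
    ultimately show ?thesis by (simp add: algebra_simps)
  qed
  have w2: "w^2 > 0" using large by simp
  interpret D: dense_fano_free W "induced E W" \<epsilon> w
  proof
    show "fano_free (induced E W)" by (rule ffW)
    show "0 < \<epsilon>" "\<epsilon> \<le> 1 / 10^29" unfolding \<epsilon>_def by auto
    show "w = real (card W)" by (rule w_def)
    show "10^32 \<le> w" by (rule order_trans[OF _ large]) simp
    fix u assume u: "u \<in> W"
    show "(3/4 - \<epsilon>) * w^2 \<le> real (card (link (induced E W) u))"
    proof (cases "u = v")
      case True
      have "(3/4 - \<epsilon>) * w^2 \<le> (3/4 + 1/200) * w^2" unfolding \<epsilon>_def by (intro mult_right_mono) auto
      then show ?thesis using linkv True by simp
    next
      case False
      moreover have "3 / (2 * \<epsilon>) \<le> real (card W)"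
        unfolding \<epsilon>_def by (rule order_trans[OF _ large[unfolded w_def]]) simp
      ultimately show ?thesis using deg u unfolding w_def by simp
    qed
  qed
  obtain A where "A \<subseteq> W" "\<And>e. e \<in> induced E W \<Longrightarrow> \<not> e \<subseteq> A \<and> \<not> e \<subseteq> W - A"
    using D.two_colourable by auto
  moreover have "W - (W - A) = A" if "A \<subseteq> W" for A using that by auto
  ultimately obtain A where A: "A \<subseteq> W" "v \<in> A" "\<And>e. e \<in> induced E W \<Longrightarrow> \<not> e \<subseteq> A \<and> \<not> e \<subseteq> W - A"
    using W(1) that by (cases "v \<in> A") (metis Diff_iff Diff_subset insert_subset)+
  have "(real (card A))^2 \<le> (1 - (3/4 + 1/200)) * w^2"
    using W.part_size[OF A(1,2), of "3/4 + 1/200"] A(3) linkv unfolding w_def by blast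
  also have "\<dots> < (499/1000 * w)^2" using w2 by (simp add: power_mult_distrib power2_eq_square)
  finally have a: "real (card A) < 499/1000 * w" by (rule power2_less_imp_less) (use large in simp)
  have ab: "real (card A) + real (card (W - A)) = w"
    using A(1) W.finV card_mono[OF W.finV A(1)] unfolding w_def
    by (simp add: card_Diff_subset[OF finite_subset[OF A(1) W.finV] A(1)] of_nat_diff)
  then have "card (W - A) \<noteq> 0" using a large by auto
  then obtain u where u: "u \<in> W - A" by (metis all_not_in_conv card.empty)
  have "(real (card (W - A)))^2 \<le> (1 - (3/4 - \<epsilon>)) * w^2"
    using W.part_size[of "W - A" u "3/4 - \<epsilon>"] u A(3) D.deg[of u] unfolding w_def by blast
  also have "\<dots> < (501/1000 * w)^2" unfolding \<epsilon>_def power_mult_distrib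
    using w2 by (intro mult_strict_right_mono) (auto simp: power2_eq_square)
  finally have "real (card (W - A)) < 501/1000 * w" by (rule power2_less_imp_less) (use large in simp)
  then show False using a ab by linarith
qed

end

section \<open>Packings of Fano planes\<close>

lemma bip_missing_add: "bip_missing (m + j) \<ge> bip_missing m + j * (m div 2 choose 2)"
proof (induction j)
  case (Suc j)
  have "m div 2 choose 2 \<le> ((m + j) div 2 choose 2)" by (rule binomial_right_mono) (simp add: div_le_mono)
  then show ?case using Suc bip_missing_Suc[of "m + j"] by simp
qed simp

lemma bip_size_add:
  "bip_size (m + j) \<ge> bip_size m + real j * (3/8 * (real m)^2 - real (m + j) / 2)"
proof (induction j)
  case (Suc j)
  have "(real m)^2 \<le> (real (m + j))^2" by (intro power_mono) auto
  then have "bip_size (Suc (m + j)) \<ge> bip_size (m + j) + (3/8 * (real m)^2 - real (m + j) / 2)"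
    using bip_size_Suc[of "m + j"] by linarith
  moreover have "real j * (3/8 * (real m)^2 - real (m + Suc j) / 2) \<le> real j * (3/8 * (real m)^2 - real (m + j) / 2)"
    by (intro mult_left_mono) auto
  moreover have "real (Suc j) * (3/8 * (real m)^2 - real (m + Suc j) / 2)
      = real j * (3/8 * (real m)^2 - real (m + Suc j) / 2) + (3/8 * (real m)^2 - real (m + Suc j) / 2)"
    by (simp add: distrib_right)
  moreover have "real (m + j) \<le> real (m + Suc j)" "m + Suc j = Suc (m + j)" by simp_all
  ultimately show ?case using Suc by (smt (verit, best) divide_right_mono)
qed simp

lemma extremal_structure_card:
  assumes "finite V" "extremal_structure V E t"
  shows "card E + bip_missing (card V - t) = card V choose 3"
proof -
  obtain A B where "A \<subseteq> V" "B \<subseteq> V" "A \<inter> B = {}" "card A = (card V - t) div 2"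
    "card B = (card V - t) - (card V - t) div 2" "E = bip_edges V A B"
    using assms(2) unfolding extremal_structure_def by auto
  then show ?thesis using card_bip_edges[OF assms(1), of A B] unfolding bip_missing_def by simp
qed

lemma rgraph_3_iff: "rgraph 3 (V, E) \<longleftrightarrow> three_graph V E"
  unfolding rgraph_def three_graph_def by auto

lemma contains_disjoint_copies_mono:
  assumes "contains_disjoint_copies k F (W, E')" "W \<subseteq> V" "E' \<subseteq> E"
  shows "contains_disjoint_copies k F (V, E)"
  using assms unfolding contains_disjoint_copies_def subhypergraph_def by (metis fst_conv order_trans snd_conv)

lemma contains_disjoint_copies_0: "contains_disjoint_copies 0 F G"
  unfolding contains_disjoint_copies_def disjoint_family_on_def by simp

lemma hverts_Fano: "hverts Fano = {1, 2, 3, 4, 5, 6, 7}"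
  unfolding Fano_def by auto

lemma hyper_iso_Fano:
  assumes "distinct [a, b, c, p, q, r, s]"
  shows "hyper_iso Fano ({a, b, c, p, q, r, s},
    {{a, b, c}, {a, p, q}, {a, r, s}, {b, p, r}, {b, q, s}, {c, p, s}, {c, q, r}})"
proof -
  define f :: "nat \<Rightarrow> 'a" where "f x = (if x = 1 then a else if x = 2 then b else if x = 3 then c
    else if x = 5 then p else if x = 6 then q else if x = 7 then r else s)" for x
  have f: "f 1 = a" "f 2 = b" "f 3 = c" "f 5 = p" "f 6 = q" "f 7 = r" "f 4 = s" unfolding f_def by auto
  have "bij_betw f {1, 2, 3, 4, 5, 6, 7} {a, b, c, p, q, r, s}"
    unfolding bij_betw_def inj_on_def using assms f by auto
  moreover have "(\<lambda>e. f ` e) ` hedges Fano = {{a, b, c}, {a, p, q}, {a, r, s}, {b, p, r}, {b, q, s}, {c, p, s}, {c, q, r}}"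
    unfolding Fano_def snd_conv image_insert image_empty f by (simp only: insert_commute)
  ultimately show ?thesis unfolding hyper_iso_def hverts_Fano by auto
qed

lemma (in three_graph) extend_packing:
  assumes U: "contains_disjoint_copies k Fano (U, induced E U)" "U \<subseteq> V"
    and nf: "\<not> fano_free (induced E (V - U))"
  shows "contains_disjoint_copies (Suc k) Fano (V, E)"
proof -
  obtain C :: "nat \<Rightarrow> 'a hypergraph" where C: "\<And>i. i < k \<Longrightarrow> subhypergraph (C i) (U, induced E U)"
    "\<And>i. i < k \<Longrightarrow> hyper_iso Fano (C i)" "disjoint_family_on (\<lambda>i. hverts (C i)) {..<k}"
    using U(1) unfolding contains_disjoint_copies_def by auto
  obtain a b c p q r s where L: "{{a, b, c}, {a, p, q}, {a, r, s}, {b, p, r}, {b, q, s}, {c, p, s}, {c, q, r}}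
      \<subseteq> induced E (V - U)"
    using nf unfolding fano_free_def by auto
  then have E: "{a, b, c} \<in> E" "{a, p, q} \<in> E" "{a, r, s} \<in> E" "{b, p, r} \<in> E" "{b, q, s} \<in> E" "{c, p, s} \<in> E" "{c, q, r} \<in> E"
    unfolding induced_def by auto
  have dist: "distinct [a, b, c, p, q, r, s]"
    using E[THEN edgeD(4)] E[THEN edgeD(5)] E[THEN edgeD(6)] by simp
  have sub: "{a, b, c, p, q, r, s} \<subseteq> V - U" using L unfolding induced_def by auto
  define D where "D = ({a, b, c, p, q, r, s},
    {{a, b, c}, {a, p, q}, {a, r, s}, {b, p, r}, {b, q, s}, {c, p, s}, {c, q, r}})"
  have D: "hyper_iso Fano D" "hverts D \<subseteq> V - U" "hedges D \<subseteq> induced E (V - U)"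
    using hyper_iso_Fano[OF dist] sub L unfolding D_def by auto
  define C' where "C' i = (if i < k then C i else D)" for i
  have CU: "hverts (C i) \<subseteq> U" "hedges (C i) \<subseteq> induced E U" if "i < k" for i
    using C(1)[OF that] unfolding subhypergraph_def by auto
  have "subhypergraph (C' i) (V, E)" if "i < Suc k" for i
    using CU[of i] D U(2) induced_sub[of E U] induced_sub[of E "V - U"]
    unfolding C'_def subhypergraph_def by (cases "i < k") auto
  moreover have "hyper_iso Fano (C' i)" if "i < Suc k" for i
    using C(2) D(1) unfolding C'_def by auto
  moreover have "disjoint_family_on (\<lambda>i. hverts (C' i)) {..<Suc k}"
    unfolding disjoint_family_on_def
  proof (intro ballI impI)
    fix i j assume ij: "i \<in> {..<Suc k}" "j \<in> {..<Suc k}" "i \<noteq> j"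
    consider "i < k" "j < k" | "i = k" "j < k" | "i < k" "j = k" using ij by force
    then show "hverts (C' i) \<inter> hverts (C' j) = {}"
    proof cases
      case 1
      then show ?thesis using C(3) ij(3) unfolding C'_def disjoint_family_on_def by auto
    next
      case 2
      then show ?thesis using CU(1)[of j] D(2) unfolding C'_def by auto
    next
      case 3
      then show ?thesis using CU(1)[of i] D(2) unfolding C'_def by auto
    qed
  qed
  ultimately show ?thesis unfolding contains_disjoint_copies_def by blast
qed

text \<open>Recording a packing by the vertices it covers lets it be carried between
  \<open>E\<close> and an induced subgraph and leaves the remaining vertices free for
  \<open>extend_packing\<close>.\<close>

lemma (in three_graph) packing_support:
  assumes "contains_disjoint_copies k Fano (V, E)"
  obtains U where "U \<subseteq> V" "card U = 7 * k" "contains_disjoint_copies k Fano (U, induced E U)"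
proof -
  obtain C :: "nat \<Rightarrow> 'a hypergraph" where C: "\<And>i. i < k \<Longrightarrow> subhypergraph (C i) (V, E)"
    "\<And>i. i < k \<Longrightarrow> hyper_iso Fano (C i)" "disjoint_family_on (\<lambda>i. hverts (C i)) {..<k}"
    using assms unfolding contains_disjoint_copies_def by auto
  define U where "U = (\<Union>i\<in>{..<k}. hverts (C i))"
  have sub: "U \<subseteq> V" unfolding U_def using C(1) unfolding subhypergraph_def by auto
  have c7: "card (hverts (C i)) = 7" if i: "i < k" for i
  proof -
    obtain f where "bij_betw f (hverts Fano) (hverts (C i))" using C(2)[OF i] unfolding hyper_iso_def by auto
    then have "card (hverts (C i)) = card (hverts Fano)" using bij_betw_same_card by metis
    then show ?thesis by (simp add: Fano_def)
  qed
  have edges: "hedges (C i) \<subseteq> induced E U" if i: "i < k" for i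
  proof
    fix e assume e: "e \<in> hedges (C i)"
    obtain f where f: "bij_betw f (hverts Fano) (hverts (C i))" "(\<lambda>e. f ` e) ` hedges Fano = hedges (C i)"
      using C(2)[OF i] unfolding hyper_iso_def by auto
    obtain e' where e': "e' \<in> hedges Fano" "e = f ` e'" using e unfolding f(2)[symmetric] by blast
    then have "e' \<subseteq> hverts Fano" unfolding Fano_def by auto
    then have "e \<subseteq> hverts (C i)" using e'(2) f(1) unfolding bij_betw_def by auto
    then show "e \<in> induced E U" using e C(1)[OF i] i unfolding induced_def U_def subhypergraph_def by auto
  qed
  have "card U = (\<Sum>i<k. card (hverts (C i)))"
    unfolding U_def
  proof (rule card_UN_disjoint)
    show "\<forall>i\<in>{..<k}. finite (hverts (C i))"
    proof
      fix i assume "i \<in> {..<k}"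
      then show "finite (hverts (C i))" using c7 by (intro card_ge_0_finite) simp
    qed
    show "\<forall>i\<in>{..<k}. \<forall>j\<in>{..<k}. i \<noteq> j \<longrightarrow> hverts (C i) \<inter> hverts (C j) = {}"
      using C(3) unfolding disjoint_family_on_def by blast
  qed simp
  then have "card U = 7 * k" using c7 by simp
  moreover have "contains_disjoint_copies k Fano (U, induced E U)"
    unfolding contains_disjoint_copies_def
    using C(2,3) edges by (intro exI[of _ C]) (auto simp: subhypergraph_def U_def)
  ultimately show ?thesis using that sub by blast
qed

context three_graph
begin

text \<open>In the complete 3-graph the degree is the difference of two binomials, obtained by
  removing \<open>v\<close>.\<close>

lemma card_vertex_edges_le:
  assumes "v \<in> V"
  shows "card {e\<in>E. v \<in> e} \<le> card V - 1 choose 2"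
proof -
  define K where "K X = {e. e \<subseteq> X \<and> card e = 3}" for X :: "'a set"
  interpret K: three_graph V "K V" using finV by unfold_locales (auto simp: K_def)
  have cK: "card (K X) = card X choose 3" if "finite X" for X
    unfolding K_def using n_subsets[OF that, of 3] .
  have "induced (K V) (V - {v}) = K (V - {v})" unfolding induced_def K_def by auto
  then have "card V choose 3 = (card (V - {v}) choose 3) + card {e\<in>K V. v \<in> e}"
    using K.card_remove_vertex[of v] cK finV by simp
  moreover have "card V > 0" using assms finV card_gt_0_iff by blast
  then have "card V = Suc (card V - 1)" by simp
  then have "card V choose 3 = (card V - 1 choose 2) + (card V - 1 choose 3)" using choose_3_Suc by metis
  moreover have "card (V - {v}) = card V - 1" using assms by simp
  ultimately have "card {e\<in>K V. v \<in> e} = card V - 1 choose 2" by simp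
  moreover have "{e\<in>E. v \<in> e} \<subseteq> {e\<in>K V. v \<in> e}" unfolding K_def using edge_sub edge_card by auto
  then have "card {e\<in>E. v \<in> e} \<le> card {e\<in>K V. v \<in> e}" using K.finE by (intro card_mono) auto
  ultimately show ?thesis by simp
qed

lemma card_remove_vertices:
  assumes "U \<subseteq> V"
  shows "card E \<le> card (induced E (V - U)) + (\<Sum>u\<in>U. card {e\<in>E. u \<in> e})"
proof -
  have finU: "finite U" using assms finV finite_subset by blast
  have "E \<subseteq> induced E (V - U) \<union> (\<Union>u\<in>U. {e\<in>E. u \<in> e})"
    unfolding induced_def using edge_sub by auto
  then have "card E \<le> card (induced E (V - U) \<union> (\<Union>u\<in>U. {e\<in>E. u \<in> e}))"
    using finE finU finite_subset[OF induced_sub finE] by (intro card_mono) auto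
  also have "\<dots> \<le> card (induced E (V - U)) + card (\<Union>u\<in>U. {e\<in>E. u \<in> e})" by (rule card_Un_le)
  also have "card (\<Union>u\<in>U. {e\<in>E. u \<in> e}) \<le> (\<Sum>u\<in>U. card {e\<in>E. u \<in> e})" by (rule card_UN_le[OF finU])
  finally show ?thesis by simp
qed

lemma card_link_induced:
  assumes "U \<subseteq> V" "v \<in> V - U"
  shows "card (link E v) \<le> card (link (induced E (V - U)) v) + 2 * (card U * card V)"
proof -
  have finU: "finite U" using assms finV finite_subset by blast
  have "link E v \<subseteq> link (induced E (V - U)) v \<union> (U \<times> V \<union> V \<times> U)"
    using assms edgeD edge_sub unfolding induced_def by auto
  moreover have "finite (link (induced E (V - U)) v)"
    using three_graph.fin_link[OF three_graph_induced] by blast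
  ultimately have "card (link E v) \<le> card (link (induced E (V - U)) v \<union> (U \<times> V \<union> V \<times> U))"
    using finV finU by (intro card_mono) auto
  also have "\<dots> \<le> card (link (induced E (V - U)) v) + (card (U \<times> V) + card (V \<times> U))"
    by (intro order_trans[OF card_Un_le] add_mono order_refl card_Un_le)
  finally show ?thesis by (simp add: card_cartesian_product mult.commute)
qed

lemma turan_fano_bound:
  assumes "fano_free E" "real (card V) \<ge> 10^60"
  shows "real (card E) \<le> bip_size (card V)"
proof (rule ccontr)
  assume c: "\<not> ?thesis"
  then have "extremal_structure V E 0" using turan_fano assms by simp
  from extremal_structure_card[OF finV this] show False using c unfolding bip_size_def by simp
qed

end

text \<open>The largeness condition is on \<open>card V - t\<close>, which does not change when the
  induction removes one vertex and lowers \<open>t\<close> by one. The edge condition is additive so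
  that no truncated subtraction occurs.\<close>

theorem packing_extremal:
  fixes V :: "'a set"
  assumes "three_graph V E" "\<not> contains_disjoint_copies (t + 1) Fano (V, E)"
    and "real (card V) - real t \<ge> 10^101" "real t \<le> 1/10^62 * real (card V)"
    and "card E + bip_missing (card V - t) \<ge> card V choose 3"
  shows "extremal_structure V E t"
  using assms
proof (induction t arbitrary: V E)
  case 0
  interpret three_graph V E by fact
  have "fano_free E"
  proof (rule ccontr)
    assume "\<not> fano_free E"
    moreover have "induced E (V - {}) = E" unfolding induced_def using edge_sub by auto
    ultimately have "contains_disjoint_copies (Suc 0) Fano (V, E)"
      using extend_packing[OF contains_disjoint_copies_0, of "{}"] by simp
    then show False using 0 by simp
  qed
  moreover have "real (card V) \<ge> 10^60" using 0(3) by simp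
  moreover have "real (card E) \<ge> bip_size (card V)" using 0(5) unfolding bip_size_def by simp
  ultimately show ?case by (rule turan_fano)
next
  case (Suc t' V E)
  interpret three_graph V E by fact
  define t where "t = Suc t'"
  define n where "n = real (card V)"
  have free: "\<not> contains_disjoint_copies (Suc t) Fano (V, E)" using Suc.prems(2) unfolding t_def by simp
  have tn: "real t \<le> 1/10^62 * n" and nt: "n - real t \<ge> 10^101"
    using Suc.prems(3,4) unfolding t_def n_def by auto
  have n_big: "n \<ge> 10^101" using nt by simp
  have n0: "n > 0" "n^2 > 0" "n^3 > 0" using n_big by auto
  have t7: "7 * real t \<le> 1/1000 * n" using tn n0 by simp
  have t_le: "t \<le> card V" using nt unfolding n_def by simp
  have Ecard: "card E + bip_missing (card V - t) \<ge> card V choose 3" using Suc.prems(5) unfolding t_def .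
  \<comment> \<open>Each of the \<open>t\<close> vertices of the complete part restores at least the
    pairs inside half of the rest, about n^2 / 8, as edges; 49/400 is a safe value below
    that.\<close>
  have Elow: "real (card E) \<ge> bip_size (card V) + real t * (49/400 * n^2)"
  proof -
    have "bip_missing (card V) \<ge> bip_missing (card V - t) + t * ((card V - t) div 2 choose 2)"
      using bip_missing_add[of "card V - t" t] t_le by simp
    then have "real (bip_missing (card V - t)) + real t * real ((card V - t) div 2 choose 2) \<le> real (bip_missing (card V))"
      by (simp flip: of_nat_mult of_nat_add)
    moreover have "real t * (49/400 * n^2) \<le> real t * real ((card V - t) div 2 choose 2)"
    proof (rule mult_left_mono)
      define j where "j = (card V - t) div 2"
      have "card V - t \<le> 2 * j + 1" unfolding j_def by linarith
      then have "real (card V - t) \<le> real (2 * j + 1)" by (rule of_nat_mono)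
      then have "real j - 1 \<ge> (n - real t - 3) / 2" using t_le unfolding n_def by (simp add: of_nat_diff)
      moreover have "n - real t - 3 \<ge> 99/100 * n" using t7 n_big by simp
      ultimately have j: "real j - 1 \<ge> 99/200 * n" by simp
      then have "(99/200 * n) * (99/200 * n) \<le> real j * (real j - 1)" using n0 by (intro mult_mono) auto
      then show "49/400 * n^2 \<le> real ((card V - t) div 2 choose 2)"
        unfolding real_choose_2 j_def[symmetric] power2_eq_square using n0(2)[unfolded power2_eq_square] by linarith
    qed simp
    ultimately show ?thesis using Ecard unfolding bip_size_def by linarith
  qed
  show ?case
  proof (cases "\<exists>v\<in>V. real (card (link E v)) \<ge> (3/4 + 2/100) * n^2")
    case True
    then obtain v where v: "v \<in> V" "real (card (link E v)) \<ge> (3/4 + 2/100) * n^2" by blast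
    define V' where "V' = V - {v}"
    define E' where "E' = induced E V'"
    have V'V: "V' \<subseteq> V" unfolding V'_def by auto
    have cV': "card V' = card V - 1" unfolding V'_def using v by simp
    interpret G: three_graph V' E' unfolding E'_def using three_graph_induced[OF V'V] .
    \<comment> \<open>Suppose t copies avoid \<open>v\<close>. What remains outside them would be
      Fano-free, but it is still almost extremal and \<open>v\<close> still has a large link there,
      contrary to \<open>no_large_link\<close>.\<close>
    have "\<not> contains_disjoint_copies (t' + 1) Fano (V', E')"
    proof
      assume "contains_disjoint_copies (t' + 1) Fano (V', E')"
      then obtain U where U: "U \<subseteq> V'" "card U = 7 * t" "contains_disjoint_copies t Fano (U, induced E' U)"
        using G.packing_support[of "t' + 1" thesis] unfolding t_def by auto
      have UV: "U \<subseteq> V" "v \<in> V - U" using U(1) v unfolding V'_def by auto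
      have "induced E' U \<subseteq> induced E U" unfolding E'_def induced_def by auto
      then have "contains_disjoint_copies t Fano (U, induced E U)"
        using contains_disjoint_copies_mono[OF U(3)] by blast
      then have ff: "fano_free (induced E (V - U))"
        using extend_packing[OF _ UV(1)] free by blast
      interpret R: three_graph "V - U" "induced E (V - U)" using three_graph_induced[of "V - U"] by blast
      have finU: "finite U" using UV(1) finV finite_subset by blast
      have cR: "real (card (V - U)) = n - 7 * real t"
        using card_Diff_subset[OF finU UV(1)] card_mono[OF finV UV(1)] U(2) unfolding n_def by (simp add: of_nat_diff)
      have Rn: "real (card (V - U)) \<le> n" unfolding cR by simp
      have "real (card (V - U)) \<ge> 10^100" unfolding cR using t7 n_big by simp
      moreover have "real (card (link (induced E (V - U)) v)) \<ge> (3/4 + 1/100) * (real (card (V - U)))^2"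
      proof -
        have "real (card (link E v)) \<le> real (card (link (induced E (V - U)) v) + 2 * (card U * card V))"
          using card_link_induced[OF UV] by (rule of_nat_mono)
        then have "real (card (link E v)) \<le> real (card (link (induced E (V - U)) v)) + 2 * (7 * real t) * n"
          using U(2) unfolding n_def by simp
        moreover have "2 * (7 * real t) * n \<le> 2 * (1/1000 * n) * n"
          using t7 n0 by (intro mult_right_mono mult_left_mono) auto
        moreover have "2 * (1/1000 * n) * n = 1/500 * n^2" by (simp add: power2_eq_square)
        moreover have "(real (card (V - U)))^2 \<le> n^2" using Rn by (intro power_mono) auto
        ultimately show ?thesis using v(2) by simp
      qed
      \<comment> \<open>Deleting the 7 t covered vertices costs at most 7 t n^2 \<le> 7/10^62 n^3
        edges, well within the allowed 1/10^60 n^3. This is where the bound on t comes from.\<close>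
      moreover have "real (card (induced E (V - U))) \<ge> (1/8 - 1/10^60) * (real (card (V - U)))^3"
      proof -
        have dle: "card {e\<in>E. u \<in> e} \<le> card V * card V" for u
        proof -
          have "card (link E u) \<le> card (V \<times> V)" using link_sub finV by (intro card_mono) auto
          then show ?thesis using card_link[of u] by (simp add: card_cartesian_product)
        qed
        have "(\<Sum>u\<in>U. card {e\<in>E. u \<in> e}) \<le> card U * (card V * card V)"
          using sum_bounded_above[of U "\<lambda>u. card {e\<in>E. u \<in> e}"] dle by simp
        then have "card E \<le> card (induced E (V - U)) + 7 * t * (card V * card V)"
          using card_remove_vertices[OF UV(1)] U(2) by simp
        then have "real (card E) \<le> real (card (induced E (V - U)) + 7 * t * (card V * card V))" by (rule of_nat_mono)
        then have 1: "real (card E) \<le> real (card (induced E (V - U))) + 7 * real t * n^2"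
          unfolding n_def by (simp add: power2_eq_square)
        define k where "k = 1/10^62 * n^3"
        have k0: "k > 0" unfolding k_def using n0 by simp
        have 2: "7 * real t * n^2 \<le> 7 * k"
        proof -
          have "7 * real t * n^2 \<le> 7 * (1/10^62 * n) * n^2" using tn by (intro mult_right_mono mult_left_mono) auto
          then show ?thesis unfolding k_def by (simp add: power3_eq_cube power2_eq_square)
        qed
        have "card V \<ge> 2" using n_big unfolding n_def by simp
        then have 3: "n^3 / 8 - n^2 / 4 - n / 8 \<le> real (card E)"
          using bip_size_lower[of "card V"] Elow n0 unfolding n_def by (smt (verit) mult_nonneg_nonneg of_nat_0_le_iff zero_le_power2 divide_nonneg_pos)
        have 4: "n^2 \<le> k"
        proof -
          have "1 * n^2 \<le> (1/10^62 * n) * n^2" using n_big by (intro mult_right_mono) auto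
          then show ?thesis unfolding k_def by (simp add: power3_eq_cube power2_eq_square)
        qed
        have "n \<le> n^2" using n_big by (simp add: power2_eq_square)
        then have "real (card (induced E (V - U))) \<ge> n^3 / 8 - 100 * k" using 1 2 3 4 k0 by linarith
        also have "n^3 / 8 - 100 * k = (1/8 - 1/10^60) * n^3" unfolding k_def by (simp add: algebra_simps)
        finally have "(1/8 - 1/10^60) * n^3 \<le> real (card (induced E (V - U)))" .
        moreover have "(1/8 - 1/10^60) * (real (card (V - U)))^3 \<le> (1/8 - 1/10^60) * n^3"
          using Rn by (intro mult_left_mono power_mono) auto
        ultimately show ?thesis by linarith
      qed
      ultimately show False using R.no_large_link[OF ff UV(2)] by blast
    qed
    moreover have "real (card V') - real t' \<ge> 10^101"
      using nt cV' t_le unfolding t_def n_def by (simp add: of_nat_diff)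
    moreover have "real t' \<le> 1/10^62 * real (card V')"
    proof -
      have "real (card V') = n - 1" using cV' t_le unfolding t_def n_def by (simp add: of_nat_diff)
      then show ?thesis using tn unfolding t_def by simp
    qed
    \<comment> \<open>The trivial degree bound for \<open>v\<close> is exactly the decrease of the
      binomial, so nothing is lost in the induction.\<close>
    moreover have E'card: "card E' + bip_missing (card V' - t') \<ge> card V' choose 3"
    proof -
      have "card E = card E' + card {e\<in>E. v \<in> e}" unfolding E'_def V'_def by (rule card_remove_vertex)
      then have "card E \<le> card E' + (card V - 1 choose 2)" using card_vertex_edges_le[OF v(1)] by simp
      moreover have "card V choose 3 = (card V - 1 choose 2) + (card V - 1 choose 3)"
        using choose_3_Suc[of "card V - 1"] t_le unfolding t_def by simp
      moreover have "card V' - t' = card V - t" unfolding cV' t_def by simp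
      ultimately show ?thesis using Ecard cV' by simp
    qed
    ultimately have "extremal_structure V' E' t'" using Suc.IH[OF G.three_graph_axioms] by blast
    then obtain A B where AB: "A \<subseteq> V'" "B \<subseteq> V'" "A \<inter> B = {}" "card A = (card V - t) div 2"
      "card B = (card V - t) - (card V - t) div 2" "E' = bip_edges V' A B"
      unfolding extremal_structure_def cV' t_def by auto
    have ABV: "A \<subseteq> V" "B \<subseteq> V" using AB V'V by auto
    \<comment> \<open>Edges through \<open>v\<close> lie in neither part, since \<open>v\<close>
      belongs to neither; equality then follows by counting.\<close>
    have EB: "E \<subseteq> bip_edges V A B"
    proof
      fix e assume e: "e \<in> E"
      show "e \<in> bip_edges V A B"
      proof (cases "v \<in> e")
        case True
        then show ?thesis using e edge_sub edge_card AB(1,2) unfolding bip_edges_def V'_def by blast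
      next
        case False
        then have "e \<in> E'" using e edge_sub unfolding E'_def induced_def V'_def by blast
        then show ?thesis using AB(6) V'V unfolding bip_edges_def by blast
      qed
    qed
    have "card (bip_edges V A B) + bip_missing (card V - t) = card V choose 3"
      using card_bip_edges[OF finV ABV AB(3)] AB(4,5) unfolding bip_missing_def by simp
    then have "card (bip_edges V A B) \<le> card E" using Ecard by simp
    then have "E = bip_edges V A B" using card_seteq[OF finite_bip_edges[OF finV] EB] by simp
    then show ?thesis unfolding extremal_structure_def t_def[symmetric] using ABV AB by blast
  next
    case False
    \<comment> \<open>Take s to be the largest packing size; outside such a packing the Turan bound
      applies.\<close>
    have "\<exists>s\<le>t. contains_disjoint_copies s Fano (V, E) \<and> \<not> contains_disjoint_copies (Suc s) Fano (V, E)"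
    proof (rule ccontr)
      assume c: "\<not> ?thesis"
      have "s \<le> Suc t \<longrightarrow> contains_disjoint_copies s Fano (V, E)" for s
        by (induction s) (use c contains_disjoint_copies_0[of Fano "(V, E)"] in auto)
      then show False using free by blast
    qed
    then obtain s where s: "s \<le> t" "contains_disjoint_copies s Fano (V, E)" "\<not> contains_disjoint_copies (Suc s) Fano (V, E)" by blast
    obtain U where U: "U \<subseteq> V" "card U = 7 * s" "contains_disjoint_copies s Fano (U, induced E U)"
      by (rule packing_support[OF s(2)])
    have ff: "fano_free (induced E (V - U))" using extend_packing[OF U(3,1)] s(3) by blast
    interpret R: three_graph "V - U" "induced E (V - U)" using three_graph_induced[of "V - U"] by blast
    have finU: "finite U" using U(1) finV finite_subset by blast
    have cR: "card (V - U) + 7 * s = card V"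
      using card_Diff_subset[OF finU U(1)] card_mono[OF finV U(1)] U(2) by simp
    then have cR': "real (card (V - U)) = n - 7 * real s" unfolding n_def by (simp flip: cR)
    have s7: "7 * real s \<le> 1/1000 * n" using s(1) t7 by linarith
    have "real (card (V - U)) \<ge> 10^60" unfolding cR' using s7 n_big by simp
    then have 1: "real (card (induced E (V - U))) \<le> bip_size (card (V - U))" by (rule R.turan_fano_bound[OF ff])
    have "real (card {e\<in>E. u \<in> e}) \<le> (3/8 + 1/100) * n^2" if "u \<in> U" for u
      using False that U(1) card_link[of u] by (force simp: algebra_simps)
    then have "(\<Sum>u\<in>U. real (card {e\<in>E. u \<in> e})) \<le> real (card U) * ((3/8 + 1/100) * n^2)"
      by (rule sum_bounded_above)
    moreover have "real (card E) \<le> real (card (induced E (V - U)) + (\<Sum>u\<in>U. card {e\<in>E. u \<in> e}))"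
      using card_remove_vertices[OF U(1)] by (rule of_nat_mono)
    ultimately have 2: "real (card E) \<le> bip_size (card (V - U)) + 7 * real s * ((3/8 + 1/100) * n^2)"
      using 1 U(2) by simp
    \<comment> \<open>Returning the 7 s vertices raises the bipartite bound by nearly 3/8 n^2 each,
      while each accounts for at most (3/8 + 1/100) n^2 edges. The excess 77/1000 s n^2 is too small
      for the 49/400 t n^2 required, as s \<le> t.\<close>
    have "bip_size (card V) \<ge> bip_size (card (V - U)) + 7 * real s * (3/8 * (n - 7 * real s)^2 - n / 2)"
      using bip_size_add[of "card (V - U)" "7 * s"] unfolding cR unfolding cR' n_def[symmetric] by simp
    moreover have "7 * real s * (3/8 * (n - 7 * real s)^2 - n / 2) \<ge> 7 * real s * (3/8 * n^2 - 1/1000 * n^2)"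
    proof (rule mult_left_mono)
      have "(n - 7 * real s)^2 \<ge> n^2 - 2 * (7 * real s) * n" by (simp add: power2_eq_square algebra_simps)
      moreover have "2 * (7 * real s) * n \<le> 2 * (1/1000 * n) * n"
        using s7 n0 by (intro mult_right_mono mult_left_mono) auto
      moreover have "2 * (1/1000 * n) * n = 1/500 * n^2" by (simp add: power2_eq_square)
      moreover have "n \<le> 1/10000 * n^2"
      proof -
        have "10000 * n \<le> n * n" using n_big by (intro mult_right_mono) auto
        then show ?thesis by (simp add: power2_eq_square)
      qed
      ultimately show "3/8 * n^2 - 1/1000 * n^2 \<le> 3/8 * (n - 7 * real s)^2 - n / 2" using n0 by linarith
    qed simp
    ultimately have "real t * (49/400 * n^2) \<le> 7 * real s * ((3/8 + 1/100) * n^2) - 7 * real s * (3/8 * n^2 - 1/1000 * n^2)"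
      using 2 Elow by linarith
    also have "\<dots> = real s * (77/1000 * n^2)" by (simp add: algebra_simps)
    also have "\<dots> \<le> real t * (77/1000 * n^2)" using s(1) n0 by (intro mult_right_mono) auto
    finally have "49/400 * n^2 \<le> 77/1000 * n^2" unfolding t_def by (simp add: mult_le_cancel_left_pos)
    then have False using n0 by simp
    then show ?thesis ..
  qed
qed

section \<open>Isomorphism types of the extremal 3-graphs\<close>

lemma bip_edges_image:
  assumes f: "bij_betw f V V'" and AB: "A \<subseteq> V" "B \<subseteq> V"
  shows "(\<lambda>e. f ` e) ` bip_edges V A B = bip_edges V' (f ` A) (f ` B)"
proof -
  have inj: "inj_on f V" and im: "f ` V = V'" using f unfolding bij_betw_def by auto
  have iff: "f ` e \<in> bip_edges V' (f ` A) (f ` B) \<longleftrightarrow> e \<in> bip_edges V A B" if e: "e \<subseteq> V" for e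
  proof -
    have "f ` e \<subseteq> f ` X \<longleftrightarrow> e \<subseteq> X" if "X \<subseteq> V" for X
      using inj_on_image_mem_iff[OF inj _ that] e by blast
    moreover have "card (f ` e) = card e" using card_image inj_on_subset[OF inj e] by blast
    ultimately show ?thesis unfolding bip_edges_def using AB e im by auto
  qed
  show ?thesis
  proof (intro equalityI subsetI)
    fix e' assume "e' \<in> (\<lambda>e. f ` e) ` bip_edges V A B"
    then obtain e where "e' = f ` e" "e \<in> bip_edges V A B" by blast
    then show "e' \<in> bip_edges V' (f ` A) (f ` B)" using iff[of e] unfolding bip_edges_def by blast
  next
    fix e' assume e': "e' \<in> bip_edges V' (f ` A) (f ` B)"
    then have "e' \<subseteq> f ` V" unfolding bip_edges_def im by simp
    then obtain e where e: "e \<subseteq> V" "e' = f ` e" by (meson subset_imageE)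
    then show "e' \<in> (\<lambda>e. f ` e) ` bip_edges V A B" using iff[of e] e' by blast
  qed
qed

lemma extremal_structure_iso:
  assumes "finite V" "finite V'" "card V = card V'" "extremal_structure V E t" "extremal_structure V' E' t"
  shows "hyper_iso (V, E) (V', E')"
proof -
  obtain A B where 1: "A \<subseteq> V" "B \<subseteq> V" "A \<inter> B = {}" "card A = (card V - t) div 2"
    "card B = (card V - t) - (card V - t) div 2" "E = bip_edges V A B"
    using assms(4) unfolding extremal_structure_def by auto
  obtain A' B' where 2: "A' \<subseteq> V'" "B' \<subseteq> V'" "A' \<inter> B' = {}" "card A' = (card V' - t) div 2"
    "card B' = (card V' - t) - (card V' - t) div 2" "E' = bip_edges V' A' B'"
    using assms(5) unfolding extremal_structure_def by auto
  have fin: "finite A" "finite B" "finite A'" "finite B'" using 1 2 assms finite_subset by metis+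
  have rest: "card (X - (C \<union> D)) = card X - (card C + card D)"
    if "finite C" "finite D" "C \<subseteq> X" "D \<subseteq> X" "C \<inter> D = {}" for X C D :: "'c set"
    using that by (simp add: card_Diff_subset card_Un_disjoint)
  define R where "R = V - (A \<union> B)"
  define R' where "R' = V' - (A' \<union> B')"
  have cR: "card R = card R'"
    unfolding R_def R'_def rest[OF fin(1,2) 1(1,2,3)] rest[OF fin(3,4) 2(1,2,3)] using 1 2 assms(3) by simp
  have finR: "finite R" "finite R'" unfolding R_def R'_def using assms by auto
  obtain g1 g2 g3 where g: "bij_betw g1 A A'" "bij_betw g2 B B'" "bij_betw g3 R R'"
    using finite_same_card_bij[OF fin(1,3)] finite_same_card_bij[OF fin(2,4)] finite_same_card_bij[OF finR cR]
      1 2 assms(3) by metis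
  define f where "f x = (if x \<in> A then g1 x else if x \<in> B then g2 x else g3 x)" for x
  have fA: "bij_betw f A A'" using g(1) by (rule bij_betw_cong[THEN iffD1, rotated]) (simp add: f_def)
  have fB: "bij_betw f B B'" using g(2) 1(3) by (auto intro!: bij_betw_cong[THEN iffD1, rotated, OF g(2)] simp: f_def)
  have fR: "bij_betw f R R'" using g(3) by (rule bij_betw_cong[THEN iffD1, rotated]) (simp add: f_def R_def)
  have "bij_betw f (A \<union> B) (A' \<union> B')" using bij_betw_combine[OF fA fB 2(3)] .
  then have "bij_betw f ((A \<union> B) \<union> R) ((A' \<union> B') \<union> R')"
    using fR by (rule bij_betw_combine) (auto simp: R'_def)
  moreover have "(A \<union> B) \<union> R = V" "(A' \<union> B') \<union> R' = V'" unfolding R_def R'_def using 1 2 by auto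
  ultimately have f: "bij_betw f V V'" by simp
  moreover have "f ` A = A'" "f ` B = B'" using fA fB unfolding bij_betw_def by auto
  ultimately have "(\<lambda>e. f ` e) ` E = E'" using bip_edges_image[OF f 1(1,2)] 1(6) 2(6) by simp
  then show ?thesis unfolding hyper_iso_def using f by auto
qed

lemma iso_extremal_structure:
  assumes "finite V" "extremal_structure V E t" "hyper_iso (V, E) (V', E')"
  shows "finite V'" "card V' = card V" "extremal_structure V' E' t"
proof -
  obtain f where f: "bij_betw f V V'" "(\<lambda>e. f ` e) ` E = E'"
    using assms(3) unfolding hyper_iso_def by auto
  show fin: "finite V'" using bij_betw_finite[OF f(1)] assms(1) by simp
  show card: "card V' = card V" using bij_betw_same_card[OF f(1)] by simp
  obtain A B where 1: "A \<subseteq> V" "B \<subseteq> V" "A \<inter> B = {}" "card A = (card V - t) div 2"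
    "card B = (card V - t) - (card V - t) div 2" "E = bip_edges V A B"
    using assms(2) unfolding extremal_structure_def by auto
  have inj: "inj_on f V" and im: "f ` V = V'" using f(1) unfolding bij_betw_def by auto
  have "E' = bip_edges V' (f ` A) (f ` B)" using bip_edges_image[OF f(1) 1(1,2)] f(2) 1(6) by simp
  moreover have "f ` A \<subseteq> V'" "f ` B \<subseteq> V'" using 1 im by auto
  moreover have "f ` A \<inter> f ` B = {}" using inj_on_image_Int[OF inj 1(1,2)] 1(3) by simp
  moreover have "card (f ` A) = card A" "card (f ` B) = card B"
    using card_image inj_on_subset[OF inj] 1(1,2) by blast+
  ultimately show "extremal_structure V' E' t"
    unfolding extremal_structure_def card using 1(4,5) by metis
qed

text \<open>The right-hand side depends only on \<open>card V\<close> and \<open>t\<close>.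
  Structures on different vertex types, such as the join on a sum type, can therefore be compared
  without composing isomorphisms.\<close>

lemma iso_class_extremal_structure:
  assumes "finite V" "extremal_structure V E t"
  shows "iso_class (V, E) = {(V', E'). finite V' \<and> card V' = card V \<and> extremal_structure V' E' t}"
proof (intro equalityI subsetI)
  fix H assume "H \<in> iso_class (V, E)"
  then have "hyper_iso (V, E) (fst H, snd H)" unfolding iso_class_def by simp
  from iso_extremal_structure[OF assms this]
  show "H \<in> {(V', E'). finite V' \<and> card V' = card V \<and> extremal_structure V' E' t}" by auto
next
  fix H :: "nat hypergraph" assume "H \<in> {(V', E'). finite V' \<and> card V' = card V \<and> extremal_structure V' E' t}"
  then have H: "finite (fst H)" "card V = card (fst H)" "extremal_structure (fst H) (snd H) t" by auto
  from extremal_structure_iso[OF assms(1) H(1,2) assms(2) H(3)]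
  show "H \<in> iso_class (V, E)" unfolding iso_class_def by simp
qed

text \<open>The join lives on a sum type, whereas \<open>copies_free\<close> ranges over natural
  numbers; this supplies a competitor of the right type.\<close>

lemma extremal_structure_exists:
  assumes "t \<le> n"
  obtains E :: "nat set set" where "extremal_structure {1..n} E t"
proof -
  let ?m = "n - t"
  have "extremal_structure {1..n} (bip_edges {1..n} {1..?m div 2} {?m div 2 + 1..?m}) t"
    unfolding extremal_structure_def
    by (intro exI[of _ "{1..?m div 2}"] exI[of _ "{?m div 2 + 1..?m}"]) auto
  then show ?thesis by (rule that)
qed

lemma extremal_structure_three_graph:
  assumes "finite V" "extremal_structure V E t" shows "three_graph V E"
proof -
  obtain A B where "E = bip_edges V A B" using assms(2) unfolding extremal_structure_def by blast
  then show ?thesis using assms(1) unfolding three_graph_def bip_edges_def by auto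
qed

lemma Fano_not_two_colourable:
  assumes "\<And>e. e \<in> hedges Fano \<Longrightarrow> \<exists>x\<in>e. P x" "\<And>e. e \<in> hedges Fano \<Longrightarrow> \<exists>x\<in>e. \<not> P x"
  shows False
proof -
  have 1: "P a \<or> P b \<or> P c" "\<not> P a \<or> \<not> P b \<or> \<not> P c" if "{a, b, c} \<in> hedges Fano" for a b c
    using assms[OF that] by auto
  have "{1, 2, 3} \<in> hedges Fano" "{3, 4, 5} \<in> hedges Fano" "{5, 6, 1} \<in> hedges Fano" "{1, 7, 4} \<in> hedges Fano"
    "{2, 7, 5} \<in> hedges Fano" "{3, 7, 6} \<in> hedges Fano" "{2, 4, 6} \<in> hedges Fano"
    unfolding Fano_def by simp_all
  note this[THEN 1(1)] this[THEN 1(2)]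
  then show False by argo
qed

text \<open>Edges inside \<open>A \<union> B\<close> meet both parts, so a copy avoiding the
  remaining \<open>t\<close> vertices would two-colour the Fano plane. Disjoint copies therefore use
  different vertices of this set.\<close>

lemma extremal_structure_packing:
  assumes fin: "finite V" and ext: "extremal_structure V E t" and "t \<le> card V"
  shows "\<not> contains_disjoint_copies (t + 1) Fano (V, E)"
proof
  assume "contains_disjoint_copies (t + 1) Fano (V, E)"
  then obtain C where C: "\<And>i. i < t + 1 \<Longrightarrow> subhypergraph (C i) (V, E)"
    "\<And>i. i < t + 1 \<Longrightarrow> hyper_iso Fano (C i)" "disjoint_family_on (\<lambda>i. hverts (C i)) {..<t + 1}"
    unfolding contains_disjoint_copies_def by auto
  obtain A B where AB: "A \<subseteq> V" "B \<subseteq> V" "A \<inter> B = {}" "card A = (card V - t) div 2"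
    "card B = (card V - t) - (card V - t) div 2" "E = bip_edges V A B"
    using ext unfolding extremal_structure_def by auto
  define T where "T = V - (A \<union> B)"
  have finT: "finite T" "finite A" "finite B" unfolding T_def using fin AB finite_subset by auto
  have cT: "card T = t"
    unfolding T_def using AB finT assms(3) by (simp add: card_Diff_subset card_Un_disjoint)
  have "\<exists>x. x \<in> hverts (C i) \<inter> T" if i: "i < t + 1" for i
  proof (rule ccontr)
    assume "\<nexists>x. x \<in> hverts (C i) \<inter> T"
    then have sub: "hverts (C i) \<subseteq> A \<union> B" using C(1)[OF i] unfolding T_def subhypergraph_def by auto
    obtain f where f: "bij_betw f (hverts Fano) (hverts (C i))" "(\<lambda>e. f ` e) ` hedges Fano = hedges (C i)"
      using C(2)[OF i] unfolding hyper_iso_def by auto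
    have "\<exists>x\<in>e. f x \<in> A" "\<exists>x\<in>e. \<not> f x \<in> A" if e: "e \<in> hedges Fano" for e
    proof -
      have "f ` e \<in> hedges (C i)" using e f(2) by blast
      then have "f ` e \<in> bip_edges V A B" using C(1)[OF i] AB(6) unfolding subhypergraph_def by auto
      then have "\<not> f ` e \<subseteq> A" "\<not> f ` e \<subseteq> B" unfolding bip_edges_def by auto
      moreover have "e \<subseteq> hverts Fano" using e unfolding Fano_def by auto
      then have "f ` e \<subseteq> A \<union> B" using f(1) sub unfolding bij_betw_def by blast
      ultimately show "\<exists>x\<in>e. f x \<in> A" "\<exists>x\<in>e. \<not> f x \<in> A" by blast+
    qed
    then show False by (rule Fano_not_two_colourable)
  qed
  then obtain g where g: "\<And>i. i < t + 1 \<Longrightarrow> g i \<in> hverts (C i) \<inter> T" by metis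
  have "inj_on g {..<t + 1}"
    using g C(3) unfolding inj_on_def disjoint_family_on_def by (metis IntI Int_iff empty_iff lessThan_iff)
  moreover have "g ` {..<t + 1} \<subseteq> T" using g by auto
  ultimately have "card {..<t + 1} \<le> card T" using card_inj_on_le finT(1) by blast
  then show False using cT by simp
qed

text \<open>The parts are the two halves of the right summand, and the left summand is the set
  outside both, whose triples are all present.\<close>

lemma hjoin_extremal_structure:
  fixes t m :: nat
  defines "J \<equiv> hjoin 3 (complete_rgraph 3 t) (B3 m)"
  shows "finite (hverts J)" "card (hverts J) = t + m" "extremal_structure (hverts J) (hedges J) t"
proof -
  have V: "hverts J = {1..t} <+> {1..m}" unfolding J_def hjoin_def complete_rgraph_def B3_def by simp
  then show "finite (hverts J)" by simp
  show card: "card (hverts J) = t + m" unfolding V by (simp add: card_Plus)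
  define A :: "(nat + nat) set" where "A = Inr ` {1..m div 2}"
  define B :: "(nat + nat) set" where "B = Inr ` {m div 2 + 1..m}"
  have halves: "{1..m} = {1..m div 2} \<union> {m div 2 + 1..m}" by auto
  have edges: "hedges J = (\<lambda>e. Inl ` e) ` {e. e \<subseteq> {1..t} \<and> card e = 3}
      \<union> (\<lambda>e. Inr ` e) ` {e. e \<subseteq> {1..m} \<and> card e = 3 \<and> e \<inter> {1..m div 2} \<noteq> {} \<and> e \<inter> {m div 2 + 1..m} \<noteq> {}}
      \<union> {e. e \<subseteq> {1..t} <+> {1..m} \<and> card e = 3 \<and> e \<inter> Inl ` {1..t} \<noteq> {} \<and> e \<inter> Inr ` {1..m} \<noteq> {}}"
    unfolding J_def hjoin_def complete_rgraph_def B3_def by simp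
  have "hedges J = bip_edges (hverts J) A B"
  proof (intro equalityI subsetI)
    fix e assume "e \<in> hedges J"
    then consider e' where "e = Inl ` e'" "e' \<subseteq> {1..t}" "card e' = 3"
      | e' where "e = Inr ` e'" "e' \<subseteq> {1..m}" "card e' = 3" "e' \<inter> {1..m div 2} \<noteq> {}" "e' \<inter> {m div 2 + 1..m} \<noteq> {}"
      | "e \<subseteq> {1..t} <+> {1..m}" "card e = 3" "e \<inter> Inl ` {1..t} \<noteq> {}"
      unfolding edges by blast
    then show "e \<in> bip_edges (hverts J) A B"
    proof cases
      case 1
      then have "e' \<noteq> {}" by auto
      then show ?thesis using 1 unfolding bip_edges_def V A_def B_def
        by (auto simp: card_image Plus_def)
    next
      case 2
      then show ?thesis unfolding bip_edges_def V A_def B_def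
        by (auto simp: card_image Plus_def inj_image_subset_iff)
    next
      case 3
      then show ?thesis unfolding bip_edges_def V A_def B_def by auto
    qed
  next
    fix e assume "e \<in> bip_edges (hverts J) A B"
    then have e: "e \<subseteq> {1..t} <+> {1..m}" "card e = 3" "\<not> e \<subseteq> A" "\<not> e \<subseteq> B"
      unfolding bip_edges_def V by auto
    consider "e \<inter> Inl ` {1..t} \<noteq> {}" "e \<inter> Inr ` {1..m} \<noteq> {}" | "e \<inter> Inr ` {1..m} = {}" | "e \<inter> Inl ` {1..t} = {}" by blast
    then show "e \<in> hedges J"
    proof cases
      case 1
      then show ?thesis using e unfolding edges by blast
    next
      case 2
      then have "e \<subseteq> Inl ` {1..t}" using e(1) unfolding Plus_def by blast
      then obtain e' where e': "e' \<subseteq> {1..t}" "e = Inl ` e'" by (meson subset_imageE)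
      then have "card e' = 3" using e(2) by (simp add: card_image)
      then show ?thesis using e' unfolding edges by blast
    next
      case 3
      then have "e \<subseteq> Inr ` {1..m}" using e(1) unfolding Plus_def by blast
      then obtain e' where e': "e' \<subseteq> {1..m}" "e = Inr ` e'" by (meson subset_imageE)
      then have "card e' = 3" using e(2) by (simp add: card_image)
      moreover have "\<not> e' \<subseteq> {1..m div 2}" "\<not> e' \<subseteq> {m div 2 + 1..m}"
        using e(3,4) e'(2) unfolding A_def B_def by blast+
      then have "e' \<inter> {m div 2 + 1..m} \<noteq> {}" "e' \<inter> {1..m div 2} \<noteq> {}"
        using e'(1) unfolding halves by blast+
      ultimately show ?thesis using e' unfolding edges by blast
    qed
  qed
  moreover have "A \<subseteq> hverts J" "B \<subseteq> hverts J" "A \<inter> B = {}" unfolding A_def B_def V by auto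
  moreover have "card A = m div 2" "card B = m - m div 2" unfolding A_def B_def by (simp_all add: card_image)
  ultimately show "extremal_structure (hverts J) (hedges J) t"
    unfolding extremal_structure_def card by (intro exI[of _ A] exI[of _ B]) simp
qed

theorem theorem2p2:
  shows "\<exists>(N0 :: nat) (c :: real). c > 0 \<and>
    (\<forall>(n :: nat) (t :: nat). n \<ge> N0 \<and> real t \<le> c * real n \<longrightarrow>
       Extremal 3 n (t + 1) Fano = {iso_class (hjoin 3 (complete_rgraph 3 t) (B3 (n - t)))})"
proof (intro exI conjI allI impI)
  \<comment> \<open>The constant is the one from \<open>packing_extremal\<close>; n \<ge> 10^102
    ensures n - t \<ge> 10^101.\<close>
  show "(1/10^62 :: real) > 0" by simp
  fix n t :: nat
  assume nt: "10^102 \<le> n \<and> real t \<le> 1/10^62 * real n"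
  have "real (10^102) \<le> real n" using nt of_nat_le_iff by blast
  then have n: "real n \<ge> 10^102" by simp
  have tn: "real t \<le> 1/10^62 * real n" using nt by blast
  have "real t \<le> 1/10 * real n" using tn n by simp
  then have t_le: "t \<le> n" and gap: "real n - real t \<ge> 10^101" using n by auto
  define J where "J = hjoin 3 (complete_rgraph 3 t) (B3 (n - t))"
  have J: "finite (hverts J)" "card (hverts J) = n" "extremal_structure (hverts J) (hedges J) t"
    using hjoin_extremal_structure[of t "n - t"] t_le unfolding J_def by simp_all
  have class_eq: "iso_class (V, E) = iso_class J"
    if "finite V" "card V = n" "extremal_structure V E t" for V and E :: "nat set set"
    using iso_class_extremal_structure[OF that(1,3)] iso_class_extremal_structure[OF J(1,3)] that(2) J(2) by simp
  obtain E0 :: "nat set set" where E0: "extremal_structure {1..n} E0 t" using extremal_structure_exists[OF t_le] by blast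
  let ?S = "{G \<in> copies_free 3 n (t + 1) Fano. \<forall>H \<in> copies_free 3 n (t + 1) Fano. card (hedges H) \<le> card (hedges G)}"
  have G0: "({1..n}, E0) \<in> copies_free 3 n (t + 1) Fano"
    using extremal_structure_three_graph[OF _ E0] extremal_structure_packing[OF _ E0] t_le
    unfolding copies_free_def rgraph_3_iff[symmetric] by simp
  have card0: "card E0 + bip_missing (n - t) = n choose 3"
    using extremal_structure_card[OF _ E0] by simp
  \<comment> \<open>A competitor with at least as many edges as \<open>E0\<close> has the extremal
    structure and hence exactly as many. This yields both the maximality of \<open>E0\<close> and
    uniqueness.\<close>
  have struct: "extremal_structure V E t"
    if "(V, E) \<in> copies_free 3 n (t + 1) Fano" "card E0 \<le> card E" for V E
  proof (rule packing_extremal)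
    show "three_graph V E" "\<not> contains_disjoint_copies (t + 1) Fano (V, E)"
      using that(1) unfolding copies_free_def rgraph_3_iff[symmetric] by auto
    have "card V = n" using that(1) unfolding copies_free_def by simp
    then show "10^101 \<le> real (card V) - real t" "real t \<le> 1/10^62 * real (card V)"
      "card V choose 3 \<le> card E + bip_missing (card V - t)"
      using gap tn card0 that(2) by auto
  qed
  have fin: "finite V" "card V = n" if "(V, E) \<in> copies_free 3 n (t + 1) Fano" for V E
    using that unfolding copies_free_def rgraph_def by auto
  have "card E \<le> card E0" if H: "(V, E) \<in> copies_free 3 n (t + 1) Fano" for V E
  proof (rule ccontr)
    assume c: "\<not> ?thesis"
    then have "extremal_structure V E t" using struct[OF H] by simp
    from extremal_structure_card[OF fin(1)[OF H] this] show False using c card0 fin(2)[OF H] by simp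
  qed
  then have "({1..n}, E0) \<in> ?S" using G0 by auto
  moreover have "iso_class G = iso_class J" if G: "G \<in> ?S" for G
  proof -
    obtain V E where VE: "G = (V, E)" by (cases G)
    have H: "(V, E) \<in> copies_free 3 n (t + 1) Fano" "card E0 \<le> card E" using G G0 VE by auto
    show ?thesis unfolding VE using class_eq[OF fin[OF H(1)] struct[OF H]] .
  qed
  ultimately have "iso_class ` ?S = {iso_class J}" by blast
  then show "Extremal 3 n (t + 1) Fano = {iso_class (hjoin 3 (complete_rgraph 3 t) (B3 (n - t)))}"
    unfolding Extremal_def J_def .
qed

end
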